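(* Let $\mathcal X$ be the GK curve, let $\tilde m,\tilde s\in\mathbb N$ (where $\tilde s=0$ is allowed), and let $c_0=0,c_1,\ldots,c_{\tilde s}$ be $\tilde s+1$ distinct elements of $\Gamma_0$. Let $\tilde{\mathcal G}=\left(\bigcup_{i=0}^{\tilde s}(\mathcal X\cap\zeta_{c_i})\right)\setminus\{P_\infty\}$, $\tilde{\mathcal D}=\mathcal X(\mathbb F_{q^6})\setminus\tilde{\mathcal G}$, $\tilde G=\sum_{P\in\tilde{\mathcal G}}\tilde mP$, $\tilde D=\sum_{P\in\tilde{\mathcal D}}P$, and let $\tilde k$ be the dimension over $\mathbb F_{q^6}$ of the functional AG code $\tilde C=C_{\mathcal L}(\tilde D,\tilde G)$. If $$\frac{q^5-2q^3+q^2-1}{(\tilde s+1)q^3}\le\tilde m\le\frac{q^5-q^3+q^2}{\tilde s+1}-1,$$ then $$\tilde k=\tilde m(\tilde s+1)q^3-\frac12\left(q^5-2q^3+q^2-2\right).$$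
   Context: Let $q$ be a prime power. The GK curve $\mathcal X$ is the non-singular projective curve in $PG(3,\overline{\mathbb F}_q)$ defined by the affine equations $Y^{q+1}=X^q+X$, $Z^{q^2-q+1}=Y^{q^2}-Y$. It has a unique point at infinity $P_\infty$, which is $\mathbb F_{q^2}$-rational, genus $g=\frac{q^5-2q^3+q^2}{2}$, and $|\mathcal X(\mathbb F_{q^6})|=q^8-q^6+q^5+1$, where $\mathcal X(\mathbb F_{q^6})$ is the set of $\mathbb F_{q^6}$-rational points. For $c\in\mathbb F_{q^6}$, $\zeta_c$ is the plane with affine equation $Z=c$ (it contains $P_\infty$). $\Gamma=\{c\in\mathbb F_{q^6} : c^{(q^3+1)(q^2-1)}+c^{(q^3+1)(q^2-q)}+1=0\}$ and $\Gamma_0=\Gamma\cup\{0\}$; for $c\in\Gamma_0$ the set $\mathcal X\cap\zeta_c$ consists of $q^3+1$ $\mathbb F_{q^6}$-rational points, $P_\infty$ included. Thus $\deg\tilde G=\tilde m(\tilde s+1)q^3$ and $\deg\tilde D=q^8-q^6+q^5-(\tilde s+1)q^3+1$. Functional code: for an $\mathbb F_{q^6}$-rational divisor $G$, $\mathcal L(G)=\{f\in\mathbb F_{q^6}(\mathcal X)\setminus\{0\}: (f)+G\ge 0\}\cup\{0\}$. For $D=P_1+\cdots+P_n$ with distinct $\mathbb F_{q^6}$-rational $P_i$ not in $\mathrm{supp}(G)$, $C_{\mathcal L}(D,G)=\{(f(P_1),\ldots,f(P_n)) : f\in\mathcal L(G)\}\subseteq\mathbb F_{q^6}^n$. *)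

theory Defs
  imports
    "HOL-Library.Poly_Mapping"
    "HOL-Library.Function_Algebras"
    "HOL-Analysis.Cartesian_Space"
    "HOL-Algebra.Algebraic_Closure_Type"
    "HOL-Number_Theory.Prime_Powers"
begin

section \<open>Projective space and forms\<close>

definition proportional :: "(('a::field ^ 'n) \<times> ('a ^ 'n)) set" where
  "proportional = {(v, w). v \<noteq> 0 \<and> w \<noteq> 0 \<and> (\<exists>a. a \<noteq> 0 \<and> w = a *s v)}"

text \<open>A projective point is the set of all its homogeneous coordinate vectors.\<close>

type_synonym ('a, 'n) point = "('a ^ 'n) set"

definition proj_space :: "('a::field, 'n::finite) point set" where
  "proj_space = (UNIV - {0}) // proportional"

text \<open>Polynomials over \<open>'a\<close> in variables indexed by \<open>'n\<close>: a monomial is its exponent vector.\<close>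

type_synonym ('a, 'n) mpoly = "('n \<Rightarrow>\<^sub>0 nat) \<Rightarrow>\<^sub>0 'a"

definition eval :: "('a::field, 'n::finite) mpoly \<Rightarrow> 'a ^ 'n \<Rightarrow> 'a" where
  "eval F v =
     (\<Sum>m\<in>Poly_Mapping.keys F. Poly_Mapping.lookup F m * (\<Prod>i\<in>UNIV. (v $ i) ^ Poly_Mapping.lookup m i))"

definition homogeneous :: "nat \<Rightarrow> ('a::field, 'n::finite) mpoly \<Rightarrow> bool" where
  "homogeneous d F \<longleftrightarrow> (\<forall>m\<in>Poly_Mapping.keys F. (\<Sum>i\<in>UNIV. Poly_Mapping.lookup m i) = d)"

definition vanishes_at :: "('a::field, 'n::finite) point \<Rightarrow> ('a, 'n) mpoly \<Rightarrow> bool" where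
  "vanishes_at P F \<longleftrightarrow> (\<forall>v\<in>P. eval F v = 0)"

text \<open>Zariski closure in projective space of the points with coordinate vectors in \<open>S\<close>.\<close>

definition proj_closure :: "('a::field ^ 'n::finite) set \<Rightarrow> ('a, 'n) point set" where
  "proj_closure S = {P \<in> proj_space.
     \<forall>d F. homogeneous d F \<and> (\<forall>v\<in>S. eval F v = 0) \<longrightarrow> vanishes_at P F}"

section \<open>Function field, local rings and valuations of a projective curve\<close>

text \<open>
  \<open>C\<close> is an irreducible projective curve over an algebraically closed field, given as a set of
  points. A rational function on \<open>C\<close> is a class of fractions \<open>A / B\<close> of forms of equal degree,
  \<open>B\<close> not vanishing identically on \<open>C\<close>, two fractions being identified if their
  cross-multiplied difference vanishes on \<open>C\<close>.
\<close>

type_synonym ('a, 'n) ratfun = "(('a, 'n) mpoly \<times> ('a, 'n) mpoly) set"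

definition fractions ::
  "('a::field, 'n::finite) point set \<Rightarrow> (('a, 'n) mpoly \<times> ('a, 'n) mpoly) set" where
  "fractions C = {(A, B). (\<exists>d. homogeneous d A \<and> homogeneous d B) \<and> \<not> (\<forall>P\<in>C. vanishes_at P B)}"

definition fraction_rel ::
  "('a::field, 'n::finite) point set \<Rightarrow>
   ((('a, 'n) mpoly \<times> ('a, 'n) mpoly) \<times> (('a, 'n) mpoly \<times> ('a, 'n) mpoly)) set"
  where
  "fraction_rel C = {((A, B), (A', B')).
     (A, B) \<in> fractions C \<and> (A', B') \<in> fractions C \<and> (\<forall>P\<in>C. vanishes_at P (A * B' - A' * B))}"

definition function_field ::
  "('a::field, 'n::finite) point set \<Rightarrow> ('a, 'n) ratfun ring" where
  "function_field C = \<lparr>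
     carrier = fractions C // fraction_rel C,
     monoid.mult = (\<lambda>f g. \<Union>(A, B)\<in>f. \<Union>(A', B')\<in>g. fraction_rel C `` {(A * A', B * B')}),
     one = fraction_rel C `` {(1, 1)},
     ring.zero = fraction_rel C `` {(0, 1)},
     add = (\<lambda>f g. \<Union>(A, B)\<in>f. \<Union>(A', B')\<in>g. fraction_rel C `` {(A * B' + A' * B, B * B')})\<rparr>"

definition local_ring ::
  "('a::field, 'n::finite) point set \<Rightarrow> ('a, 'n) point \<Rightarrow> ('a, 'n) ratfun set" where
  "local_ring C P = {f \<in> carrier (function_field C). \<exists>(A, B)\<in>f. \<not> vanishes_at P B}"

definition maximal_ideal_at ::
  "('a::field, 'n::finite) point set \<Rightarrow> ('a, 'n) point \<Rightarrow> ('a, 'n) ratfun set" where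
  "maximal_ideal_at C P =
     {f \<in> carrier (function_field C). \<exists>(A, B)\<in>f. \<not> vanishes_at P B \<and> vanishes_at P A}"

definition value_at :: "('a::field, 'n::finite) point \<Rightarrow> ('a, 'n) ratfun \<Rightarrow> 'a" where
  "value_at P f = (THE c. \<exists>(A, B)\<in>f. \<exists>v\<in>P. eval B v \<noteq> 0 \<and> c = eval A v / eval B v)"

definition uniformizer ::
  "('a::field, 'n::finite) point set \<Rightarrow> ('a, 'n) point \<Rightarrow> ('a, 'n) ratfun \<Rightarrow> bool" where
  "uniformizer C P t \<longleftrightarrow> t \<in> maximal_ideal_at C P \<and>
     maximal_ideal_at C P = {t \<otimes>\<^bsub>function_field C\<^esub> h | h. h \<in> local_ring C P}"

text \<open>The valuation at a non-singular point \<open>P\<close>; meaningful only for nonzero \<open>f\<close>.\<close>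

definition ord_at ::
  "('a::field, 'n::finite) point set \<Rightarrow> ('a, 'n) point \<Rightarrow> ('a, 'n) ratfun \<Rightarrow> int" where
  "ord_at C P f = (THE n::int. \<exists>t u. uniformizer C P t \<and>
     u \<in> local_ring C P - maximal_ideal_at C P \<and>
     f = u \<otimes>\<^bsub>function_field C\<^esub> (t [^]\<^bsub>function_field C\<^esub> n))"

section \<open>Rationality over a subfield and functional codes\<close>

text \<open>
  From here on the curve \<open>C\<close> lives over the algebraic closure of the field \<open>'k\<close>, and
  rationality means rationality over \<open>'k\<close>.
\<close>

definition rational_points ::
  "('k::field alg_closure, 'n::finite) point set \<Rightarrow> ('k alg_closure, 'n) point set" where
  "rational_points C = {P \<in> C. \<exists>v\<in>P. \<forall>i. v $ i \<in> range to_ac}"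

definition rational_functions ::
  "('k::field alg_closure, 'n::finite) point set \<Rightarrow> ('k alg_closure, 'n) ratfun set" where
  "rational_functions C = {f \<in> carrier (function_field C).
     \<exists>(A, B)\<in>f. (\<forall>m. Poly_Mapping.lookup A m \<in> range to_ac) \<and>
                (\<forall>m. Poly_Mapping.lookup B m \<in> range to_ac)}"

type_synonym ('a, 'n) divisor = "('a, 'n) point \<Rightarrow>\<^sub>0 int"

definition riemann_roch_space ::
  "('k::field alg_closure, 'n::finite) point set \<Rightarrow> ('k alg_closure, 'n) divisor \<Rightarrow>
   ('k alg_closure, 'n) ratfun set" where
  "riemann_roch_space C G =
     {f \<in> rational_functions C. f \<noteq> \<zero>\<^bsub>function_field C\<^esub> \<and>
        (\<forall>P\<in>C. ord_at C P f + Poly_Mapping.lookup G P \<ge> 0)} \<union> {\<zero>\<^bsub>function_field C\<^esub>}"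

text \<open>
  The coordinates of a code word are indexed by the points of the support of \<open>D\<close> themselves
  instead of by an enumeration of them; words are extended by \<open>0\<close> off that support.
  At rational points the value of a rational function lies in \<open>'k\<close>, and \<open>of_ac\<close> transports it
  from the algebraic closure back to \<open>'k\<close>.
\<close>

definition functional_code ::
  "('k::field alg_closure, 'n::finite) point set \<Rightarrow>
   ('k alg_closure, 'n) divisor \<Rightarrow> ('k alg_closure, 'n) divisor \<Rightarrow>
   (('k alg_closure, 'n) point \<Rightarrow> 'k) set" where
  "functional_code C D G =
     (\<lambda>f P. if P \<in> Poly_Mapping.keys D then of_ac (value_at P f) else 0) ` riemann_roch_space C G"

lemma vector_space_words: "vector_space (\<lambda>(a::'k::field) (w::'i \<Rightarrow> 'k) i. a * w i)"
  by unfold_locales (auto simp: fun_eq_iff algebra_simps)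

definition code_dimension :: "('i \<Rightarrow> 'k::field) set \<Rightarrow> nat" where
  "code_dimension W = vector_space.dim (\<lambda>(a::'k) (w::'i \<Rightarrow> 'k) i. a * w i) W"

section \<open>The GK curve\<close>

text \<open>Homogeneous coordinates are \<open>(X : Y : Z : T)\<close>, the plane at infinity being \<open>T = 0\<close>.\<close>

definition GK_curve :: "nat \<Rightarrow> ('a::field, 4) point set" where
  "GK_curve q = proj_closure {vector [x, y, z, 1] | x y z.
     y ^ (q + 1) = x ^ q + x \<and> z ^ (q\<^sup>2 - q + 1) = y ^ (q\<^sup>2) - y}"

definition GK_infinity :: "nat \<Rightarrow> ('a::field, 4) point" where
  "GK_infinity q = (THE P. P \<in> GK_curve q \<and> (\<forall>v\<in>P. v $ 4 = 0))"

definition plane_Z :: "'a::field \<Rightarrow> ('a, 4) point set" where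
  "plane_Z c = {P \<in> proj_space. \<forall>v\<in>P. v $ 3 = c * v $ 4}"

definition GK_Gamma :: "nat \<Rightarrow> 'k::field set" where
  "GK_Gamma q = {c. c ^ ((q ^ 3 + 1) * (q\<^sup>2 - 1)) + c ^ ((q ^ 3 + 1) * (q\<^sup>2 - q)) + 1 = 0}"

definition GK_Gamma0 :: "nat \<Rightarrow> 'k::field set" where
  "GK_Gamma0 q = GK_Gamma q \<union> {0}"

end

theory Submission
  imports Defs
begin

text \<open>
  The code has dimension \<open>deg G + 1 - g\<close>, as the Riemann--Roch theorem predicts for
  \<open>2 g - 2 < deg G < deg D\<close>. On this curve the theorem is not needed, because all the functions
  involved can be written down.

  \<^bold>\<open>The function field.\<close> At the point at infinity the coordinate functions \<open>x\<close>, \<open>y\<close>, \<open>z\<close> have poles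
  of orders \<open>q^3 + 1\<close>, \<open>q^3 - q^2 + q\<close> and \<open>q^3\<close>. Their expansions in a parameter \<open>t\<close> with
  \<open>x = t^-(q^3 + 1)\<close> only need the extraction of roots of degree prime to the characteristic, of
  power series with constant term \<open>1\<close> (\<open>gk_series_exist\<close>). So the function field is
  treated as a field of Laurent series over the algebraic closure: \<open>cls \<phi>\<close> is the class of
  fractions of forms with expansion \<open>\<phi>\<close>, and its order at infinity is the order of the series \<open>\<phi>\<close>
  (\<open>ord_inf\<close>).

  \<^bold>\<open>The affine coordinate ring.\<close> Over the polynomials in \<open>z\<close> the coordinate ring is spanned by the
  \<open>q^3\<close> monomials \<open>x^i y^j\<close> with \<open>i < q\<close> and \<open>j < q^2\<close> (\<open>normal_form\<close>). The pole orders of the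
  monomials \<open>x^i y^j z^k\<close> with these \<open>i\<close>, \<open>j\<close> are pairwise distinct (\<open>gk_weight_inj\<close>), so they form
  a basis over the field of constants, and the functions with a pole of order at most \<open>N\<close> at
  infinity and no other pole are the combinations of the monomials of weight at most \<open>N\<close>.
  The equations \<open>y^(q^2) - y = z^(q^2 - q + 1)\<close> and \<open>x^q + x = y^(q + 1)\<close> are of Artin--Schreier type:
  every fibre \<open>z = c\<close> has \<open>q^3\<close> points, a function vanishing on it is divisible by \<open>z - c\<close>
  (\<open>fibre_divisible\<close>), and \<open>z - c\<close> is a local parameter at each of its points
  (\<open>affine_uniformizer\<close>). As every function divides a polynomial in \<open>z\<close> (\<open>norm_exists\<close>), it
  follows that a function without affine poles is a polynomial in \<open>x\<close>, \<open>y\<close>, \<open>z\<close>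
  (\<open>regular_on_affine\<close>).

  \<^bold>\<open>The Riemann--Roch space.\<close> On the affine curve \<open>G\<close> is the divisor of zeros of
  \<open>h = (\<Prod>i. z - c i)^m\<close>, and \<open>h\<close> has a pole of order \<open>N = deg G = m (s + 1) q^3\<close> at infinity.
  Hence the space of \<open>G\<close> consists of the quotients by \<open>h\<close> of the combinations of the basis monomials
  of weight at most \<open>N\<close>; the coefficients are rational if the function is, by comparison with its
  Frobenius power (\<open>expansion_rational\<close>). The number of these monomials is computed from the fact
  that the weights of the \<open>x^i y^j\<close> represent all residues modulo \<open>q^3\<close> (\<open>card_basis\<close>).

  \<^bold>\<open>Injectivity of the evaluation.\<close> For \<open>c \<in> \<Gamma>\<^sub>0\<close> all \<open>q^3\<close> points of the fibre \<open>z = c\<close> are rational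
  (\<open>fibre_rational\<close>), and \<open>\<Gamma>\<^sub>0\<close> has at least \<open>q^5 - q^3 + q^2\<close> elements (\<open>card_Gamma0_ge\<close>). A function
  in the space of \<open>G\<close> that vanishes at all points of \<open>D\<close> thus has a numerator divisible by
  \<open>z - d\<close> for at least \<open>q^5 - q^3 + q^2 - (s + 1)\<close> values \<open>d\<close>, which is at least \<open>m (s + 1)\<close>, and hence
  has a pole of order at least \<open>N\<close> unless it is \<open>0\<close>; as the function also vanishes at infinity, the
  order is less than \<open>N\<close> (\<open>words_independent\<close>).
\<close>

unbundle no fps_syntax

section \<open>Auxiliary facts on power series, polynomials and linear algebra\<close>

lemma power_sum_linear:
  fixes a h :: "'a::comm_ring_1"
  shows "\<exists>r. (a + h) ^ n = a ^ n + of_nat n * a ^ (n - 1) * h + h\<^sup>2 * r"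
proof (induction n)
  case 0
  show ?case by (intro exI[of _ 0]) simp
next
  case (Suc n)
  then obtain r where r: "(a + h) ^ n = a ^ n + of_nat n * a ^ (n - 1) * h + h\<^sup>2 * r" by blast
  have *: "a * (of_nat n * a ^ (n - 1)) = of_nat n * a ^ n" by (cases n) simp_all
  have "(a + h) ^ Suc n = a ^ Suc n + (a * (of_nat n * a ^ (n - 1)) + a ^ n) * h
      + h\<^sup>2 * (of_nat n * a ^ (n - 1) + a * r + h * r)"
    by (simp add: r algebra_simps power2_eq_square)
  also have "\<dots> = a ^ Suc n + of_nat (Suc n) * a ^ (Suc n - 1) * h
      + h\<^sup>2 * (of_nat n * a ^ (n - 1) + a * r + h * r)"
    by (simp only: *) (simp add: algebra_simps)
  finally show ?case by blast
qed

lemma fps_power_nth_cong: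
  fixes f g :: "'a::comm_ring_1 fps"
  assumes "\<And>i. i \<le> k \<Longrightarrow> fps_nth f i = fps_nth g i" and "i \<le> k"
  shows "fps_nth (f ^ n) i = fps_nth (g ^ n) i"
  using assms(2)
proof (induction n arbitrary: i)
  case (Suc n)
  then show ?case by (auto simp: fps_mult_nth assms(1) intro!: sum.cong)
qed simp

text \<open>Newton iteration, one coefficient at a time.\<close>

lemma fps_nth_root_exists:
  fixes f :: "'a::field fps"
  assumes f0: "fps_nth f 0 = 1" and n: "of_nat n \<noteq> (0 :: 'a)"
  obtains g where "fps_nth g 0 = 1" and "g ^ n = f"
proof -
  define G where "G = rec_nat (1 :: 'a fps) (\<lambda>k g. g +
    fps_const ((fps_nth f (Suc k) - fps_nth (g ^ n) (Suc k)) / of_nat n) * fps_X ^ Suc k)"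
  have G0: "G 0 = 1"
    and GS: "G (Suc k) = G k +
      fps_const ((fps_nth f (Suc k) - fps_nth (G k ^ n) (Suc k)) / of_nat n) * fps_X ^ Suc k" for k
    by (simp_all add: G_def)
  have agree1: "fps_nth (G (Suc k)) i = fps_nth (G k) i" if "i \<le> k" for i k
    using that by (simp add: GS fps_X_power_mult_right_nth del: power_Suc)
  have agree: "fps_nth (G (k + d)) i = fps_nth (G k) i" if "i \<le> k" for i k d
    using that by (induction d) (simp_all add: agree1)
  have lead: "fps_nth (G k) 0 = 1" for k
    using agree[of 0 0 k] by (simp add: G0)
  have pow: "fps_nth (G k ^ n) i = fps_nth f i" if "i \<le> k" for i k
    using that
  proof (induction k arbitrary: i)
    case 0
    then show ?case by (simp add: G0 f0)
  next
    case (Suc k)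
    show ?case
    proof (cases "i = Suc k")
      case False
      with Suc.prems have "i \<le> k" by simp
      then show ?thesis
        using Suc.IH fps_power_nth_cong[of k "G (Suc k)" "G k" i n] agree1 by simp
    next
      case True
      define c where "c = (fps_nth f (Suc k) - fps_nth (G k ^ n) (Suc k)) / of_nat n"
      define h where "h = fps_const c * fps_X ^ Suc k"
      obtain r where r: "(G k + h) ^ n = G k ^ n + of_nat n * G k ^ (n - 1) * h + h\<^sup>2 * r"
        using power_sum_linear by blast
      have hr: "h\<^sup>2 * r = fps_X ^ (Suc k + Suc k) * (fps_const c ^ 2 * r)"
        by (simp only: h_def power_mult_distrib power_add[symmetric] power_mult[symmetric]
            mult.commute mult.left_commute mult_2_right)
      have 1: "fps_nth (h\<^sup>2 * r) (Suc k) = 0"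
        by (subst hr, subst fps_X_power_mult_nth) simp
      have hn: "of_nat n * G k ^ (n - 1) * h = fps_const (of_nat n * c) * G k ^ (n - 1) * fps_X ^ Suc k"
        by (simp add: h_def algebra_simps fps_of_nat[symmetric] fps_const_mult[symmetric]
            del: power_Suc fps_const_mult)
      have 2: "fps_nth (of_nat n * G k ^ (n - 1) * h) (Suc k) = of_nat n * c"
        by (subst hn, subst fps_X_power_mult_right_nth) (simp add: lead fps_power_zeroth)
      have "fps_nth (G (Suc k) ^ n) (Suc k) = fps_nth (G k ^ n) (Suc k) + of_nat n * c"
        unfolding GS c_def[symmetric] h_def[symmetric] r by (simp only: fps_add_nth 1 2 add_0_right)
      also have "\<dots> = fps_nth f (Suc k)" using n by (simp add: c_def)
      finally show ?thesis using True by simp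
    qed
  qed
  define g where "g = Abs_fps (\<lambda>k. fps_nth (G k) k)"
  have gG: "fps_nth g i = fps_nth (G k) i" if "i \<le> k" for i k
    using agree[of i i "k - i"] that by (simp add: g_def)
  have "fps_nth (g ^ n) k = fps_nth f k" for k
    using fps_power_nth_cong[of k g "G k" k n] gG pow[of k k] by simp
  then have "g ^ n = f" by (simp add: fps_eq_iff)
  moreover have "fps_nth g 0 = 1" by (simp add: g_def lead)
  ultimately show ?thesis using that by blast
qed

text \<open>
  Laurent series of pairwise distinct orders cannot cancel: the order of a linear combination
  is the least order of a term that occurs in it.
\<close>

lemma fls_combination_subdegree:
  fixes g :: "'i \<Rightarrow> 'a::field fls"
  assumes I: "finite I" and g: "\<And>i. i \<in> I \<Longrightarrow> g i \<noteq> 0"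
    and inj: "inj_on (\<lambda>i. fls_subdegree (g i)) I"
    and i0: "i0 \<in> I" "c i0 \<noteq> 0"
    and min: "\<And>i. i \<in> I \<Longrightarrow> c i \<noteq> 0 \<Longrightarrow> fls_subdegree (g i0) \<le> fls_subdegree (g i)"
  shows "fls_subdegree (\<Sum>i\<in>I. fls_const (c i) * g i) = fls_subdegree (g i0)"
    and "fls_nth (\<Sum>i\<in>I. fls_const (c i) * g i) (fls_subdegree (g i0)) =
      c i0 * fls_nth (g i0) (fls_subdegree (g i0))"
    and "(\<Sum>i\<in>I. fls_const (c i) * g i) \<noteq> 0"
proof -
  let ?S = "\<Sum>i\<in>I. fls_const (c i) * g i" and ?d = "fls_subdegree (g i0)"
  have nth: "fls_nth ?S k = (\<Sum>i\<in>I. c i * fls_nth (g i) k)" for k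
    using I by (induction I rule: finite_induct) simp_all
  have "(\<Sum>i\<in>I. c i * fls_nth (g i) ?d) = (\<Sum>i\<in>{i0}. c i * fls_nth (g i) ?d)"
  proof (intro sum.mono_neutral_right ballI)
    fix i assume i: "i \<in> I - {i0}"
    show "c i * fls_nth (g i) ?d = 0"
    proof (cases "c i = 0")
      case False
      then have "?d \<le> fls_subdegree (g i)" using min i by blast
      moreover have "?d \<noteq> fls_subdegree (g i)" using inj i i0 by (auto dest: inj_onD)
      ultimately show ?thesis by simp
    qed simp
  qed (use I i0 in auto)
  then show lead: "fls_nth ?S ?d = c i0 * fls_nth (g i0) ?d" by (simp add: nth)
  then have nz: "fls_nth ?S ?d \<noteq> 0" using i0 g by simp
  then show "?S \<noteq> 0" by auto
  show "fls_subdegree ?S = ?d"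
  proof (rule fls_subdegree_eqI[OF nz])
    fix k assume "k < ?d"
    then have "c i * fls_nth (g i) k = 0" if "i \<in> I" for i
      using min[OF that] by (cases "c i = 0") simp_all
    then show "fls_nth ?S k = 0" unfolding nth by (intro sum.neutral) blast
  qed
qed

lemma fls_combination_min:
  fixes g :: "'i \<Rightarrow> 'a::field fls"
  assumes "finite I" and "i1 \<in> I" and "c i1 \<noteq> (0 :: 'a)"
  obtains i0 where "i0 \<in> I" and "c i0 \<noteq> 0"
    and "\<And>i. i \<in> I \<Longrightarrow> c i \<noteq> 0 \<Longrightarrow> fls_subdegree (g i0) \<le> fls_subdegree (g i)"
proof -
  let ?J = "{i \<in> I. c i \<noteq> 0}"
  have "finite ?J" "?J \<noteq> {}" using assms by auto
  then obtain i0 where "is_arg_min (\<lambda>i. fls_subdegree (g i)) (\<lambda>i. i \<in> ?J) i0"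
    using ex_is_arg_min_if_finite by blast
  then have "i0 \<in> I" "c i0 \<noteq> 0"
    "\<And>i. i \<in> I \<Longrightarrow> c i \<noteq> 0 \<Longrightarrow> fls_subdegree (g i0) \<le> fls_subdegree (g i)"
    by (auto simp: is_arg_min_linorder)
  then show ?thesis using that by blast
qed

lemma fls_combination_independent:
  fixes g :: "'i \<Rightarrow> 'a::field fls"
  assumes I: "finite I" and g: "\<And>i. i \<in> I \<Longrightarrow> g i \<noteq> 0"
    and inj: "inj_on (\<lambda>i. fls_subdegree (g i)) I"
    and zero: "(\<Sum>i\<in>I. fls_const (c i) * g i) = 0" and i: "i \<in> I"
  shows "c i = 0"
proof (rule ccontr)
  assume "c i \<noteq> 0"
  then obtain i0 where "i0 \<in> I" "c i0 \<noteq> 0"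
    "\<And>i. i \<in> I \<Longrightarrow> c i \<noteq> 0 \<Longrightarrow> fls_subdegree (g i0) \<le> fls_subdegree (g i)"
    using fls_combination_min[OF I i] by metis
  then show False using fls_combination_subdegree(3)[OF I g inj] zero by blast
qed

text \<open>A polynomial without multiple roots over an algebraically closed field.\<close>

lemma card_roots_separable:
  fixes p :: "'a::alg_closed_field poly"
  assumes p: "p \<noteq> 0" and sep: "\<And>x. poly p x = 0 \<Longrightarrow> poly (pderiv p) x \<noteq> 0"
  shows "card {x. poly p x = 0} = degree p"
proof -
  obtain A where A: "size A = degree p" "p = smult (lead_coeff p) (\<Prod>x\<in>#A. [:-x, 1:])"
    using alg_closed_imp_factorization[OF p] by blast
  have lc: "lead_coeff p \<noteq> 0" using p by simp
  have root: "poly p x = 0 \<longleftrightarrow> x \<in># A" for x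
  proof -
    have "poly p x = lead_coeff p * (\<Prod>y\<in>#A. x - y)"
      by (subst A(2)) (simp add: poly_prod_mset image_mset.compositionality o_def)
    then show ?thesis using lc by (auto simp: prod_mset_zero_iff)
  qed
  have "count A x \<le> 1" for x
  proof (rule ccontr)
    assume "\<not> count A x \<le> 1"
    then have "replicate_mset 2 x \<subseteq># A"
      by (simp add: count_le_replicate_mset_subset_eq[symmetric])
    then obtain B where B: "A = replicate_mset 2 x + B" by (metis subset_mset.add_diff_inverse)
    define r where "r = smult (lead_coeff p) (\<Prod>y\<in>#B. [:-y, 1:])"
    have "p = [:-x, 1:] * [:-x, 1:] * r"
      by (subst A(2), subst B) (simp add: r_def numeral_2_eq_2 mult.assoc
          del: mult_pCons_left mult_pCons_right)
    then have "poly p x = 0" "poly (pderiv p) x = 0"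
      by (simp_all only: pderiv_mult poly_mult poly_add) simp_all
    then show False using sep by blast
  qed
  then have "A = mset_set (set_mset A)"
    by (intro multiset_eqI) (metis One_nat_def Suc_leI count_greater_zero_iff count_mset_set(1,3)
        finite_set_mset le_antisym not_in_iff)
  then have "card (set_mset A) = size A" by (metis size_mset_set)
  moreover have "{x. poly p x = 0} = set_mset A" using root by auto
  ultimately show ?thesis using A(1) by simp
qed

context vector_space
begin

lemma dim_combinations:
  assumes I: "finite I"
    and ind: "\<And>c. (\<Sum>i\<in>I. scale (c i) (e i)) = 0 \<Longrightarrow> \<forall>i\<in>I. c i = 0"
  shows "dim {\<Sum>i\<in>I. scale (c i) (e i) |c. True} = card I"
proof -
  have inj: "inj_on e I"
  proof (rule inj_onI, rule ccontr)
    fix i j assume ij: "i \<in> I" "j \<in> I" "e i = e j" "i \<noteq> j"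
    define c where "c = (\<lambda>k. if k = i then (1 :: 'a) else if k = j then -1 else 0)"
    have "(\<Sum>k\<in>I. scale (c k) (e k)) = (\<Sum>k\<in>{i, j}. scale (c k) (e k))"
      using ij I by (intro sum.mono_neutral_right) (auto simp: c_def)
    also have "\<dots> = 0" using ij by (simp add: c_def)
    finally have "c i = 0" using ind ij by blast
    then show False by (simp add: c_def)
  qed
  have "independent (e ` I)"
  proof (rule independent_if_scalars_zero)
    fix f x assume z: "(\<Sum>x\<in>e ` I. scale (f x) x) = 0" and x: "x \<in> e ` I"
    have "(\<Sum>i\<in>I. scale (f (e i)) (e i)) = 0" using z by (simp add: sum.reindex[OF inj])
    then show "f x = 0" using ind[of "\<lambda>i. f (e i)"] x by auto
  qed (use I in simp)
  moreover have "{\<Sum>i\<in>I. scale (c i) (e i) |c. True} = span (e ` I)"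
  proof (intro equalityI subsetI)
    fix x assume "x \<in> {\<Sum>i\<in>I. scale (c i) (e i) |c. True}"
    then show "x \<in> span (e ` I)" by (auto intro!: span_sum span_scale intro: span_base)
  next
    fix x assume "x \<in> span (e ` I)"
    then obtain u where "x = (\<Sum>v\<in>e ` I. scale (u v) v)"
      using I by (auto simp: span_finite)
    then have "x = (\<Sum>i\<in>I. scale (u (e i)) (e i))" by (simp add: sum.reindex[OF inj])
    then show "x \<in> {\<Sum>i\<in>I. scale (c i) (e i) |c. True}" by auto
  qed
  ultimately show ?thesis
    using dim_span_eq_card_independent[of "e ` I"] card_image[OF inj] by simp
qed

lemma nontrivial_relation:
  assumes I: "finite I" and J: "finite J" and card: "card J < card I"
    and sp: "\<And>i. i \<in> I \<Longrightarrow> e i \<in> span (w ` J)"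
  obtains c i where "i \<in> I" "c i \<noteq> 0" "(\<Sum>i\<in>I. scale (c i) (e i)) = 0"
proof (rule ccontr)
  assume "\<not> thesis"
  then have ind: "(\<Sum>i\<in>I. scale (c i) (e i)) = 0 \<Longrightarrow> \<forall>i\<in>I. c i = 0" for c using that by blast
  have "{\<Sum>i\<in>I. scale (c i) (e i) |c. True} \<subseteq> span (w ` J)"
    by (auto intro!: span_sum span_scale sp)
  then have "dim {\<Sum>i\<in>I. scale (c i) (e i) |c. True} \<le> card (w ` J)"
    using J by (intro dim_le_card) auto
  also have "\<dots> \<le> card J" using J by (rule card_image_le)
  finally show False using dim_combinations[OF I ind] card by simp
qed

end

section \<open>Evaluation of forms at Laurent series\<close>

lemma vector_4 [simp]:
  "(vector [a, b, c, d] :: 'a::zero ^ 4) $ 1 = a"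
  "(vector [a, b, c, d] :: 'a::zero ^ 4) $ 2 = b"
  "(vector [a, b, c, d] :: 'a::zero ^ 4) $ 3 = c"
  "(vector [a, b, c, d] :: 'a::zero ^ 4) $ 4 = d"
  unfolding vector_def by simp_all

lemma prod_4: "prod f (UNIV :: 4 set) = f 1 * f 2 * f 3 * f 4"
  unfolding UNIV_4 by (simp add: ac_simps)

text \<open>The value of a polynomial at a vector of Laurent series.\<close>

definition eval_fls :: "('a::field, 'n::finite) mpoly \<Rightarrow> 'a fls ^ 'n \<Rightarrow> 'a fls" where
  "eval_fls F v = (\<Sum>m\<in>Poly_Mapping.keys F. fls_const (Poly_Mapping.lookup F m) *
     (\<Prod>i\<in>UNIV. (v $ i) ^ Poly_Mapping.lookup m i))"

lemma fls_const_add: "fls_const (a + b) = fls_const a + fls_const (b :: 'a::field)"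
  by (simp add: fls_plus_const)

lemma fls_const_diff: "fls_const (a - b) = fls_const a - fls_const (b :: 'a::field)"
  by (simp add: fls_minus_const)

lemma fls_const_mult: "fls_const (a * b) = fls_const a * fls_const (b :: 'a::field)"
  by simp

lemma fls_const_sum: "fls_const (sum f A) = (\<Sum>x\<in>A. fls_const (f x :: 'a::field))"
  by (induction A rule: infinite_finite_induct) (simp_all add: fls_const_add)

lemma fls_const_prod: "fls_const (prod f A) = (\<Prod>x\<in>A. fls_const (f x :: 'a::field))"
  by (induction A rule: infinite_finite_induct)
     (simp_all add: fls_const_mult del: fls_const_mult_const)

lemma fls_const_eq_iff: "fls_const a = fls_const b \<longleftrightarrow> a = (b :: 'a::field)"
  by (metis eq_iff_diff_eq_0 fls_const_diff fls_const_eq_0_iff)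

lemma eval_fls_superset:
  assumes "finite A" and "Poly_Mapping.keys F \<subseteq> A"
  shows "eval_fls F v = (\<Sum>m\<in>A. fls_const (Poly_Mapping.lookup F m) *
    (\<Prod>i\<in>UNIV. (v $ i) ^ Poly_Mapping.lookup m i))"
  unfolding eval_fls_def using assms
  by (intro sum.mono_neutral_left) (auto simp: in_keys_iff)

lemma eval_fls_zero [simp]: "eval_fls 0 v = 0"
  by (simp add: eval_fls_def)

lemma eval_fls_add: "eval_fls (F + G) v = eval_fls F v + eval_fls G v"
proof -
  let ?A = "Poly_Mapping.keys F \<union> Poly_Mapping.keys G"
  have sub: "Poly_Mapping.keys (F + G) \<subseteq> ?A" by (rule keys_add)
  show ?thesis
    by (subst (1 2 3) eval_fls_superset[of ?A])
       (use sub in \<open>auto simp: lookup_add fls_const_add distrib_right sum.distrib\<close>)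
qed

lemma eval_fls_uminus: "eval_fls (- F) v = - eval_fls F v"
  by (simp add: eval_fls_def sum_negf[symmetric])

lemma eval_fls_diff: "eval_fls (F - G) v = eval_fls F v - eval_fls G v"
  using eval_fls_add[of F "- G" v] by (simp add: eval_fls_uminus)

lemma eval_fls_sum: "eval_fls (sum F A) v = (\<Sum>a\<in>A. eval_fls (F a) v)"
  by (induction A rule: infinite_finite_induct) (simp_all add: eval_fls_add)

lemma eval_fls_single:
  "eval_fls (Poly_Mapping.single m c) v =
     fls_const c * (\<Prod>i\<in>UNIV. (v $ i) ^ Poly_Mapping.lookup m i)"
  by (cases "c = 0") (simp_all add: eval_fls_def)

lemma mpoly_sum_singles:
  "F = (\<Sum>m\<in>Poly_Mapping.keys F. Poly_Mapping.single m (Poly_Mapping.lookup F m))"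
proof (rule poly_mapping_eqI)
  fix k
  show "Poly_Mapping.lookup F k = Poly_Mapping.lookup
    (\<Sum>m\<in>Poly_Mapping.keys F. Poly_Mapping.single m (Poly_Mapping.lookup F m)) k"
    by (cases "k \<in> Poly_Mapping.keys F")
       (auto simp: lookup_sum lookup_single when_def in_keys_iff sum.delta)
qed

lemma eval_fls_mult: "eval_fls (F * G) v = eval_fls F v * eval_fls G v"
proof -
  have single: "eval_fls (Poly_Mapping.single m a * Poly_Mapping.single n b) v =
    eval_fls (Poly_Mapping.single m a) v * eval_fls (Poly_Mapping.single n b) v" for m n a b
    by (simp add: mult_single eval_fls_single lookup_add power_add prod.distrib algebra_simps)
  have "F * G = (\<Sum>m\<in>Poly_Mapping.keys F. \<Sum>n\<in>Poly_Mapping.keys G.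
      Poly_Mapping.single m (Poly_Mapping.lookup F m) *
      Poly_Mapping.single n (Poly_Mapping.lookup G n))"
    by (subst mpoly_sum_singles[of F], subst mpoly_sum_singles[of G], rule sum_product)
  then have "eval_fls (F * G) v = (\<Sum>m\<in>Poly_Mapping.keys F. \<Sum>n\<in>Poly_Mapping.keys G.
      eval_fls (Poly_Mapping.single m (Poly_Mapping.lookup F m)) v *
      eval_fls (Poly_Mapping.single n (Poly_Mapping.lookup G n)) v)"
    by (simp add: eval_fls_sum single)
  also have "\<dots> = eval_fls F v * eval_fls G v"
    by (simp add: sum_product[symmetric] eval_fls_def[of F] eval_fls_def[of G] eval_fls_single)
  finally show ?thesis .
qed

lemma eval_fls_one [simp]: "eval_fls 1 v = 1"
  by (simp add: eval_fls_single flip: single_one)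

lemma eval_fls_const: "eval_fls F (\<chi> i. fls_const (v $ i)) = fls_const (eval F v)"
  by (simp add: eval_fls_def eval_def fls_const_sum fls_const_prod fls_const_power fls_const_mult
      del: fls_const_mult_const)

lemma eval_fls_scale:
  assumes "homogeneous d F"
  shows "eval_fls F (a *s v) = a ^ d * eval_fls F v"
proof -
  have "fls_const (Poly_Mapping.lookup F m) * (\<Prod>i\<in>UNIV. ((a *s v) $ i) ^ Poly_Mapping.lookup m i)
      = a ^ d * (fls_const (Poly_Mapping.lookup F m) *
        (\<Prod>i\<in>UNIV. (v $ i) ^ Poly_Mapping.lookup m i))"
    if "m \<in> Poly_Mapping.keys F" for m
    using assms that
    by (simp add: homogeneous_def power_mult_distrib prod.distrib power_sum[symmetric])
  then show ?thesis unfolding eval_fls_def sum_distrib_left by (intro sum.cong refl)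
qed

lemma eval_scale:
  assumes "homogeneous d F"
  shows "eval F (a *s v) = a ^ d * eval F v"
proof -
  have "fls_const (eval F (a *s v)) = eval_fls F (fls_const a *s (\<chi> i. fls_const (v $ i)))"
    by (simp add: eval_fls_const[symmetric] vector_scalar_mult_def)
  also have "\<dots> = fls_const (a ^ d * eval F v)"
    by (simp add: eval_fls_scale[OF assms] eval_fls_const fls_const_power[symmetric])
  finally show ?thesis by (simp only: fls_const_eq_iff)
qed

lemma eval_add: "eval (F + G) v = eval F v + eval G v"
  by (metis eval_fls_add eval_fls_const fls_const_add fls_const_eq_iff)

lemma eval_diff: "eval (F - G) v = eval F v - eval G v"
  by (metis eval_fls_diff eval_fls_const fls_const_diff fls_const_eq_iff)

lemma eval_mult: "eval (F * G) v = eval F v * eval G v"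
  by (metis eval_fls_mult eval_fls_const fls_const_mult fls_const_eq_iff)

lemma eval_one [simp]: "eval 1 v = 1"
  by (metis eval_fls_one eval_fls_const fls_const_1 fls_const_eq_iff)

lemma homogeneous_zero [simp]: "homogeneous d 0"
  by (simp add: homogeneous_def)

lemma homogeneous_one [simp]: "homogeneous 0 1"
  by (simp add: homogeneous_def)

lemma homogeneous_add:
  assumes "homogeneous d F" "homogeneous d G"
  shows "homogeneous d (F + G)"
  using assms keys_add[of F G] unfolding homogeneous_def by blast

lemma homogeneous_uminus: "homogeneous d F \<Longrightarrow> homogeneous d (- F)"
  by (simp add: homogeneous_def in_keys_iff)

lemma homogeneous_diff:
  "homogeneous d F \<Longrightarrow> homogeneous d G \<Longrightarrow> homogeneous d (F - G)"
  using homogeneous_add[of d F "- G"] homogeneous_uminus[of d G] by simp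

lemma homogeneous_mult:
  assumes "homogeneous d F" "homogeneous e G"
  shows "homogeneous (d + e) (F * G)"
  unfolding homogeneous_def
proof
  fix m assume "m \<in> Poly_Mapping.keys (F * G)"
  then obtain a b where "m = a + b" "a \<in> Poly_Mapping.keys F" "b \<in> Poly_Mapping.keys G"
    using keys_mult by blast
  then show "(\<Sum>i\<in>UNIV. Poly_Mapping.lookup m i) = d + e"
    using assms by (simp add: homogeneous_def lookup_add sum.distrib)
qed

lemma homogeneous_single:
  "(\<Sum>i\<in>UNIV. Poly_Mapping.lookup m i) = d \<Longrightarrow> homogeneous d (Poly_Mapping.single m c)"
  by (simp add: homogeneous_def)

text \<open>The exponent vector of \<open>X^i Y^j Z^k T^l\<close>.\<close>

definition monom4 :: "nat \<Rightarrow> nat \<Rightarrow> nat \<Rightarrow> nat \<Rightarrow> (4 \<Rightarrow>\<^sub>0 nat)" where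
  "monom4 i j k l = Poly_Mapping.single 1 i + Poly_Mapping.single 2 j
     + Poly_Mapping.single 3 k + Poly_Mapping.single 4 l"

lemma lookup_monom4 [simp]:
  "Poly_Mapping.lookup (monom4 i j k l) 1 = i"
  "Poly_Mapping.lookup (monom4 i j k l) 2 = j"
  "Poly_Mapping.lookup (monom4 i j k l) 3 = k"
  "Poly_Mapping.lookup (monom4 i j k l) 4 = l"
  by (simp_all add: monom4_def lookup_add lookup_single)

lemma eval_fls_monom4:
  "eval_fls (Poly_Mapping.single (monom4 i j k l) c) v =
     fls_const c * ((v $ 1) ^ i * (v $ 2) ^ j * (v $ 3) ^ k * (v $ 4) ^ l)"
  by (simp add: eval_fls_single prod_4)

lemma homogeneous_monom4:
  "i + j + k + l = d \<Longrightarrow> homogeneous d (Poly_Mapping.single (monom4 i j k l) c)"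
  by (intro homogeneous_single) (simp add: sum_4)

section \<open>The affine coordinate ring and its place at infinity\<close>

text \<open>
  The affine equations of the curve, for elements of an arbitrary ring: they are used for constants
  and for Laurent series.
\<close>

definition gk_rel :: "nat \<Rightarrow> 'b::comm_ring_1 \<Rightarrow> 'b \<Rightarrow> 'b \<Rightarrow> bool" where
  "gk_rel q x y z \<longleftrightarrow> y ^ (q + 1) = x ^ q + x \<and> z ^ (q\<^sup>2 - q + 1) = y ^ (q\<^sup>2) - y"

text \<open>
  The pole order of \<open>x^i y^j z^k\<close> at infinity; the pole order \<open>q^3 - q^2 + q\<close> of \<open>y\<close> is written as a
  product.
\<close>

definition gk_weight :: "nat \<Rightarrow> nat \<Rightarrow> nat \<Rightarrow> nat \<Rightarrow> nat" where
  "gk_weight q i j k = i * (q ^ 3 + 1) + j * (q * (q\<^sup>2 - q + 1)) + k * q ^ 3"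

lemma gk_exponents:
  fixes q :: nat
  assumes "q \<ge> 2"
  shows "(q\<^sup>2 - q + 1) * (q + 1) = q ^ 3 + 1" and "q\<^sup>2 - q + 1 + q = q\<^sup>2 + 1" and "q < q\<^sup>2"
    and "q\<^sup>2 < q ^ 3" and "q * (q\<^sup>2 - q + 1) < q ^ 3"
proof -
  obtain r where r: "q = r + 2" using assms by (metis le_add_diff_inverse2)
  have n: "q\<^sup>2 - q + 1 = r\<^sup>2 + 3 * r + 3"
    by (simp add: r power2_eq_square algebra_simps)
  show "(q\<^sup>2 - q + 1) * (q + 1) = q ^ 3 + 1"
    unfolding n by (simp add: r power2_eq_square power3_eq_cube algebra_simps)
  show "q\<^sup>2 - q + 1 + q = q\<^sup>2 + 1" unfolding n by (simp add: r power2_eq_square algebra_simps)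
  show "q < q\<^sup>2" by (simp add: r power2_eq_square algebra_simps)
  show "q\<^sup>2 < q ^ 3" by (simp add: r power2_eq_square power3_eq_cube algebra_simps)
  show "q * (q\<^sup>2 - q + 1) < q ^ 3"
    unfolding n by (simp add: r power2_eq_square power3_eq_cube algebra_simps)
qed

lemma gk_weight_inj:
  assumes q: "q \<ge> 2" and w: "gk_weight q i j k = gk_weight q i' j' k'"
    and "i < q" "i' < q" "j < q\<^sup>2" "j' < q\<^sup>2"
  shows "i = i' \<and> j = j' \<and> k = k'"
proof -
  define n where "n = q\<^sup>2 - q + 1"
  have "gk_weight q a b c mod q = a" if "a < q" for a b c
  proof -
    have "gk_weight q a b c = a + q * (a * q\<^sup>2 + b * n + c * q\<^sup>2)"
      by (simp add: gk_weight_def n_def power2_eq_square power3_eq_cube algebra_simps)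
    then show ?thesis using that by simp
  qed
  then have i: "i = i'" using w assms by metis
  then have "j * (q * n) + k * q ^ 3 = j' * (q * n) + k' * q ^ 3"
    using w by (simp add: gk_weight_def n_def)
  then have "q * (j * n + k * q\<^sup>2) = q * (j' * n + k' * q\<^sup>2)"
    by (simp add: algebra_simps power3_eq_cube power2_eq_square)
  then have e: "j * n + k * q\<^sup>2 = j' * n + k' * q\<^sup>2" using q by simp
  have "coprime q n"
  proof -
    have "n + q = q\<^sup>2 + 1" using gk_exponents(2)[OF q] by (simp add: n_def)
    then have "n + q = q * (q - 1) + 1 + q"
      using q by (cases q) (simp_all add: power2_eq_square)
    then have n': "n = q * (q - 1) + 1" by simp
    show ?thesis unfolding n' by (intro coprimeI) (metis dvd_add_right_iff dvd_mult2)
  qed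
  then have cop: "coprime (int (q\<^sup>2)) (int n)" by simp
  have "(int j - int j') * int n = int (q\<^sup>2) * (int k' - int k)"
    using arg_cong[OF e, of int] by (simp add: algebra_simps)
  then have "int (q\<^sup>2) dvd (int j - int j') * int n" by simp
  then have "int (q\<^sup>2) dvd int j - int j'" using cop coprime_dvd_mult_left_iff by blast
  then have j: "j = j'"
    using assms(5,6) dvd_imp_le_int[of "int j - int j'" "int (q\<^sup>2)"] by linarith
  then show ?thesis using e i q by simp
qed

text \<open>
  The expansions of the coordinate functions at the point at infinity, in a parameter \<open>t\<close>
  with \<open>x = t^-(q^3 + 1)\<close>: the ramification over the \<open>x\<close>-line is tame there, so only roots of
  degrees prime to the characteristic have to be extracted.
\<close>

lemma gk_series_exist:
  fixes q :: nat and ty :: "'a::field itself"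
  assumes q: "q \<ge> 2" and n1: "of_nat (q + 1) \<noteq> (0 :: 'a)"
    and n2: "of_nat (q\<^sup>2 - q + 1) \<noteq> (0 :: 'a)"
  obtains xi yi zi :: "'a fls" where "gk_rel q xi yi zi"
    "fls_subdegree xi = - int (q ^ 3 + 1)" "fls_nth xi (- int (q ^ 3 + 1)) = 1"
    "fls_subdegree yi = - int (q * (q\<^sup>2 - q + 1))" "fls_nth yi (- int (q * (q\<^sup>2 - q + 1))) = 1"
    "fls_subdegree zi = - int (q ^ 3)" "fls_nth zi (- int (q ^ 3)) = 1"
proof -
  define n where "n = q\<^sup>2 - q + 1"
  define e where "e = (q ^ 3 + 1) * (q - 1)"
  define d where "d = (q ^ 3 - q) * n"
  have n: "n * (q + 1) = q ^ 3 + 1" and nq: "n + q = q\<^sup>2 + 1"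
    using gk_exponents[OF q] by (simp_all add: n_def)
  have n0: "n > 0" by (simp add: n_def)
  have q3: "q < q ^ 3" using gk_exponents(3,4)[OF q] by linarith
  have e0: "e > 0" and d0: "d > 0" using q q3 n0 by (simp_all add: e_def d_def)
  obtain y where y: "fps_nth y 0 = 1" "y ^ (q + 1) = 1 + (fps_X :: 'a fps) ^ e"
    using fps_nth_root_exists[OF _ n1, of "1 + fps_X ^ e"] e0 by auto
  have "fps_nth (y ^ (q\<^sup>2) - fps_X ^ d * y) 0 = 1"
    using d0 y by (simp add: fps_power_zeroth)
  then obtain z where z: "fps_nth z 0 = 1" "z ^ n = y ^ (q\<^sup>2) - fps_X ^ d * y"
    using fps_nth_root_exists n2 n_def by metis
  define t :: "'a fls" where "t = fls_X"
  have t: "t \<noteq> 0" by (simp add: t_def)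
  define xi where "xi = t powi (- int (q ^ 3 + 1))"
  define yi where "yi = t powi (- int (q * n)) * fps_to_fls y"
  define zi where "zi = t powi (- int (q ^ 3)) * fps_to_fls z"
  have pw: "(t powi a) ^ k = t powi (a * int k)" for a k
    by (simp add: power_int_mult power_int_of_nat)
  have pf: "fps_to_fls (fps_X ^ k) = t powi int k" for k
    by (simp add: fps_to_fls_power t_def power_int_of_nat)
  have "yi ^ (q + 1) = t powi (- int (q * n) * int (q + 1)) * fps_to_fls (y ^ (q + 1))"
    by (simp only: yi_def power_mult_distrib pw fps_to_fls_power)
  also have "- int (q * n) * int (q + 1) = - int (q ^ 3 + 1) * int q"
    unfolding n[symmetric] of_nat_mult by (simp only: mult_minus_left mult_minus_right ac_simps)
  also have "fps_to_fls (y ^ (q + 1)) = 1 + t powi int e"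
    by (simp only: y pf fps_to_fls_plus fps_one_to_fls)
  also have "t powi (- int (q ^ 3 + 1) * int q) * (1 + t powi int e)
      = xi ^ q + t powi (- int (q ^ 3 + 1) * int q + int e)"
    by (simp add: xi_def pw distrib_left power_int_add t)
  also have "- int (q ^ 3 + 1) * int q + int e = - int (q ^ 3 + 1)"
  proof -
    have "int (q - 1) = int q - 1" using q by simp
    then show ?thesis by (simp only: e_def of_nat_mult) (simp add: algebra_simps)
  qed
  finally have r1: "yi ^ (q + 1) = xi ^ q + xi" by (simp add: xi_def)
  have "zi ^ n = t powi (- int (q ^ 3) * int n) * fps_to_fls (z ^ n)"
    by (simp only: zi_def power_mult_distrib pw fps_to_fls_power)
  also have "\<dots> = t powi (- int (q ^ 3) * int n) * fps_to_fls y ^ (q\<^sup>2)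
      - t powi (- int (q ^ 3) * int n + int d) * fps_to_fls y"
  proof -
    have zn: "fps_to_fls (z ^ n) = fps_to_fls y ^ (q\<^sup>2) - t powi int d * fps_to_fls y"
      by (simp only: z fps_to_fls_minus fls_times_fps_to_fls pf fps_to_fls_power[of y])
    have td: "t powi (- int (q ^ 3) * int n + int d) = t powi (- int (q ^ 3) * int n) * t powi int d"
      using t by (intro power_int_add) simp
    show ?thesis by (simp only: zn td right_diff_distrib mult.assoc)
  qed
  also have "- int (q ^ 3) * int n + int d = - int (q * n)"
  proof -
    have "int (q ^ 3 - q) = int (q ^ 3) - int q" using q3 by simp
    then show ?thesis by (simp only: d_def of_nat_mult) (simp add: algebra_simps)
  qed
  also have "- int (q ^ 3) * int n = - int (q * n) * int (q\<^sup>2)"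
    by (simp add: power3_eq_cube power2_eq_square)
  also have "t powi (- int (q * n) * int (q\<^sup>2)) * fps_to_fls y ^ (q\<^sup>2) = yi ^ (q\<^sup>2)"
    by (simp only: yi_def power_mult_distrib pw)
  finally have r2: "zi ^ n = yi ^ (q\<^sup>2) - yi" by (simp add: yi_def)
  have tp: "t powi a = fls_X_intpow a" for a by (simp add: t_def)
  have lead: "fls_nth (fls_X_intpow (- int k) * fps_to_fls f) (- int k) = fps_nth f 0"
    for k and f :: "'a fps"
    by (simp add: fls_shifted_times_simps)
  have sd: "fls_subdegree (fls_X_intpow (- int k) * fps_to_fls f) = - int k"
    if "fps_nth f 0 = 1" for k and f :: "'a fps"
  proof -
    have "f \<noteq> 0" using that by auto
    moreover have "subdegree f = 0" using that by (simp add: subdegree_eq_0)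
    ultimately show ?thesis by (simp add: fls_subdegree_fls_to_fps fls_shifted_times_simps)
  qed
  show ?thesis
  proof
    show "gk_rel q xi yi zi" using r1 r2 by (simp add: gk_rel_def n_def)
    show "fls_subdegree xi = - int (q ^ 3 + 1)" "fls_nth xi (- int (q ^ 3 + 1)) = 1"
      unfolding xi_def tp by simp_all
    show "fls_subdegree yi = - int (q * (q\<^sup>2 - q + 1))"
      "fls_nth yi (- int (q * (q\<^sup>2 - q + 1))) = 1"
      unfolding yi_def tp n_def[symmetric] using sd[OF y(1)] lead y(1) by (simp_all only:)
    show "fls_subdegree zi = - int (q ^ 3)" "fls_nth zi (- int (q ^ 3)) = 1"
      unfolding zi_def tp using sd[OF z(1)] lead z(1) by (simp_all only:)
  qed
qed

text \<open>Evaluation of a polynomial with constant coefficients at a Laurent series.\<close>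

definition evp :: "'a::field poly \<Rightarrow> 'a fls \<Rightarrow> 'a fls" where
  "evp p z = poly (map_poly fls_const p) z"

lemma evp_0 [simp]: "evp 0 z = 0"
  by (simp add: evp_def)

lemma evp_pCons: "evp (pCons a p) z = fls_const a + z * evp p z"
  by (simp add: evp_def map_poly_pCons)

lemma evp_add: "evp (p + r) z = evp p z + evp r z"
  by (induction p r rule: poly_induct2) (simp_all add: evp_pCons fls_const_add algebra_simps)

lemma evp_smult: "evp (smult a p) z = fls_const a * evp p z"
  by (induction p) (simp_all add: evp_pCons algebra_simps fls_const_mult del: fls_const_mult_const)

lemma evp_mult: "evp (p * r) z = evp p z * evp r z"
  by (induction p) (simp_all add: evp_pCons evp_add evp_smult algebra_simps)

lemma evp_uminus: "evp (- p) z = - evp p z"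
  using evp_add[of p "- p" z] by (simp add: eq_neg_iff_add_eq_0 add.commute)

lemma evp_monom: "evp (monom a k) z = fls_const a * z ^ k"
  by (induction k) (simp_all add: monom_0 monom_Suc evp_pCons)

lemma evp_const: "evp p (fls_const c) = fls_const (poly p c)"
  by (induction p) (simp_all add: evp_pCons fls_const_add)

lemma evp_altdef: "degree p \<le> D \<Longrightarrow> evp p z = (\<Sum>k\<le>D. fls_const (coeff p k) * z ^ k)"
proof -
  assume "degree p \<le> D"
  then have "(\<Sum>k\<le>degree p. fls_const (coeff p k) * z ^ k)
      = (\<Sum>k\<le>D. fls_const (coeff p k) * z ^ k)"
    by (intro sum.mono_neutral_left) (auto simp: coeff_eq_0)
  then show ?thesis by (simp add: evp_def poly_altdef coeff_map_poly degree_map_poly)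
qed

text \<open>
  Polynomial functions in three variables with coefficients in \<open>K\<close>, evaluated at triples of
  Laurent series.
\<close>

inductive_set polyfun :: "'a::field set \<Rightarrow> ('a fls \<Rightarrow> 'a fls \<Rightarrow> 'a fls \<Rightarrow> 'a fls) set"
  for K where
  monomial: "a \<in> K \<Longrightarrow> (\<lambda>x y z. fls_const a * (x ^ i * y ^ j * z ^ k)) \<in> polyfun K"
| add: "g \<in> polyfun K \<Longrightarrow> h \<in> polyfun K \<Longrightarrow> (\<lambda>x y z. g x y z + h x y z) \<in> polyfun K"

lemma polyfun_mono: "K \<subseteq> K' \<Longrightarrow> g \<in> polyfun K \<Longrightarrow> g \<in> polyfun K'"
proof -
  assume K: "K \<subseteq> K'"
  show "g \<in> polyfun K \<Longrightarrow> g \<in> polyfun K'"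
    by (induction rule: polyfun.induct) (use K in \<open>auto intro: polyfun.intros\<close>)
qed

lemma polyfun_UNIV: "g \<in> polyfun K \<Longrightarrow> g \<in> polyfun UNIV"
  using polyfun_mono by blast

lemma polyfun_mult:
  assumes K: "\<And>a b. a \<in> K \<Longrightarrow> b \<in> K \<Longrightarrow> a * b \<in> K"
    and g: "g \<in> polyfun K" and h: "h \<in> polyfun K"
  shows "(\<lambda>x y z. g x y z * h x y z) \<in> polyfun K"
  using g
proof induction
  case (monomial a i j k)
  from h show ?case
  proof induction
    case (monomial b i' j' k')
    then have "(\<lambda>x y z. fls_const (a * b) * (x ^ (i + i') * y ^ (j + j') * z ^ (k + k')))
        \<in> polyfun K"
      using \<open>a \<in> K\<close> K by (intro polyfun.monomial)
    also have "(\<lambda>x y z. fls_const (a * b) * (x ^ (i + i') * y ^ (j + j') * z ^ (k + k')))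
       = (\<lambda>x y z. fls_const a * (x ^ i * y ^ j * z ^ k) * (fls_const b * (x ^ i' * y ^ j' * z ^ k')))"
      by (simp add: power_add fls_const_mult algebra_simps del: fls_const_mult_const)
    finally show ?case .
  next
    case (add g h)
    from polyfun.add[OF add.IH] show ?case by (simp add: distrib_left)
  qed
next
  case (add g1 g2)
  from polyfun.add[OF add.IH] show ?case by (simp add: distrib_right)
qed

lemma polyfun_const: "a \<in> K \<Longrightarrow> (\<lambda>x y z. fls_const a) \<in> polyfun K"
  using polyfun.monomial[of a K 0 0 0] by simp

lemma polyfun_X: "1 \<in> K \<Longrightarrow> (\<lambda>x y z. x) \<in> polyfun K"
  using polyfun.monomial[of 1 K 1 0 0] by simp

lemma polyfun_Y: "1 \<in> K \<Longrightarrow> (\<lambda>x y z. y) \<in> polyfun K"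
  using polyfun.monomial[of 1 K 0 1 0] by simp

lemma polyfun_Z: "1 \<in> K \<Longrightarrow> (\<lambda>x y z. z) \<in> polyfun K"
  using polyfun.monomial[of 1 K 0 0 1] by simp

lemma polyfun_power:
  assumes K: "\<And>a b. a \<in> K \<Longrightarrow> b \<in> K \<Longrightarrow> a * b \<in> K" "1 \<in> K" and g: "g \<in> polyfun K"
  shows "(\<lambda>x y z. g x y z ^ n) \<in> polyfun K"
proof (induction n)
  case 0
  show ?case using polyfun_const[OF K(2)] by simp
next
  case (Suc n)
  then show ?case using polyfun_mult[OF K(1) g Suc.IH] by simp
qed

lemma polyfun_sum:
  assumes "0 \<in> K" "\<And>i. i \<in> I \<Longrightarrow> g i \<in> polyfun K"
  shows "(\<lambda>x y z. \<Sum>i\<in>I. g i x y z) \<in> polyfun K"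
  using assms
proof (induction I rule: infinite_finite_induct)
  case (insert i I)
  then have "(\<lambda>x y z. g i x y z + (\<Sum>i\<in>I. g i x y z)) \<in> polyfun K"
    by (intro polyfun.add) auto
  then show ?case using insert by simp
qed (use polyfun_const[of 0 K] in simp_all)

lemma polyfun_prod:
  assumes "\<And>a b. a \<in> K \<Longrightarrow> b \<in> K \<Longrightarrow> a * b \<in> K" "1 \<in> K" "\<And>i. i \<in> I \<Longrightarrow> g i \<in> polyfun K"
  shows "(\<lambda>x y z. \<Prod>i\<in>I. g i x y z) \<in> polyfun K"
  using assms
proof (induction I rule: infinite_finite_induct)
  case (insert i I)
  then have "(\<lambda>x y z. g i x y z * (\<Prod>i\<in>I. g i x y z)) \<in> polyfun K"
    by (intro polyfun_mult) auto
  then show ?case using insert by simp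
qed (use polyfun_const[of 1 K] in simp_all)

lemma polyfun_scale: "g \<in> polyfun UNIV \<Longrightarrow> (\<lambda>x y z. fls_const a * g x y z) \<in> polyfun UNIV"
  by (intro polyfun_mult[where g = "\<lambda>x y z. fls_const a"] polyfun_const) auto

lemma polyfun_diff:
  assumes "g \<in> polyfun UNIV" "h \<in> polyfun UNIV"
  shows "(\<lambda>x y z. g x y z - h x y z) \<in> polyfun UNIV"
  using polyfun.add[OF assms(1) polyfun_scale[OF assms(2), of "-1"]] by simp

lemma polyfun_evp: "(\<lambda>x y z. evp p z) \<in> polyfun UNIV"
proof (induction p)
  case (pCons a p)
  have "(\<lambda>x y z. fls_const a + z * evp p z) \<in> polyfun UNIV"
    by (intro polyfun.add polyfun_const polyfun_mult[where g = "\<lambda>x y z. z"] polyfun_Z pCons.IH)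
       auto
  then show ?case by (simp add: evp_pCons)
qed (use polyfun_const[of 0 UNIV] in simp)

text \<open>The value of a polynomial function at a triple of constants.\<close>

definition pval :: "('a::field fls \<Rightarrow> 'a fls \<Rightarrow> 'a fls \<Rightarrow> 'a fls) \<Rightarrow> 'a \<Rightarrow> 'a \<Rightarrow> 'a \<Rightarrow> 'a" where
  "pval g a b c = fls_nth (g (fls_const a) (fls_const b) (fls_const c)) 0"

lemma fls_const_pval:
  assumes "g \<in> polyfun K"
  shows "fls_const (pval g a b c) = g (fls_const a) (fls_const b) (fls_const c)"
proof -
  have "\<exists>r. g (fls_const a) (fls_const b) (fls_const c) = fls_const r"
    using assms
  proof induction
    case (monomial u i j k)
    show ?case by (intro exI[of _ "u * (a ^ i * b ^ j * c ^ k)"]) (simp add: fls_const_power[symmetric])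
  next
    case (add g h)
    then obtain r s where "g (fls_const a) (fls_const b) (fls_const c) = fls_const r"
      "h (fls_const a) (fls_const b) (fls_const c) = fls_const s" by blast
    then show ?case by (intro exI[of _ "r + s"]) (simp add: fls_const_add)
  qed
  then show ?thesis by (auto simp: pval_def)
qed

lemma pval_mult:
  assumes "g \<in> polyfun K" "h \<in> polyfun K"
  shows "pval (\<lambda>x y z. g x y z * h x y z) a b c = pval g a b c * pval h a b c"
  using assms[THEN fls_const_pval, of a b c, symmetric]
  by (subst pval_def) simp

lemma pval_const [simp]: "pval (\<lambda>x y z. fls_const u) a b c = u"
  by (simp add: pval_def)

lemma pval_evp: "pval (\<lambda>x y z. evp p z) a b c = poly p c"
  by (simp add: pval_def evp_const)

lemma gk_rel_fls_const:
  "gk_rel q (fls_const a) (fls_const b) (fls_const (c :: 'a::field)) \<longleftrightarrow> gk_rel q a b c"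
  by (simp only: gk_rel_def fls_const_power[symmetric] fls_const_add[symmetric]
      fls_const_diff[symmetric] fls_const_eq_iff)

lemma evp_linear: "evp [:-c, 1:] z = z - fls_const c"
  by (simp add: evp_pCons algebra_simps)

lemma evp_linear_power: "evp ([:-c, 1:] ^ k) z = (z - fls_const c) ^ k"
proof (induction k)
  case 0
  show ?case by (simp add: one_pCons evp_pCons)
next
  case (Suc k)
  then show ?case by (simp only: power_Suc evp_mult evp_linear)
qed

lemma polynomial_zero_of_values:
  fixes p :: "'a::alg_closed_field poly"
  assumes "\<And>c. poly p c = 0"
  shows "p = 0"
proof -
  have "degree (p + 1) = 0"
  proof (rule ccontr)
    assume "degree (p + 1) \<noteq> 0"
    then obtain c where "poly (p + 1) c = 0" using alg_closed_imp_poly_has_root by blast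
    then show False using assms by simp
  qed
  then obtain u where u: "p + 1 = [:u:]" by (metis degree_eq_zeroE)
  then have "u = 1" using assms[of 0] by (metis add_0 poly_1 poly_add poly_const_conv)
  then show ?thesis using u by (simp add: one_pCons[symmetric])
qed

lemma polynomial_zero_of_roots:
  fixes f :: "nat \<Rightarrow> 'a::idom"
  assumes "card S = N" "N > 0" and zero: "\<And>x. x \<in> S \<Longrightarrow> (\<Sum>i<N. f i * x ^ i) = 0" and "i < N"
  shows "f i = 0"
proof (rule ccontr)
  assume "f i \<noteq> 0"
  define P where "P = (\<Sum>i<N. monom (f i) i)"
  have coeff: "coeff P k = (if k < N then f k else 0)" for k
    by (simp add: P_def coeff_sum)
  have P: "P \<noteq> 0" using \<open>f i \<noteq> 0\<close> \<open>i < N\<close> coeff[of i] by auto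
  have "degree P < N"
    using \<open>N > 0\<close> coeff by (metis P leading_coeff_neq_0)
  moreover have "card S \<le> card {x. poly P x = 0}"
    using zero by (intro card_mono poly_roots_finite P) (auto simp: P_def poly_sum poly_monom)
  moreover have "card {x. poly P x = 0} \<le> degree P" using P by (rule card_poly_roots_bound)
  ultimately show False using assms(1) by linarith
qed

lemma card_additive_roots:
  fixes u a :: "'a::alg_closed_field"
  assumes N: "N \<ge> 2" "of_nat N = (0 :: 'a)" and u: "u \<noteq> 0"
  shows "card {x. x ^ N + u * x = a} = N"
proof -
  define P where "P = monom 1 N + [:-a, u:]"
  have deg: "degree P = N"
    unfolding P_def using N u by (subst degree_add_eq_left) (auto simp: degree_monom_eq)
  have "P \<noteq> 0" using deg N by auto
  moreover have "pderiv P = [:u:]"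
    by (simp add: P_def pderiv_add pderiv_monom N pderiv_pCons)
  ultimately have "card {x. poly P x = 0} = degree P"
    using u by (intro card_roots_separable) simp_all
  moreover have "poly P x = 0 \<longleftrightarrow> x ^ N + u * x = a" for x
    by (simp add: P_def poly_monom algebra_simps add_eq_0_iff2)
  ultimately show ?thesis using deg by simp
qed

text \<open>
  The setting: an algebraically closed field of prime characteristic, a power \<open>q \<ge> 2\<close> of that
  prime, and the expansions \<open>xi\<close>, \<open>yi\<close>, \<open>zi\<close> of the three coordinate functions at infinity.
\<close>

locale gk =
  fixes q e :: nat and xi yi zi :: "'a::alg_closed_field fls"
  assumes q_ge2: "q \<ge> 2" and char: "prime CHAR('a)" and q_eq: "q = CHAR('a) ^ e"
    and rel_inf: "gk_rel q xi yi zi"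
    and xi: "fls_subdegree xi = - int (q ^ 3 + 1)" "fls_nth xi (- int (q ^ 3 + 1)) = 1"
    and yi: "fls_subdegree yi = - int (q * (q\<^sup>2 - q + 1))"
      "fls_nth yi (- int (q * (q\<^sup>2 - q + 1))) = 1"
    and zi: "fls_subdegree zi = - int (q ^ 3)" "fls_nth zi (- int (q ^ 3)) = 1"
begin

lemma q_zero: "of_nat q = (0 :: 'a)"
  using q_ge2 q_eq by (cases e) simp_all

lemma frobenius: "(a + b :: 'a) ^ (q ^ k) = a ^ (q ^ k) + b ^ (q ^ k)"
  by (rule freshmans_dream'[OF char, of _ "e * k"]) (simp add: q_eq power_mult)

lemma frobenius_fls: "(a + b :: 'a fls) ^ (q ^ k) = a ^ (q ^ k) + b ^ (q ^ k)"
  by (rule freshmans_dream'[of _ "e * k"]) (simp_all add: char q_eq power_mult)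

lemma frobenius_fls_sum: "(sum f A :: 'a fls) ^ (q ^ k) = (\<Sum>i\<in>A. f i ^ (q ^ k))"
  by (rule freshmans_dream_sum'[of _ "e * k"]) (simp_all add: char q_eq power_mult)

lemma xi_nz: "xi \<noteq> 0" and yi_nz: "yi \<noteq> 0" and zi_nz: "zi \<noteq> 0"
  using xi yi zi q_ge2 by auto

abbreviation PF :: "('a fls \<Rightarrow> 'a fls \<Rightarrow> 'a fls \<Rightarrow> 'a fls) set" where
  "PF \<equiv> polyfun UNIV"

lemma card_fibre_y: "card {b. b ^ (q\<^sup>2) - b = (a :: 'a)} = q\<^sup>2"
proof -
  have "q\<^sup>2 \<ge> 2" using q_ge2 gk_exponents(3)[OF q_ge2] by linarith
  then show ?thesis
    using card_additive_roots[of "q\<^sup>2" "-1 :: 'a" a] q_zero by simp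
qed

lemma card_fibre_x: "card {b. b ^ q + b = (a :: 'a)} = q"
  using card_additive_roots[of q "1 :: 'a" a] q_zero q_ge2 by simp

subsection \<open>Normal forms\<close>

text \<open>
  The coordinate ring is free over the polynomials in \<open>z\<close>, with basis \<open>x^i y^j\<close> for
  \<open>i < q\<close> and \<open>j < q^2\<close>. The values of \<open>p i j\<close> for other \<open>i\<close>, \<open>j\<close> are irrelevant.
\<close>

definition nf :: "(nat \<Rightarrow> nat \<Rightarrow> 'a poly) \<Rightarrow> 'a fls \<Rightarrow> 'a fls \<Rightarrow> 'a fls \<Rightarrow> 'a fls" where
  "nf p x y z = (\<Sum>i<q. \<Sum>j<q\<^sup>2. evp (p i j) z * (x ^ i * y ^ j))"

lemma nf_polyfun: "nf p \<in> PF"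
proof -
  have "(\<lambda>x y z. evp (p i j) z * (x ^ i * y ^ j)) \<in> PF" for i j
    by (intro polyfun_mult polyfun_evp polyfun_power polyfun_X polyfun_Y) auto
  then have "(\<lambda>x y z. \<Sum>i<q. \<Sum>j<q\<^sup>2. evp (p i j) z * (x ^ i * y ^ j)) \<in> PF"
    by (intro polyfun_sum) auto
  then show ?thesis by (simp add: nf_def[abs_def])
qed

lemma nf_add: "nf (\<lambda>i j. p i j + r i j) x y z = nf p x y z + nf r x y z"
  by (simp add: nf_def evp_add distrib_right sum.distrib)

lemma nf_monomial:
  "\<exists>p. \<forall>x y z. gk_rel q x y z \<longrightarrow> evp r z * (x ^ i * y ^ j) = nf p x y z"
proof (induction i arbitrary: j r rule: less_induct)
  case (less i)
  note outer = less
  show ?case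
  proof (cases "i < q")
    case False
    define d where "d = i - q"
    have i: "i = d + q" using False by (simp add: d_def)
    obtain p1 where p1: "\<forall>x y z. gk_rel q x y z \<longrightarrow>
        evp r z * (x ^ d * y ^ (j + (q + 1))) = nf p1 x y z"
      using outer[of d r "j + (q + 1)"] i q_ge2 by auto
    obtain p2 where p2: "\<forall>x y z. gk_rel q x y z \<longrightarrow>
        evp (- r) z * (x ^ Suc d * y ^ j) = nf p2 x y z"
      using outer[of "Suc d" "- r" j] i q_ge2 by auto
    show ?thesis
    proof (intro exI allI impI)
      fix x y z :: "'a fls" assume rel: "gk_rel q x y z"
      then have xq: "x ^ q = y ^ (q + 1) - x" by (simp add: gk_rel_def)
      have "evp r z * (x ^ i * y ^ j)
          = evp r z * (x ^ d * y ^ (j + (q + 1))) + evp (- r) z * (x ^ Suc d * y ^ j)"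
        unfolding i power_add[of x d q] xq power_add[of y j "q + 1"] evp_uminus
        by (simp add: algebra_simps)
      then show "evp r z * (x ^ i * y ^ j) = nf (\<lambda>i j. p1 i j + p2 i j) x y z"
        using p1 p2 rel by (simp only: nf_add)
    qed
  next
    case i: True
    show ?thesis
    proof (induction j arbitrary: r rule: less_induct)
      case (less j)
      show ?case
      proof (cases "j < q\<^sup>2")
        case False
        define d where "d = j - q\<^sup>2"
        have j: "j = d + q\<^sup>2" using False by (simp add: d_def)
        have q2: "q\<^sup>2 > 1" using gk_exponents(3)[OF q_ge2] q_ge2 by linarith
        obtain p1 where p1: "\<forall>x y z. gk_rel q x y z \<longrightarrow>
            evp (r * monom 1 (q\<^sup>2 - q + 1)) z * (x ^ i * y ^ d) = nf p1 x y z"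
          using less[of d] j q2 by (metis less_add_same_cancel1 less_trans zero_less_one)
        obtain p2 where p2: "\<forall>x y z. gk_rel q x y z \<longrightarrow>
            evp r z * (x ^ i * y ^ Suc d) = nf p2 x y z"
          using less[of "Suc d" r] j q2 by auto
        show ?thesis
        proof (intro exI allI impI)
          fix x y z :: "'a fls" assume rel: "gk_rel q x y z"
          then have yq: "y ^ q\<^sup>2 = z ^ (q\<^sup>2 - q + 1) + y" by (simp add: gk_rel_def)
          have "evp r z * (x ^ i * y ^ j) = evp (r * monom 1 (q\<^sup>2 - q + 1)) z * (x ^ i * y ^ d)
              + evp r z * (x ^ i * y ^ Suc d)"
            unfolding j power_add[of y d "q\<^sup>2"] yq evp_mult evp_monom
            by (simp add: algebra_simps)
          then show "evp r z * (x ^ i * y ^ j) = nf (\<lambda>i j. p1 i j + p2 i j) x y z"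
            using p1 p2 rel by (simp only: nf_add)
        qed
      next
        case j: True
        define p where "p = (\<lambda>i' j'. if j' = j then if i' = i then r else 0 else 0)"
        have "nf p x y z = evp r z * (x ^ i * y ^ j)" for x y z
        proof -
          have "evp (p i' j') z * (x ^ i' * y ^ j')
              = (if j' = j then if i' = i then evp r z * (x ^ i * y ^ j) else 0 else 0)" for i' j'
            by (simp add: p_def)
          then show ?thesis using i j by (simp add: nf_def)
        qed
        then show ?thesis by metis
      qed
    qed
  qed
qed

lemma normal_form:
  assumes "g \<in> PF"
  shows "\<exists>p. \<forall>x y z. gk_rel q x y z \<longrightarrow> g x y z = nf p x y z"
  using assms
proof induction
    case (monomial a i j k)
    obtain p where "\<forall>x y z. gk_rel q x y z \<longrightarrow> evp (monom a k) z * (x ^ i * y ^ j) = nf p x y z"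
      using nf_monomial by blast
    then show ?case by (intro exI[of _ p]) (simp add: evp_monom algebra_simps)
  next
    case (add g h)
    then obtain p r where "\<forall>x y z. gk_rel q x y z \<longrightarrow> g x y z = nf p x y z"
      "\<forall>x y z. gk_rel q x y z \<longrightarrow> h x y z = nf r x y z" by blast
    then show ?case by (intro exI[of _ "\<lambda>i j. p i j + r i j"]) (simp add: nf_add)
qed

text \<open>The expansion at infinity of the monomial \<open>x^i y^j z^k\<close>.\<close>

abbreviation mono_inf :: "nat \<times> nat \<times> nat \<Rightarrow> 'a fls" where
  "mono_inf \<equiv> \<lambda>(i, j, k). xi ^ i * yi ^ j * zi ^ k"

text \<open>The basis monomials of degree at most \<open>D\<close> in \<open>z\<close>.\<close>

definition box :: "nat \<Rightarrow> (nat \<times> nat \<times> nat) set" where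
  "box D = {..<q} \<times> {..<q\<^sup>2} \<times> {..D}"

lemma finite_box [simp]: "finite (box D)"
  by (simp add: box_def)

lemma mono_inf_nz: "mono_inf u \<noteq> 0"
  by (cases u) (simp add: xi_nz yi_nz zi_nz)

lemma mono_inf_subdegree: "fls_subdegree (xi ^ i * yi ^ j * zi ^ k) = - int (gk_weight q i j k)"
proof -
  define M where "M = q * (q\<^sup>2 - q + 1)"
  show ?thesis
    unfolding gk_weight_def M_def[symmetric]
    by (simp add: fls_subdegree_pow xi yi[folded M_def] zi xi_nz yi_nz zi_nz algebra_simps)
qed

lemma mono_inf_inj:
  assumes "u \<in> box D" "u' \<in> box D" "fls_subdegree (mono_inf u) = fls_subdegree (mono_inf u')"
  shows "u = u'"
proof -
  obtain i j k i' j' k' where u: "u = (i, j, k)" "u' = (i', j', k')" by (metis prod_cases3)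
  then show ?thesis
    using assms gk_weight_inj[OF q_ge2, of i j k i' j' k']
    by (simp add: box_def mono_inf_subdegree)
qed

lemma mono_inf_inj_on: "inj_on (\<lambda>u. fls_subdegree (mono_inf u)) (box D)"
  using mono_inf_inj by (intro inj_onI) blast

lemma nf_expand:
  assumes "\<And>i j. i < q \<Longrightarrow> j < q\<^sup>2 \<Longrightarrow> degree (p i j) \<le> D"
  shows "nf p x y z = (\<Sum>(i, j, k)\<in>box D. fls_const (coeff (p i j) k) * (x ^ i * y ^ j * z ^ k))"
proof -
  have "nf p x y z
      = (\<Sum>i<q. \<Sum>j<q\<^sup>2. \<Sum>k\<le>D. fls_const (coeff (p i j) k) * (x ^ i * y ^ j * z ^ k))"
    unfolding nf_def
    by (intro sum.cong refl) (simp add: evp_altdef[OF assms] sum_distrib_right sum_distrib_left algebra_simps)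
  then show ?thesis by (simp add: box_def sum.cartesian_product)
qed

lemma degree_bound:
  obtains D where "\<And>i j. i < q \<Longrightarrow> j < q\<^sup>2 \<Longrightarrow> degree (p i j :: 'a poly) \<le> D"
proof
  fix i j assume "i < q" "j < q\<^sup>2"
  then show "degree (p i j) \<le> (\<Sum>i<q. \<Sum>j<q\<^sup>2. degree (p i j))"
    by (intro order.trans[OF member_le_sum[of j "{..<q\<^sup>2}" "\<lambda>j. degree (p i j)"]]
        member_le_sum[of i "{..<q}" "\<lambda>i. \<Sum>j<q\<^sup>2. degree (p i j)"]) auto
qed

lemma nf_inf_zero:
  assumes "nf p xi yi zi = 0" and "i < q" "j < q\<^sup>2"
  shows "p i j = 0"
proof (rule poly_eqI)
  fix k
  obtain D where D: "\<And>i j. i < q \<Longrightarrow> j < q\<^sup>2 \<Longrightarrow> degree (p i j) \<le> D" using degree_bound[of p] by blast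
  let ?c = "\<lambda>(i, j, k). coeff (p i j) k"
  have "(\<Sum>u\<in>box D. fls_const (?c u) * mono_inf u) = 0"
    using assms(1) nf_expand[of p D xi, OF D] by (simp add: case_prod_unfold)
  then have "?c (i, j, k) = 0" if "k \<le> D"
    using assms that
    by (intro fls_combination_independent[OF finite_box mono_inf_nz mono_inf_inj_on])
       (auto simp: box_def)
  moreover have "coeff (p i j) k = 0" if "k > D"
    using D[OF assms(2,3)] that by (intro coeff_eq_0) simp
  ultimately show "coeff (p i j) k = coeff 0 k" by (cases "k \<le> D") simp_all
qed

lemma nf_inf_weight:
  assumes "nf p xi yi zi = 0 \<or> - int N \<le> fls_subdegree (nf p xi yi zi)"
    and ij: "i < q" "j < q\<^sup>2" and k: "coeff (p i j) k \<noteq> 0"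
  shows "gk_weight q i j k \<le> N"
proof -
  obtain D where D: "\<And>i j. i < q \<Longrightarrow> j < q\<^sup>2 \<Longrightarrow> degree (p i j) \<le> D" using degree_bound[of p] by blast
  let ?c = "\<lambda>(i, j, k). coeff (p i j) k"
  have "k \<le> D" using k D[OF ij] by (meson le_degree order.trans)
  then have u: "(i, j, k) \<in> box D" "?c (i, j, k) \<noteq> 0" using ij k by (simp_all add: box_def)
  then obtain u0 where u0: "u0 \<in> box D" "?c u0 \<noteq> 0" "\<And>u. u \<in> box D \<Longrightarrow> ?c u \<noteq> 0 \<Longrightarrow>
      fls_subdegree (mono_inf u0) \<le> fls_subdegree (mono_inf u)"
    using fls_combination_min[OF finite_box, of "(i, j, k)" D ?c mono_inf] by blast
  have nf: "nf p xi yi zi = (\<Sum>u\<in>box D. fls_const (?c u) * mono_inf u)"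
    using nf_expand[of p D xi, OF D] by (simp add: case_prod_unfold)
  have "fls_subdegree (nf p xi yi zi) = fls_subdegree (mono_inf u0)" "nf p xi yi zi \<noteq> 0"
    unfolding nf using fls_combination_subdegree[where g = mono_inf and c = ?c and I = "box D",
        OF finite_box mono_inf_nz mono_inf_inj_on u0]
    by blast+
  then have "- int N \<le> fls_subdegree (mono_inf (i, j, k))"
    using assms(1) u0(3)[OF u] by linarith
  then show ?thesis by (simp add: mono_inf_subdegree)
qed

lemma nf_fibre_zero:
  assumes zero: "\<And>a b. gk_rel q a b c \<Longrightarrow> pval (nf p) a b c = 0" and ij: "i < q" "j < q\<^sup>2"
  shows "poly (p i j) c = 0"
proof -
  have pv: "pval (nf p) a b c = (\<Sum>i<q. (\<Sum>j<q\<^sup>2. poly (p i j) c * b ^ j) * a ^ i)" for a b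
  proof -
    have "fls_const (pval (nf p) a b c)
        = fls_const (\<Sum>i<q. (\<Sum>j<q\<^sup>2. poly (p i j) c * b ^ j) * a ^ i)"
      unfolding fls_const_pval[OF nf_polyfun]
      by (simp add: nf_def evp_const fls_const_sum fls_const_power[symmetric] sum_distrib_right
          sum_distrib_left algebra_simps)
    then show ?thesis by (simp only: fls_const_eq_iff)
  qed
  have inner: "(\<Sum>j<q\<^sup>2. poly (p i j) c * b ^ j) = 0" if b: "b ^ (q\<^sup>2) - b = c ^ (q\<^sup>2 - q + 1)" for b
  proof (rule polynomial_zero_of_roots[where f = "\<lambda>i. \<Sum>j<q\<^sup>2. poly (p i j) c * b ^ j"])
    show "card {a. a ^ q + a = b ^ (q + 1)} = q" by (rule card_fibre_x)
    fix a assume "a \<in> {a. a ^ q + a = b ^ (q + 1)}"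
    then have "gk_rel q a b c" using b by (simp add: gk_rel_def)
    then show "(\<Sum>i<q. (\<Sum>j<q\<^sup>2. poly (p i j) c * b ^ j) * a ^ i) = 0" using zero pv by simp
  qed (use ij q_ge2 in auto)
  show ?thesis
  proof (rule polynomial_zero_of_roots[where f = "\<lambda>j. poly (p i j) c"])
    show "card {b. b ^ (q\<^sup>2) - b = c ^ (q\<^sup>2 - q + 1)} = q\<^sup>2" by (rule card_fibre_y)
  qed (use inner ij q_ge2 in auto)
qed

text \<open>
  A polynomial function vanishes on the curve as soon as it vanishes in the function field, and
  then it vanishes at every triple that satisfies the equations of the curve.
\<close>

lemma polyfun_zero:
  assumes g: "g \<in> PF" and "g xi yi zi = 0" and "gk_rel q x y z"
  shows "g x y z = 0"
proof -
  obtain p where p: "\<And>x y z. gk_rel q x y z \<Longrightarrow> g x y z = nf p x y z" using normal_form[OF g] by blast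
  then have "nf p xi yi zi = 0" using assms rel_inf by simp
  then have "p i j = 0" if "i < q" "j < q\<^sup>2" for i j using that nf_inf_zero by blast
  then show ?thesis using p[OF assms(3)] by (simp add: nf_def)
qed

lemma polyfun_eq:
  assumes "g \<in> PF" "h \<in> PF" and "g xi yi zi = h xi yi zi" and "gk_rel q x y z"
  shows "g x y z = h x y z"
  using polyfun_zero[OF polyfun_diff[OF assms(1,2)] _ assms(4)] assms(3) by simp

lemma pval_eq:
  assumes "g \<in> PF" "h \<in> PF" and "g xi yi zi = h xi yi zi" and "gk_rel q a b c"
  shows "pval g a b c = pval h a b c"
  using polyfun_eq[OF assms(1-3)] assms(4) by (simp add: pval_def gk_rel_fls_const)

lemma pval_nf:
  assumes "g \<in> PF" and "\<And>x y z. gk_rel q x y z \<Longrightarrow> g x y z = nf p x y z" and "gk_rel q a b c"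
  shows "pval g a b c = pval (nf p) a b c"
  using assms by (simp add: pval_def gk_rel_fls_const)

lemma polyfun_vanishes_iff:
  assumes g: "g \<in> PF"
  shows "g xi yi zi = 0 \<longleftrightarrow> (\<forall>a b c. gk_rel q a b c \<longrightarrow> pval g a b c = 0)"
proof
  assume "g xi yi zi = 0"
  then show "\<forall>a b c. gk_rel q a b c \<longrightarrow> pval g a b c = 0"
    using polyfun_zero[OF g] by (simp add: pval_def gk_rel_fls_const)
next
  assume zero: "\<forall>a b c. gk_rel q a b c \<longrightarrow> pval g a b c = 0"
  obtain p where p: "\<And>x y z. gk_rel q x y z \<Longrightarrow> g x y z = nf p x y z" using normal_form[OF g] by blast
  have "p i j = 0" if "i < q" "j < q\<^sup>2" for i j
  proof -
    have "poly (p i j) c = 0" for c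
      using zero pval_nf[OF g p] that by (intro nf_fibre_zero) auto
    then show ?thesis by (rule polynomial_zero_of_values)
  qed
  then show "g xi yi zi = 0" using p[OF rel_inf] by (simp add: nf_def)
qed

text \<open>
  A function that vanishes on the whole fibre over \<open>z = c\<close> is divisible by \<open>z - c\<close>: that fibre
  consists of \<open>q^3\<close> points, as many as the rank of the coordinate ring.
\<close>

lemma fibre_divisible:
  assumes g: "g \<in> PF" and zero: "\<And>a b. gk_rel q a b c \<Longrightarrow> pval g a b c = 0"
  obtains g' where "g' \<in> PF"
    and "\<And>x y z. gk_rel q x y z \<Longrightarrow> g x y z = (z - fls_const c) * g' x y z"
proof -
  obtain p where p: "\<And>x y z. gk_rel q x y z \<Longrightarrow> g x y z = nf p x y z" using normal_form[OF g] by blast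
  have z0: "poly (p i j) c = 0" if "i < q" "j < q\<^sup>2" for i j
    using nf_fibre_zero[OF _ that] zero pval_nf[OF g p] by simp
  have div: "p i j = [:-c, 1:] * (p i j div [:-c, 1:])" if "i < q" "j < q\<^sup>2" for i j
    by (rule dvd_mult_div_cancel[symmetric]) (use z0[OF that] in \<open>simp add: poly_eq_0_iff_dvd\<close>)
  have "evp (p i j) z = (z - fls_const c) * evp (p i j div [:-c, 1:]) z" if "i < q" "j < q\<^sup>2" for i j z
    by (subst div[OF that], subst evp_mult) (simp only: evp_linear)
  then have "nf p x y z = (z - fls_const c) * nf (\<lambda>i j. p i j div [:-c, 1:]) x y z" for x y z
    by (simp add: nf_def sum_distrib_left mult.assoc)
  then show ?thesis using that[OF nf_polyfun] p by metis
qed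

text \<open>The basis monomials with a pole of order at most \<open>N\<close> at infinity.\<close>

definition basis :: "nat \<Rightarrow> (nat \<times> nat \<times> nat) set" where
  "basis N = {(i, j, k). i < q \<and> j < q\<^sup>2 \<and> gk_weight q i j k \<le> N}"

lemma basis_subset_box: "basis N \<subseteq> box N"
proof -
  have "k \<le> N" if "gk_weight q i j k \<le> N" for i j k
  proof -
    have "k * 1 \<le> k * q ^ 3" using q_ge2 by (intro mult_le_mono) auto
    also have "k * q ^ 3 \<le> gk_weight q i j k" by (simp add: gk_weight_def)
    finally show ?thesis using that by simp
  qed
  then show ?thesis by (auto simp: basis_def box_def)
qed

lemma finite_basis [simp]: "finite (basis N)"
  using basis_subset_box finite_box finite_subset by blast

lemma basis_expansion:
  assumes g: "g \<in> PF" and N: "g xi yi zi = 0 \<or> - int N \<le> fls_subdegree (g xi yi zi)"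
  obtains c where "\<And>x y z. gk_rel q x y z \<Longrightarrow>
    g x y z = (\<Sum>(i, j, k)\<in>basis N. fls_const (c (i, j, k)) * (x ^ i * y ^ j * z ^ k))"
proof -
  obtain p where p: "\<And>x y z. gk_rel q x y z \<Longrightarrow> g x y z = nf p x y z" using normal_form[OF g] by blast
  obtain D0 where D0: "\<And>i j. i < q \<Longrightarrow> j < q\<^sup>2 \<Longrightarrow> degree (p i j) \<le> D0" using degree_bound[of p] by blast
  define D where "D = max D0 N"
  have D: "\<And>i j. i < q \<Longrightarrow> j < q\<^sup>2 \<Longrightarrow> degree (p i j) \<le> D" using D0 by (force simp: D_def)
  have sub: "basis N \<subseteq> box D" using basis_subset_box[of N] by (auto simp: box_def D_def)
  have expand: "nf p x y z = (\<Sum>(i, j, k)\<in>box D. fls_const (coeff (p i j) k) * (x ^ i * y ^ j * z ^ k))"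
    for x y z by (rule nf_expand) (rule D)
  have big: "coeff (p i j) k = 0" if "(i, j, k) \<in> box D - basis N" for i j k
    using nf_inf_weight[of p N i j k] N that p[OF rel_inf] by (auto simp: box_def basis_def)
  have "g x y z = (\<Sum>(i, j, k)\<in>basis N. fls_const (coeff (p i j) k) * (x ^ i * y ^ j * z ^ k))"
    if "gk_rel q x y z" for x y z
    unfolding p[OF that] expand
    by (intro sum.mono_neutral_right finite_box sub) (auto simp: big)
  then show ?thesis
    by (intro that[of "\<lambda>(i, j, k). coeff (p i j) k"]) (simp add: case_prod_unfold)
qed

text \<open>Weights are distinct, so each step raises the number of monomials by at most one.\<close>

lemma card_basis_add: "card (basis (w + d)) \<le> card (basis w) + d"
proof (induction d)
  case (Suc d)
  let ?E = "{(i, j, k). i < q \<and> j < q\<^sup>2 \<and> gk_weight q i j k = w + Suc d}"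
  have "card ?E \<le> 1"
  proof (rule ccontr)
    assume "\<not> card ?E \<le> 1"
    then obtain u v where uv: "u \<in> ?E" "v \<in> ?E" "u \<noteq> v"
      by (metis (no_types, lifting) One_nat_def card_le_Suc0_iff_eq card.infinite le_SucI le_zero_eq)
    obtain i j k i' j' k' where "u = (i, j, k)" "v = (i', j', k')" by (metis prod_cases3)
    then show False using uv gk_weight_inj[OF q_ge2, of i j k i' j' k'] by simp
  qed
  moreover have "basis (w + Suc d) \<subseteq> basis (w + d) \<union> ?E" by (auto simp: basis_def)
  then have "card (basis (w + Suc d)) \<le> card (basis (w + d) \<union> ?E)"
    by (intro card_mono) (auto intro: finite_subset[OF _ finite_basis[of "w + Suc d"]]
        simp: basis_def)
  then have "card (basis (w + Suc d)) \<le> card (basis (w + d)) + card ?E"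
    using card_Un_le[of "basis (w + d)" ?E] by linarith
  ultimately show ?case using Suc.IH by simp
qed simp

subsection \<open>Norms and normality\<close>

text \<open>
  Every nonzero function divides a nonzero polynomial in \<open>z\<close>. If the pole order of \<open>g\<close> is at most
  \<open>T\<close>, the powers \<open>z^k\<close> with \<open>k \<le> T\<close> and the products of \<open>g\<close> with the basis monomials of weight at
  most \<open>q^3 T\<close> are too many to be linearly independent among the functions with poles of order at
  most \<open>q^3 T + T\<close>.
\<close>

lemma norm_exists:
  assumes g: "g \<in> PF" and nz: "g xi yi zi \<noteq> 0"
  obtains g' p where "g' \<in> PF" "p \<noteq> 0" "g xi yi zi * g' xi yi zi = evp p zi"
proof -
  interpret vs: vector_space "\<lambda>a (v :: 'a fls). fls_const a * v"
    by unfold_locales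
       (simp_all add: fls_const_add algebra_simps fls_const_mult del: fls_const_mult_const)
  define T where "T = nat (- fls_subdegree (g xi yi zi))"
  define w where "w = q ^ 3 * T"
  define f where "f = (\<lambda>s. case s of Inl k \<Rightarrow> zi ^ k | Inr u \<Rightarrow> g xi yi zi * mono_inf u)"
  define I where "I = ({..T} <+> basis w)"
  have finI: "finite I" by (simp add: I_def)
  have card: "card (basis (w + T)) < card I"
    using card_basis_add[of w T] by (simp add: I_def card_Plus)
  have span: "h xi yi zi \<in> vs.span (mono_inf ` basis (w + T))"
    if h: "h \<in> PF" "- int (w + T) \<le> fls_subdegree (h xi yi zi)" for h
  proof -
    obtain c where "\<And>x y z. gk_rel q x y z \<Longrightarrow>
      h x y z = (\<Sum>(i, j, k)\<in>basis (w + T). fls_const (c (i, j, k)) * (x ^ i * y ^ j * z ^ k))"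
      using basis_expansion h by blast
    then have "h xi yi zi = (\<Sum>u\<in>basis (w + T). fls_const (c u) * mono_inf u)"
      using rel_inf by (simp add: case_prod_unfold)
    moreover have "mono_inf u \<in> vs.span (mono_inf ` basis (w + T))" if "u \<in> basis (w + T)" for u
      by (intro vs.span_base imageI that)
    ultimately show ?thesis by (simp only:) (intro vs.span_sum vs.span_scale)
  qed
  have fs: "f s \<in> vs.span (mono_inf ` basis (w + T))" if s: "s \<in> I" for s
  proof (cases s)
    case (Inl k)
    have "k \<le> T" using s Inl by (auto simp: I_def)
    then have "k * q ^ 3 \<le> w" by (simp add: w_def)
    then have "gk_weight q 0 0 k \<le> w + T" by (simp add: gk_weight_def)
    then have "- int (w + T) \<le> - int (gk_weight q 0 0 k)"
      by (simp only: neg_le_iff_le of_nat_le_iff)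
    moreover have "(\<lambda>x y z. z ^ k) \<in> PF" by (intro polyfun_power polyfun_Z) auto
    ultimately show ?thesis
      using span[of "\<lambda>x y z. z ^ k"] mono_inf_subdegree[of 0 0 k] Inl by (simp add: f_def)
  next
    case (Inr u)
    obtain i j k where u: "u = (i, j, k)" by (metis prod_cases3)
    have "gk_weight q i j k \<le> w" using s Inr u by (auto simp: I_def basis_def)
    moreover have "- int T \<le> fls_subdegree (g xi yi zi)" by (simp add: T_def)
    moreover have "fls_subdegree (g xi yi zi * (xi ^ i * yi ^ j * zi ^ k))
        = fls_subdegree (g xi yi zi) - int (gk_weight q i j k)"
      using nz mono_inf_nz[of u] by (subst fls_subdegree_mult) (simp_all add: u mono_inf_subdegree)
    ultimately have "- int (w + T) \<le> fls_subdegree (g xi yi zi * (xi ^ i * yi ^ j * zi ^ k))"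
      by simp
    moreover have "(\<lambda>x y z. g x y z * (x ^ i * y ^ j * z ^ k)) \<in> PF"
      by (intro polyfun_mult polyfun_power polyfun_X polyfun_Y polyfun_Z g) auto
    ultimately show ?thesis
      using span[of "\<lambda>x y z. g x y z * (x ^ i * y ^ j * z ^ k)"] Inr u by (simp add: f_def)
  qed
  have "\<exists>c s. s \<in> I \<and> c s \<noteq> 0 \<and> (\<Sum>s\<in>I. fls_const (c s) * f s) = 0"
    by (rule vs.nontrivial_relation[OF finI finite_basis card, of f mono_inf]) (use fs in blast)+
  then obtain c s where cs: "s \<in> I" "c s \<noteq> 0" "(\<Sum>s\<in>I. fls_const (c s) * f s) = 0"
    by blast
  define p where "p = (\<Sum>k\<le>T. monom (- c (Inl k)) k)"
  define g' where "g' = (\<lambda>x y z. \<Sum>(i, j, k)\<in>basis w.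
      fls_const (c (Inr (i, j, k))) * (x ^ i * y ^ j * z ^ k))"
  have g': "g' \<in> PF"
    unfolding g'_def case_prod_unfold by (intro polyfun_sum polyfun.monomial) auto
  have g'_inf: "g' xi yi zi = (\<Sum>u\<in>basis w. fls_const (c (Inr u)) * mono_inf u)"
    by (simp add: g'_def case_prod_unfold)
  have "coeff p k = (if k \<le> T then - c (Inl k) else 0)" for k
    by (simp add: p_def coeff_sum)
  then have pc: "coeff p k = - c (Inl k)" if "k \<le> T" for k using that by simp
  have "degree p \<le> T" by (rule degree_le) (simp add: p_def coeff_sum)
  then have p_inf: "evp p zi = - (\<Sum>k\<le>T. fls_const (c (Inl k)) * zi ^ k)"
    by (simp add: evp_altdef pc sum_negf flip: fls_const_uminus)
  have "0 = (\<Sum>k\<le>T. fls_const (c (Inl k)) * zi ^ k)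
      + (\<Sum>u\<in>basis w. fls_const (c (Inr u)) * (g xi yi zi * mono_inf u))"
    using cs(3) by (simp add: I_def sum.Plus f_def)
  also have "(\<Sum>u\<in>basis w. fls_const (c (Inr u)) * (g xi yi zi * mono_inf u))
      = g xi yi zi * g' xi yi zi"
    by (simp add: g'_inf sum_distrib_left algebra_simps)
  finally have rel: "g xi yi zi * g' xi yi zi = evp p zi"
    using p_inf by (metis add.commute eq_neg_iff_add_eq_0)
  have "p \<noteq> 0"
  proof
    assume p: "p = 0"
    then have "g' xi yi zi = 0" using rel nz by simp
    then have "c (Inr u) = 0" if "u \<in> basis w" for u
      using that g'_inf
      by (intro fls_combination_independent[OF finite_basis mono_inf_nz
            inj_on_subset[OF mono_inf_inj_on basis_subset_box]]) simp_all
    moreover have "c (Inl k) = 0" if "k \<le> T" for k using pc[OF that] p by simp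
    ultimately show False using cs(1,2) by (auto simp: I_def)
  qed
  then show ?thesis using that g' rel by blast
qed

text \<open>The local ring at an affine point of the curve and its maximal ideal.\<close>

definition loc :: "'a \<Rightarrow> 'a \<Rightarrow> 'a \<Rightarrow> 'a fls set" where
  "loc a b c = {g xi yi zi / h xi yi zi | g h. g \<in> PF \<and> h \<in> PF \<and> pval h a b c \<noteq> 0}"

definition max_ideal :: "'a \<Rightarrow> 'a \<Rightarrow> 'a \<Rightarrow> 'a fls set" where
  "max_ideal a b c = {g xi yi zi / h xi yi zi | g h.
     g \<in> PF \<and> h \<in> PF \<and> pval h a b c \<noteq> 0 \<and> pval g a b c = 0}"

lemma inf_nz: "h \<in> PF \<Longrightarrow> gk_rel q a b c \<Longrightarrow> pval h a b c \<noteq> 0 \<Longrightarrow> h xi yi zi \<noteq> 0"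
  using polyfun_vanishes_iff by blast

lemma zi_minus_const_nz: "zi - fls_const c \<noteq> 0"
proof
  assume "zi - fls_const c = 0"
  then have "fls_subdegree zi = 0" by simp
  then show False using zi q_ge2 by simp
qed

text \<open>
  The denominator \<open>p\<close> is removed one root at a time: regularity along the fibre \<open>z = c\<close> over a root
  \<open>c\<close> of \<open>p\<close> makes the numerator vanish on that fibre.
\<close>

lemma regular_is_polyfun:
  assumes \<phi>: "evp p zi * \<phi> = g xi yi zi" and "p \<noteq> 0" "g \<in> PF"
    and reg: "\<And>a b c. gk_rel q a b c \<Longrightarrow> \<phi> \<in> loc a b c"
  shows "\<exists>g'\<in>PF. \<phi> = g' xi yi zi"
  using assms(1-3)
proof (induction "degree p" arbitrary: p g)
  case 0
  then obtain u where p: "p = [:u:]" by (metis degree_eq_zeroE)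
  then have u: "u \<noteq> 0" using 0 by simp
  have "fls_const (inverse u) * (fls_const u * \<phi>) = fls_const (inverse u) * g xi yi zi"
    using 0 by (simp add: p evp_pCons)
  then have "\<phi> = fls_const (inverse u) * g xi yi zi"
    using u by (simp flip: mult.assoc)
  then show ?case by (intro bexI[OF _ polyfun_scale[OF \<open>g \<in> PF\<close>, of "inverse u"]])
next
  case (Suc n)
  then obtain c where c: "poly p c = 0"
    by (metis alg_closed_imp_poly_has_root zero_less_Suc)
  then obtain p' where p': "p = [:-c, 1:] * p'" by (auto simp: poly_eq_0_iff_dvd)
  have "p' \<noteq> 0" using Suc.prems p' by auto
  then have deg: "n = degree p'" using Suc.hyps(2) unfolding p' by (subst (asm) degree_mult_eq) auto
  have "pval g a b c = 0" if ab: "gk_rel q a b c" for a b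
  proof -
    obtain g1 h1 where gh: "\<phi> = g1 xi yi zi / h1 xi yi zi" "g1 \<in> PF" "h1 \<in> PF"
      "pval h1 a b c \<noteq> 0" using reg[OF ab] by (auto simp: loc_def)
    then have "h1 xi yi zi \<noteq> 0" using inf_nz ab by blast
    then have "g xi yi zi * h1 xi yi zi = evp p zi * g1 xi yi zi"
      using Suc.prems(1) gh(1) by (simp add: field_simps)
    then have "pval (\<lambda>x y z. g x y z * h1 x y z) a b c = pval (\<lambda>x y z. evp p z * g1 x y z) a b c"
      using gh Suc.prems ab by (intro pval_eq polyfun_mult polyfun_evp) auto
    then have "pval g a b c * pval h1 a b c = 0"
      using gh Suc.prems c by (simp add: pval_mult[of _ UNIV] polyfun_evp pval_evp)
    then show ?thesis using gh by simp
  qed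
  then obtain g' where g': "g' \<in> PF"
    "\<And>x y z. gk_rel q x y z \<Longrightarrow> g x y z = (z - fls_const c) * g' x y z"
    using fibre_divisible[OF \<open>g \<in> PF\<close>] by blast
  have ev: "evp p zi = (zi - fls_const c) * evp p' zi"
    unfolding p' evp_mult by (simp only: evp_linear)
  have "evp p' zi * \<phi> = g' xi yi zi"
    using zi_minus_const_nz[of c] Suc.prems(1) g'(2)[OF rel_inf] ev by (simp add: mult.assoc)
  then show ?case using Suc.hyps(1)[OF deg] \<open>p' \<noteq> 0\<close> g'(1) by blast
qed

text \<open>The affine curve is normal: a function without affine poles is a polynomial function.\<close>

lemma regular_on_affine:
  assumes \<phi>: "\<phi> = g xi yi zi / h xi yi zi" "g \<in> PF" "h \<in> PF" "h xi yi zi \<noteq> 0"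
    and reg: "\<And>a b c. gk_rel q a b c \<Longrightarrow> \<phi> \<in> loc a b c"
  obtains g' where "g' \<in> PF" "\<phi> = g' xi yi zi"
proof -
  obtain h' p where h': "h' \<in> PF" "p \<noteq> 0" "h xi yi zi * h' xi yi zi = evp p zi"
    using norm_exists \<phi> by blast
  have "evp p zi * \<phi> = g xi yi zi * h' xi yi zi"
    using \<phi> by (simp add: h'(3)[symmetric])
  then have "evp p zi * \<phi> = (\<lambda>x y z. g x y z * h' x y z) xi yi zi" by simp
  moreover have "(\<lambda>x y z. g x y z * h' x y z) \<in> PF" using \<phi> h' by (intro polyfun_mult) auto
  ultimately have "\<exists>g'\<in>PF. \<phi> = g' xi yi zi"
    by (rule regular_is_polyfun[where g = "\<lambda>x y z. g x y z * h' x y z", OF _ h'(2) _ reg])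
  then show ?thesis using that by blast
qed

text \<open>At every affine point with \<open>z = c\<close> the function \<open>z - c\<close> is a local parameter.\<close>

lemma affine_uniformizer:
  assumes P: "gk_rel q a b c"
  shows "max_ideal a b c = {(zi - fls_const c) * \<phi> | \<phi>. \<phi> \<in> loc a b c}"
proof (intro equalityI subsetI)
  fix \<psi> assume "\<psi> \<in> max_ideal a b c"
  then obtain g h where gh: "\<psi> = g xi yi zi / h xi yi zi" "g \<in> PF" "h \<in> PF"
    "pval h a b c \<noteq> 0" "pval g a b c = 0" by (auto simp: max_ideal_def)
  \<comment> \<open>A polynomial function that is nonzero at the point and zero on the rest of its fibre.\<close>
  define B where "B = {b'. b' ^ (q\<^sup>2) - b' = c ^ (q\<^sup>2 - q + 1)} - {b}"
  define A where "A = {a'. a' ^ q + a' = b ^ (q + 1)} - {a}"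
  define u where "u = (\<lambda>x y (z :: 'a fls). (\<Prod>b'\<in>B. y - fls_const b') * (\<Prod>a'\<in>A. x - fls_const a'))"
  have fin: "finite A" "finite B"
    using card_fibre_x[of "b ^ (q + 1)"] card_fibre_y[of "c ^ (q\<^sup>2 - q + 1)"] q_ge2
    by (auto simp: A_def B_def intro!: card_ge_0_finite)
  have u: "u \<in> PF" unfolding u_def
    by (intro polyfun_mult polyfun_prod polyfun_diff polyfun_X polyfun_Y polyfun_const) auto
  have pu: "pval u a' b' c' = (\<Prod>b''\<in>B. b' - b'') * (\<Prod>a''\<in>A. a' - a'')" for a' b' c'
  proof -
    have "fls_const (pval u a' b' c') = fls_const ((\<Prod>b''\<in>B. b' - b'') * (\<Prod>a''\<in>A. a' - a''))"
      unfolding fls_const_pval[OF u]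
      by (simp add: u_def fls_const_prod fls_const_mult fls_const_diff del: fls_const_mult_const)
    then show ?thesis by (simp only: fls_const_eq_iff)
  qed
  have u0: "pval u a b c \<noteq> 0" using fin by (simp add: pu A_def B_def)
  have "pval (\<lambda>x y z. g x y z * u x y z) a' b' c = 0" if P': "gk_rel q a' b' c" for a' b'
  proof (cases "b' = b \<and> a' = a")
    case True
    then show ?thesis using gh by (simp add: pval_mult[OF gh(2) u])
  next
    case False
    then have "b' \<in> B \<or> b' = b \<and> a' \<in> A"
      using P' by (auto simp: A_def B_def gk_rel_def)
    then have "pval u a' b' c = 0" using fin by (auto simp: pu)
    then show ?thesis by (simp add: pval_mult[OF gh(2) u])
  qed
  then obtain g' where g': "g' \<in> PF" "\<And>x y z. gk_rel q x y z \<Longrightarrow>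
      g x y z * u x y z = (z - fls_const c) * g' x y z"
    using fibre_divisible[of "\<lambda>x y z. g x y z * u x y z" c] polyfun_mult[OF _ gh(2) u] by auto
  define h' where "h' = (\<lambda>x y z. h x y z * u x y z)"
  have h': "h' \<in> PF" "pval h' a b c \<noteq> 0"
    using polyfun_mult[OF _ gh(3) u] pval_mult[OF gh(3) u] gh(4) u0 by (simp_all add: h'_def)
  have nz: "u xi yi zi \<noteq> 0" using inf_nz[OF u P u0] .
  have "g xi yi zi = (zi - fls_const c) * g' xi yi zi / u xi yi zi"
    using g'(2)[OF rel_inf] nz by (simp add: eq_divide_eq)
  then have "\<psi> = (zi - fls_const c) * (g' xi yi zi / h' xi yi zi)"
    by (simp add: gh(1) h'_def mult.commute)
  moreover have "g' xi yi zi / h' xi yi zi \<in> loc a b c"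
    unfolding loc_def using g'(1) h' by blast
  ultimately show "\<psi> \<in> {(zi - fls_const c) * \<phi> | \<phi>. \<phi> \<in> loc a b c}" by blast
next
  fix \<psi> assume "\<psi> \<in> {(zi - fls_const c) * \<phi> | \<phi>. \<phi> \<in> loc a b c}"
  then obtain g h where gh: "\<psi> = (zi - fls_const c) * (g xi yi zi / h xi yi zi)" "g \<in> PF" "h \<in> PF"
    "pval h a b c \<noteq> 0" by (auto simp: loc_def)
  define t where "t = (\<lambda>(x :: 'a fls) (y :: 'a fls) z. z - fls_const c)"
  have t: "t \<in> PF" "pval t a b c = 0"
    unfolding t_def by (auto intro!: polyfun_diff polyfun_Z polyfun_const simp: pval_def)
  define s where "s = (\<lambda>x y z. t x y z * g x y z)"
  have "\<psi> = s xi yi zi / h xi yi zi" using gh by (simp add: s_def t_def)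
  moreover have "s \<in> PF" "pval s a b c = 0"
    unfolding s_def using polyfun_mult[OF _ t(1) gh(2)] pval_mult[OF t(1) gh(2)] t by simp_all
  ultimately show "\<psi> \<in> max_ideal a b c" using gh unfolding max_ideal_def by blast
qed

text \<open>
  If \<open>g g' = p(z)\<close>, then the order of \<open>g\<close> at a point with \<open>z = c\<close> is at most the multiplicity of the
  root \<open>c\<close> of \<open>p\<close>.
\<close>

lemma affine_order_bounded:
  assumes P: "gk_rel q a b c" and \<psi>: "\<psi> \<in> loc a b c" "\<psi> \<noteq> 0"
  obtains N where "\<And>n \<phi>. n > N \<Longrightarrow> \<phi> \<in> loc a b c \<Longrightarrow> \<psi> \<noteq> (zi - fls_const c) ^ n * \<phi>"
proof -
  obtain g h where gh: "\<psi> = g xi yi zi / h xi yi zi" "g \<in> PF" "h \<in> PF" "pval h a b c \<noteq> 0"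
    using \<psi> by (auto simp: loc_def)
  have hnz: "h xi yi zi \<noteq> 0" using inf_nz gh P by blast
  then have "g xi yi zi \<noteq> 0" using gh \<psi> by auto
  then obtain g' p where g': "g' \<in> PF" "p \<noteq> 0" "g xi yi zi * g' xi yi zi = evp p zi"
    using norm_exists gh by blast
  obtain p' where p': "p = [:-c, 1:] ^ order c p * p'" "\<not> [:-c, 1:] dvd p'"
    using order_decomp[OF g'(2)] by blast
  have "\<psi> \<noteq> (zi - fls_const c) ^ n * \<phi>" if n: "n > order c p" and \<phi>: "\<phi> \<in> loc a b c" for n \<phi>
  proof
    assume eq: "\<psi> = (zi - fls_const c) ^ n * \<phi>"
    obtain g1 h1 where g1: "\<phi> = g1 xi yi zi / h1 xi yi zi" "g1 \<in> PF" "h1 \<in> PF"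
      "pval h1 a b c \<noteq> 0" using \<phi> by (auto simp: loc_def)
    have h1nz: "h1 xi yi zi \<noteq> 0" using inf_nz g1 P by blast
    obtain d where d: "n = order c p + Suc d" using n less_imp_Suc_add by fastforce
    have pz: "evp p zi = (zi - fls_const c) ^ order c p * evp p' zi"
      by (subst p'(1)) (simp only: evp_mult evp_linear_power)
    have "g xi yi zi * h1 xi yi zi = (zi - fls_const c) ^ n * g1 xi yi zi * h xi yi zi"
      using eq gh(1) g1(1) hnz h1nz by (simp add: field_simps)
    then have "(g xi yi zi * h1 xi yi zi) * g' xi yi zi
        = (zi - fls_const c) ^ n * g1 xi yi zi * h xi yi zi * g' xi yi zi" by simp
    moreover have "(g xi yi zi * h1 xi yi zi) * g' xi yi zi = evp p zi * h1 xi yi zi"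
      unfolding g'(3)[symmetric] by (simp only: mult.assoc mult.commute[of "h1 xi yi zi"])
    ultimately have "(zi - fls_const c) ^ order c p * (evp p' zi * h1 xi yi zi)
      = (zi - fls_const c) ^ order c p *
        ((zi - fls_const c) ^ Suc d * g1 xi yi zi * h xi yi zi * g' xi yi zi)"
      unfolding pz d power_add by (simp only: mult.assoc)
    then have "evp p' zi * h1 xi yi zi
        = (zi - fls_const c) ^ Suc d * g1 xi yi zi * h xi yi zi * g' xi yi zi"
      using zi_minus_const_nz by simp
    then have "pval (\<lambda>x y z. evp p' z * h1 x y z) a b c = pval (\<lambda>x y z.
        (z - fls_const c) ^ Suc d * g1 x y z * h x y z * g' x y z) a b c"
      using gh g1 g' P
      by (intro pval_eq polyfun_mult polyfun_power polyfun_diff polyfun_Z polyfun_const polyfun_evp)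
         auto
    also have "\<dots> = 0" by (simp add: pval_def)
    finally have "poly p' c = 0"
      using g1 by (simp add: pval_mult[of _ UNIV] polyfun_evp pval_evp)
    then show False using p'(2) by (simp add: poly_eq_0_iff_dvd)
  qed
  then show ?thesis using that by blast
qed

end

section \<open>The projective curve and its function field\<close>

lemma eval_fls_power: "eval_fls (F ^ n) v = eval_fls F v ^ n"
  by (induction n) (simp_all add: eval_fls_mult)

lemma eval_power: "eval (F ^ n) v = eval F v ^ n"
  by (induction n) (simp_all add: eval_mult)

lemma homogeneous_power: "homogeneous d F \<Longrightarrow> homogeneous (d * n) (F ^ n)"
  by (induction n) (simp_all add: homogeneous_mult)

text \<open>A variable, as a form of degree one.\<close>

definition mvar :: "'n::finite \<Rightarrow> ('a::field, 'n) mpoly" where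
  "mvar i = Poly_Mapping.single (Poly_Mapping.single i 1) 1"

lemma homogeneous_mvar: "homogeneous 1 (mvar i)"
  unfolding mvar_def
  by (intro homogeneous_single) (simp add: lookup_single when_def)

lemma eval_fls_mvar [simp]: "eval_fls (mvar i) v = v $ i"
proof -
  have "(\<Prod>j\<in>UNIV. (v $ j) ^ Poly_Mapping.lookup (Poly_Mapping.single i (1 :: nat)) j)
      = (\<Prod>j\<in>UNIV. if j = i then v $ i else 1)"
    by (intro prod.cong) (auto simp: lookup_single when_def)
  then show ?thesis by (simp add: mvar_def eval_fls_single)
qed

lemma eval_mvar [simp]: "eval (mvar i) v = v $ i"
proof -
  have "fls_const (eval (mvar i) v) = fls_const (v $ i)"
    by (subst eval_fls_const[symmetric]) simp
  then show ?thesis by (simp only: fls_const_eq_iff)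
qed

lemma homogeneous_mvar_power: "homogeneous n (mvar i ^ n)"
  using homogeneous_power[OF homogeneous_mvar, of n i] by simp

text \<open>Evaluating at power series and taking constant terms commute.\<close>

lemma eval_fls_regular:
  fixes v :: "'a::field fls ^ 'n::finite"
  assumes v: "\<And>i. fls_subdegree (v $ i) \<ge> 0"
  shows "fls_subdegree (eval_fls F v) \<ge> 0"
    and "fls_nth (eval_fls F v) 0 = eval F (\<chi> i. fls_nth (v $ i) 0)"
proof -
  define p where "p = (\<lambda>i. fls_regpart (v $ i))"
  have vp: "v $ i = fps_to_fls (p i)" for i using v[of i] by (simp add: p_def)
  define s where "s = (\<Sum>m\<in>Poly_Mapping.keys F. fps_const (Poly_Mapping.lookup F m) *
     (\<Prod>i\<in>UNIV. p i ^ Poly_Mapping.lookup m i))"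
  have to_fls_sum: "fps_to_fls (sum f A) = (\<Sum>x\<in>A. fps_to_fls (f x))"
    for f :: "('n \<Rightarrow>\<^sub>0 nat) \<Rightarrow> 'a fps" and A
    by (induction A rule: infinite_finite_induct) simp_all
  have to_fls_prod: "fps_to_fls (prod f A) = (\<Prod>x\<in>A. fps_to_fls (f x))"
    for f :: "'n \<Rightarrow> 'a fps" and A
    by (induction A rule: infinite_finite_induct) (simp_all add: fls_times_fps_to_fls)
  have s: "eval_fls F v = fps_to_fls s"
    by (simp add: eval_fls_def s_def vp to_fls_sum to_fls_prod fls_times_fps_to_fls
        fps_to_fls_power)
  show "fls_subdegree (eval_fls F v) \<ge> 0" by (simp add: s fls_subdegree_fls_to_fps_gt0)
  have "fps_nth (prod f A) 0 = (\<Prod>x\<in>A. fps_nth (f x) 0)" for f :: "'n \<Rightarrow> 'a fps" and A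
    by (induction A rule: infinite_finite_induct) simp_all
  then have "fps_nth s 0 = eval F (\<chi> i. fls_nth (v $ i) 0)"
    by (simp add: s_def eval_def fps_sum_nth vp fps_power_zeroth)
  then show "fls_nth (eval_fls F v) 0 = eval F (\<chi> i. fls_nth (v $ i) 0)" by (simp add: s)
qed

text \<open>Passing between forms and polynomial functions by setting \<open>T = 1\<close>.\<close>

lemma dehomogenize:
  fixes F :: "('a::field, 4) mpoly"
  assumes "0 \<in> K" and "\<And>m. Poly_Mapping.lookup F m \<in> K"
  shows "(\<lambda>x y z. eval_fls F (vector [x, y, z, 1])) \<in> polyfun K"
proof -
  have "(\<lambda>x y z. \<Sum>m\<in>Poly_Mapping.keys F. fls_const (Poly_Mapping.lookup F m) *
      (x ^ Poly_Mapping.lookup m 1 * y ^ Poly_Mapping.lookup m 2 * z ^ Poly_Mapping.lookup m 3))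
      \<in> polyfun K"
    by (intro polyfun_sum polyfun.monomial assms)
  then show ?thesis by (simp add: eval_fls_def prod_4)
qed

lemma dehomogenize_UNIV:
  fixes F :: "('a::field, 4) mpoly"
  shows "(\<lambda>x y z. eval_fls F (vector [x, y, z, 1])) \<in> polyfun UNIV"
  by (rule dehomogenize) auto

lemma pval_dehomogenize:
  fixes F :: "('a::field, 4) mpoly"
  shows
  "pval (\<lambda>x y z. eval_fls F (vector [x, y, z, 1])) a b c = eval F (vector [a, b, c, 1])"
proof -
  have vec: "(vector [fls_const a, fls_const b, fls_const c, 1] :: 'a fls ^ 4)
      = (\<chi> i. fls_const ((vector [a, b, c, 1] :: 'a ^ 4) $ i))"
    by (simp add: vec_eq_iff forall_4)
  show ?thesis unfolding pval_def vec eval_fls_const by simp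
qed

lemma homogenize:
  assumes K: "0 \<in> K" "\<And>a b. a \<in> K \<Longrightarrow> b \<in> K \<Longrightarrow> a + b \<in> K" and g: "g \<in> polyfun K"
  obtains d0 where "\<And>d. d \<ge> d0 \<Longrightarrow> \<exists>F :: ('a::field, 4) mpoly. homogeneous d F \<and>
    (\<forall>m. Poly_Mapping.lookup F m \<in> K) \<and> (\<forall>x y z. eval_fls F (vector [x, y, z, 1]) = g x y z)"
proof -
  have "\<exists>d0. \<forall>d\<ge>d0. \<exists>F :: ('a, 4) mpoly. homogeneous d F \<and>
    (\<forall>m. Poly_Mapping.lookup F m \<in> K) \<and> (\<forall>x y z. eval_fls F (vector [x, y, z, 1]) = g x y z)"
    using g
  proof induction
    case (monomial a i j k)
    show ?case
    proof (intro exI[of _ "i + j + k"] allI impI)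
      fix d assume d: "i + j + k \<le> d"
      let ?F = "Poly_Mapping.single (monom4 i j k (d - (i + j + k))) a"
      have "homogeneous d ?F" using d by (intro homogeneous_monom4) simp
      moreover have "Poly_Mapping.lookup ?F m \<in> K" for m
        using monomial K(1) by (simp add: lookup_single when_def)
      ultimately show "\<exists>F :: ('a, 4) mpoly. homogeneous d F \<and> (\<forall>m. Poly_Mapping.lookup F m \<in> K)
          \<and> (\<forall>x y z. eval_fls F (vector [x, y, z, 1]) = fls_const a * (x ^ i * y ^ j * z ^ k))"
        by (intro exI[of _ ?F]) (simp add: eval_fls_monom4)
    qed
  next
    case (add g h)
    then obtain d1 d2 where d1: "\<And>d. d \<ge> d1 \<Longrightarrow> \<exists>F :: ('a, 4) mpoly. homogeneous d F \<and>
        (\<forall>m. Poly_Mapping.lookup F m \<in> K) \<and> (\<forall>x y z. eval_fls F (vector [x, y, z, 1]) = g x y z)"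
      and d2: "\<And>d. d \<ge> d2 \<Longrightarrow> \<exists>F :: ('a, 4) mpoly. homogeneous d F \<and>
        (\<forall>m. Poly_Mapping.lookup F m \<in> K) \<and> (\<forall>x y z. eval_fls F (vector [x, y, z, 1]) = h x y z)"
      by blast
    show ?case
    proof (intro exI[of _ "max d1 d2"] allI impI)
      fix d assume "max d1 d2 \<le> d"
      then obtain F G :: "('a, 4) mpoly" where "homogeneous d F" "homogeneous d G"
        "\<forall>m. Poly_Mapping.lookup F m \<in> K" "\<forall>m. Poly_Mapping.lookup G m \<in> K"
        "\<forall>x y z. eval_fls F (vector [x, y, z, 1]) = g x y z"
        "\<forall>x y z. eval_fls G (vector [x, y, z, 1]) = h x y z"
        using d1[of d] d2[of d] by auto
      then show "\<exists>F :: ('a, 4) mpoly. homogeneous d F \<and> (\<forall>m. Poly_Mapping.lookup F m \<in> K) \<and>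
          (\<forall>x y z. eval_fls F (vector [x, y, z, 1]) = g x y z + h x y z)"
        using K(2)
        by (intro exI[of _ "F + G"]) (simp add: homogeneous_add lookup_add eval_fls_add)
    qed
  qed
  then show ?thesis using that by blast
qed

text \<open>The projective point with homogeneous coordinates \<open>v\<close>.\<close>

definition pt :: "'a::field ^ 'n \<Rightarrow> ('a, 'n) point" where
  "pt v = proportional `` {v}"

lemma in_pt_iff: "v \<noteq> 0 \<Longrightarrow> w \<in> pt v \<longleftrightarrow> (\<exists>a. a \<noteq> 0 \<and> w = a *s v)"
  by (auto simp: pt_def proportional_def)

lemma pt_in_proj_space: "v \<noteq> 0 \<Longrightarrow> pt v \<in> proj_space"
  by (auto simp: proj_space_def quotient_def pt_def)

lemma proj_space_cases:
  assumes "P \<in> proj_space"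
  obtains v where "v \<noteq> 0" "P = pt v"
  using assms by (auto simp: proj_space_def quotient_def pt_def)

lemma self_in_pt: "v \<noteq> 0 \<Longrightarrow> v \<in> pt v"
  by (auto simp: in_pt_iff intro!: exI[of _ 1])

lemma pt_scale:
  fixes v :: "'a::field ^ 'n"
  assumes "v \<noteq> 0" "a \<noteq> 0"
  shows "pt (a *s v) = pt v"
proof -
  have nz: "a *s v \<noteq> 0" using assms by (simp add: vec_eq_iff)
  have "w \<in> pt (a *s v) \<longleftrightarrow> w \<in> pt v" for w
  proof
    assume "w \<in> pt (a *s v)"
    then obtain b where "b \<noteq> 0" "w = b *s (a *s v)" using in_pt_iff[OF nz] by blast
    then show "w \<in> pt v" using assms
      by (auto simp: in_pt_iff vector_smult_assoc intro!: exI[of _ "b * a"])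
  next
    assume "w \<in> pt v"
    then obtain b where "b \<noteq> 0" "w = b *s v" using in_pt_iff[OF assms(1)] by blast
    then show "w \<in> pt (a *s v)" using assms
      by (auto simp: in_pt_iff[OF nz] vector_smult_assoc intro!: exI[of _ "b / a"])
  qed
  then show ?thesis by blast
qed

lemma vanishes_at_pt:
  assumes "v \<noteq> 0" "homogeneous d F"
  shows "vanishes_at (pt v) F \<longleftrightarrow> eval F v = 0"
proof
  show "eval F v = 0" if "vanishes_at (pt v) F"
    using that self_in_pt[OF assms(1)] unfolding vanishes_at_def by blast
  show "vanishes_at (pt v) F" if "eval F v = 0"
    unfolding vanishes_at_def
  proof
    fix w assume "w \<in> pt v"
    then obtain a where "w = a *s v" using in_pt_iff[OF assms(1)] by blast
    then show "eval F w = 0" using that eval_scale[OF assms(2)] by simp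
  qed
qed

text \<open>The affine point \<open>(a, b, c)\<close> and the common point at infinity of all planes \<open>Z = c\<close> and the curve.\<close>

definition affine_pt :: "'a::field \<Rightarrow> 'a \<Rightarrow> 'a \<Rightarrow> ('a, 4) point" where
  "affine_pt a b c = pt (vector [a, b, c, 1])"

definition inf_pt :: "('a::field, 4) point" where
  "inf_pt = pt (vector [1, 0, 0, 0])"

lemma affine_vec_nz [simp]: "(vector [a, b, c, 1] :: 'a::field ^ 4) \<noteq> 0"
  by (simp add: vec_eq_iff forall_4)

lemma inf_vec_nz [simp]: "(vector [1, 0, 0, 0] :: 'a::field ^ 4) \<noteq> 0"
  by (simp add: vec_eq_iff forall_4)

lemma affine_pt_eq_iff: "affine_pt a b c = affine_pt a' b' c' \<longleftrightarrow> a = a' \<and> b = b' \<and> c = c'"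
proof
  assume "affine_pt a b c = affine_pt a' b' c'"
  then have "vector [a, b, c, 1] \<in> pt (vector [a', b', c', 1] :: 'a ^ 4)"
    using self_in_pt[OF affine_vec_nz, of a b c] by (simp add: affine_pt_def)
  then obtain u where "(vector [a, b, c, 1] :: 'a ^ 4) = u *s vector [a', b', c', 1]"
    by (auto simp: in_pt_iff)
  then show "a = a' \<and> b = b' \<and> c = c'" by (simp add: vec_eq_iff forall_4)
qed simp

lemma affine_pt_neq_inf: "affine_pt a b c \<noteq> inf_pt"
proof
  assume "affine_pt a b c = inf_pt"
  then have "vector [a, b, c, 1] \<in> pt (vector [1, 0, 0, 0] :: 'a ^ 4)"
    using self_in_pt[OF affine_vec_nz, of a b c] by (simp add: affine_pt_def inf_pt_def)
  then obtain u where "(vector [a, b, c, 1] :: 'a ^ 4) = u *s vector [1, 0, 0, 0]"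
    by (auto simp: in_pt_iff)
  then show False by (simp add: vec_eq_iff forall_4)
qed

context gk
begin

abbreviation curve :: "('a, 4) point set" where
  "curve \<equiv> GK_curve q"

text \<open>The generic point of the curve.\<close>

abbreviation gen :: "'a fls ^ 4" where
  "gen \<equiv> vector [xi, yi, zi, 1]"

text \<open>The generic point, scaled so that it specialises to the point at infinity.\<close>

abbreviation gen' :: "'a fls ^ 4" where
  "gen' \<equiv> vector [1, yi / xi, zi / xi, 1 / xi]"

lemma gen_scale: "homogeneous d F \<Longrightarrow> eval_fls F gen = xi ^ d * eval_fls F gen'"
proof -
  have "gen = xi *s gen'" using xi_nz by (simp add: vec_eq_iff forall_4)
  then show "homogeneous d F \<Longrightarrow> ?thesis" by (simp add: eval_fls_scale)
qed

lemma subdegree_ratios: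
  "fls_subdegree (yi / xi) > 0" "fls_subdegree (zi / xi) = 1" "fls_subdegree (1 / xi) > 0"
proof -
  have "int (q * (q\<^sup>2 - q + 1)) < int (q ^ 3)"
    using gk_exponents(5)[OF q_ge2] by (simp only: of_nat_less_iff)
  then show "fls_subdegree (yi / xi) > 0"
    by (simp add: fls_divide_subdegree yi_nz xi_nz xi yi del: of_nat_mult)
  show "fls_subdegree (zi / xi) = 1" by (simp add: fls_divide_subdegree zi_nz xi_nz xi zi)
  show "fls_subdegree (1 / xi) > 0"
    by (simp add: fls_divide_subdegree xi_nz xi add_pos_nonneg)
qed

lemma gen'_regular: "fls_subdegree (gen' $ i) \<ge> 0"
  using subdegree_ratios exhaust_4[of i] by auto

lemma gen'_nth0: "(\<chi> i. fls_nth (gen' $ i) 0) = vector [1, 0, 0, 0]"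
  using subdegree_ratios by (simp add: vec_eq_iff forall_4)

lemma eval_gen'_subdegree: "fls_subdegree (eval_fls F gen') \<ge> 0"
  by (rule eval_fls_regular(1)[OF gen'_regular])

lemma eval_gen'_nth0: "fls_nth (eval_fls F gen') 0 = eval F (vector [1, 0, 0, 0])"
  by (simp only: eval_fls_regular(2)[OF gen'_regular] gen'_nth0)

lemma eval_gen_iff: "eval_fls F gen = 0 \<longleftrightarrow> (\<forall>a b c. gk_rel q a b c \<longrightarrow> eval F (vector [a, b, c, 1]) = 0)"
  using polyfun_vanishes_iff[OF dehomogenize_UNIV[of F]] by (simp add: pval_dehomogenize)

lemma curve_eq_closure: "curve = proj_closure {vector [a, b, c, 1] | a b c. gk_rel q a b c}"
  by (simp add: GK_curve_def gk_rel_def)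

lemma affine_pt_in_curve:
  assumes "gk_rel q a b c"
  shows "affine_pt a b c \<in> curve"
proof -
  have "vanishes_at (affine_pt a b c) F"
    if "homogeneous d F" "\<forall>v\<in>{vector [a, b, c, 1] | a b c. gk_rel q a b c}. eval F v = 0"
    for d and F :: "('a, 4) mpoly"
    unfolding affine_pt_def vanishes_at_pt[OF affine_vec_nz that(1)] using that(2) assms by blast
  then show ?thesis
    using pt_in_proj_space[OF affine_vec_nz] unfolding curve_eq_closure proj_closure_def affine_pt_def
    by blast
qed

lemma form_vanishes_iff:
  assumes "homogeneous d F"
  shows "(\<forall>P\<in>curve. vanishes_at P F) \<longleftrightarrow> eval_fls F gen = 0"
proof
  assume all: "\<forall>P\<in>curve. vanishes_at P F"
  then show "eval_fls F gen = 0"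
    using affine_pt_in_curve vanishes_at_pt[OF affine_vec_nz assms] all
    unfolding eval_gen_iff affine_pt_def by blast
next
  assume "eval_fls F gen = 0"
  then show "\<forall>P\<in>curve. vanishes_at P F"
    using assms unfolding eval_gen_iff curve_eq_closure proj_closure_def by blast
qed

lemma inf_pt_in_curve: "inf_pt \<in> curve"
proof -
  have "vanishes_at inf_pt F"
    if F: "homogeneous d F" "\<forall>v\<in>{vector [a, b, c, 1] | a b c. gk_rel q a b c}. eval F v = 0"
    for d and F :: "('a, 4) mpoly"
  proof -
    have "eval_fls F gen = 0" using F by (auto simp: eval_gen_iff)
    then have "eval_fls F gen' = 0" using gen_scale[OF F(1)] xi_nz by simp
    then have "eval F (vector [1, 0, 0, 0]) = 0" using eval_gen'_nth0[of F] by simp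
    then show ?thesis by (simp add: inf_pt_def vanishes_at_pt[OF inf_vec_nz F(1)])
  qed
  then show ?thesis
    using pt_in_proj_space[OF inf_vec_nz] unfolding curve_eq_closure proj_closure_def inf_pt_def
    by blast
qed

text \<open>
  Homogenised, \<open>Y^(q + 1) = X^q + X\<close> and \<open>Z^(q^2 - q + 1) = Y^(q^2) - Y\<close> are satisfied on the whole
  line \<open>Y = T = 0\<close>. It is cut down to one point by the following consequence of the two equations,
  both sides of which have degree \<open>q^2 - q + 1\<close>.
\<close>

lemma gk_rel_third:
  fixes x y z :: "'b::comm_ring_1"
  assumes "gk_rel q x y z"
  shows "z ^ (q\<^sup>2 - q + 1) = y * (x ^ q + x) ^ (q - 1) - y"
proof -
  have "y ^ (q\<^sup>2) = y * (y ^ (q + 1)) ^ (q - 1)"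
  proof -
    have "q\<^sup>2 = Suc ((q + 1) * (q - 1))"
      using q_ge2 by (cases q) (simp_all add: power2_eq_square)
    then show ?thesis by (simp only: power_Suc power_mult)
  qed
  then show ?thesis using assms by (simp add: gk_rel_def)
qed

lemma curve_cases:
  assumes "P \<in> curve"
  obtains (affine) a b c where "gk_rel q a b c" "P = affine_pt a b c" | (inf) "P = inf_pt"
proof -
  define n where "n = q\<^sup>2 - q + 1"
  have n1: "n - 1 = q * (q - 1)" by (simp add: n_def power2_eq_square right_diff_distrib')
  have nq: "n + q = q\<^sup>2 + 1" using gk_exponents(2)[OF q_ge2] by (simp add: n_def)
  have n2: "n \<le> q\<^sup>2" using nq q_ge2 by linarith
  let ?x = "mvar 1 :: ('a, 4) mpoly" and ?y = "mvar 2 :: ('a, 4) mpoly"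
    and ?z = "mvar 3 :: ('a, 4) mpoly" and ?t = "mvar 4 :: ('a, 4) mpoly"
  obtain v where v: "v \<noteq> 0" "P = pt v"
    using assms proj_space_cases unfolding GK_curve_def proj_closure_def by blast
  have form: "eval F v = 0"
    if "homogeneous d F" "\<And>a b c. gk_rel q a b c \<Longrightarrow> eval F (vector [a, b, c, 1]) = 0" for d F
  proof -
    have "vanishes_at P F" using assms that unfolding curve_eq_closure proj_closure_def by blast
    then show ?thesis using v vanishes_at_pt[OF v(1) that(1)] by simp
  qed
  have h2: "homogeneous (i + j) (mvar k ^ i * mvar l ^ j)" for i j and k l :: 4
    by (intro homogeneous_mult homogeneous_mvar_power)
  have e1: "(v $ 2) ^ (q + 1) = (v $ 1) ^ q * v $ 4 + v $ 1 * (v $ 4) ^ q"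
  proof -
    have "homogeneous (q + 1) (?y ^ (q + 1) - ?x ^ q * ?t ^ 1 - ?x ^ 1 * ?t ^ q)"
      using h2[of q 1 1 4] h2[of 1 q 1 4]
      by (intro homogeneous_diff homogeneous_mvar_power) (simp_all add: add.commute)
    then have "eval (?y ^ (q + 1) - ?x ^ q * ?t ^ 1 - ?x ^ 1 * ?t ^ q) v = 0"
      by (rule form) (simp add: eval_diff eval_mult eval_power gk_rel_def)
    then show ?thesis by (simp add: eval_diff eval_mult eval_power eval_add algebra_simps)
  qed
  have e2: "(v $ 3) ^ n * (v $ 4) ^ (q\<^sup>2 - n) = (v $ 2) ^ (q\<^sup>2) - v $ 2 * (v $ 4) ^ (q\<^sup>2 - 1)"
  proof -
    have "homogeneous (q\<^sup>2) (?z ^ n * ?t ^ (q\<^sup>2 - n) - ?y ^ (q\<^sup>2) + ?y ^ 1 * ?t ^ (q\<^sup>2 - 1))"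
      using h2[of n "q\<^sup>2 - n" 3 4] h2[of 1 "q\<^sup>2 - 1" 2 4] n2 q_ge2
      by (intro homogeneous_add homogeneous_diff homogeneous_mvar_power) simp_all
    then have "eval (?z ^ n * ?t ^ (q\<^sup>2 - n) - ?y ^ (q\<^sup>2) + ?y ^ 1 * ?t ^ (q\<^sup>2 - 1)) v = 0"
      by (rule form) (simp add: eval_diff eval_mult eval_power eval_add gk_rel_def n_def)
    then show ?thesis by (simp add: eval_diff eval_mult eval_power eval_add algebra_simps)
  qed
  have e3: "(v $ 3) ^ n = v $ 2 * ((v $ 1) ^ q + v $ 1 * (v $ 4) ^ (q - 1)) ^ (q - 1)
      - v $ 2 * (v $ 4) ^ (n - 1)"
  proof -
    let ?F = "?z ^ n - ?y ^ 1 * (?x ^ q + ?x ^ 1 * ?t ^ (q - 1)) ^ (q - 1) + ?y ^ 1 * ?t ^ (n - 1)"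
    have "homogeneous q (?x ^ q + ?x ^ 1 * ?t ^ (q - 1))"
      using h2[of 1 "q - 1" 1 4] q_ge2 by (intro homogeneous_add homogeneous_mvar_power) simp
    from homogeneous_power[OF this, of "q - 1"]
    have "homogeneous (1 + q * (q - 1)) (?y ^ 1 * (?x ^ q + ?x ^ 1 * ?t ^ (q - 1)) ^ (q - 1))"
      by (intro homogeneous_mult homogeneous_mvar_power)
    moreover have "1 + q * (q - 1) = n" using n1 by (simp add: n_def)
    ultimately have "homogeneous n ?F"
      using h2[of 1 "n - 1" 2 4]
      by (intro homogeneous_add homogeneous_diff homogeneous_mvar_power) (simp_all add: n_def)
    then have "eval ?F v = 0"
      by (rule form)
         (simp add: eval_diff eval_mult eval_power eval_add gk_rel_third[folded n_def])
    then show ?thesis by (simp add: eval_diff eval_mult eval_power eval_add algebra_simps)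
  qed
  show ?thesis
  proof (cases "v $ 4 = 0")
    case False
    define a b c where "a = v $ 1 / v $ 4" and "b = v $ 2 / v $ 4" and "c = v $ 3 / v $ 4"
    have va: "v = v $ 4 *s vector [a, b, c, 1]"
      using False by (simp add: vec_eq_iff forall_4 a_def b_def c_def)
    have v1: "v $ 1 = v $ 4 * a" and v2: "v $ 2 = v $ 4 * b" and v3: "v $ 3 = v $ 4 * c"
      using False by (simp_all add: a_def b_def c_def)
    have "(v $ 4) ^ (q + 1) * b ^ (q + 1) = (v $ 4) ^ (q + 1) * (a ^ q + a)"
      using e1 by (simp add: v1 v2 power_mult_distrib algebra_simps)
    then have r1: "b ^ (q + 1) = a ^ q + a" using False by (simp only: mult_cancel_left power_eq_0_iff) simp
    have "(v $ 4) ^ (n + (q\<^sup>2 - n)) * c ^ n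
        = (v $ 4) ^ (q\<^sup>2) * b ^ (q\<^sup>2) - (v $ 4) ^ Suc (q\<^sup>2 - 1) * b"
      using e2 by (simp add: v2 v3 power_mult_distrib power_add algebra_simps)
    then have "(v $ 4) ^ (q\<^sup>2) * c ^ n = (v $ 4) ^ (q\<^sup>2) * (b ^ (q\<^sup>2) - b)"
      using n2 q_ge2 by (simp add: right_diff_distrib)
    then have "c ^ n = b ^ (q\<^sup>2) - b" using False by simp
    then have "gk_rel q a b c" using r1 by (simp add: gk_rel_def n_def)
    moreover have "P = affine_pt a b c"
      unfolding v(2) affine_pt_def by (subst va) (intro pt_scale affine_vec_nz False)
    ultimately show ?thesis using affine by blast
  next
    case True
    have "v $ 2 = 0" using e1 True q_ge2 by (simp add: power_0_left)
    moreover from this have "v $ 3 = 0" using e3 by auto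
    ultimately have v1: "v = v $ 1 *s vector [1, 0, 0, 0]"
      using True by (simp add: vec_eq_iff forall_4)
    then have "v $ 1 \<noteq> 0" using v(1) by (metis vector_smult_lzero)
    then have "P = inf_pt" unfolding v(2) inf_pt_def by (subst v1) (intro pt_scale inf_vec_nz)
    then show ?thesis using inf by blast
  qed
qed

lemma GK_infinity_eq: "GK_infinity q = (inf_pt :: ('a, 4) point)"
  unfolding GK_infinity_def
proof (rule the_equality)
  show "inf_pt \<in> curve \<and> (\<forall>v\<in>inf_pt. v $ 4 = 0)"
    using inf_pt_in_curve by (auto simp: inf_pt_def in_pt_iff)
next
  fix P :: "('a, 4) point" assume P: "P \<in> curve \<and> (\<forall>v\<in>P. v $ 4 = 0)"
  then have "P \<in> curve" by blast
  then show "P = inf_pt"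
  proof (cases rule: curve_cases)
    case (affine a b c)
    then have "vector [a, b, c, 1] \<in> P"
      using self_in_pt[OF affine_vec_nz] by (simp add: affine_pt_def)
    then have "(vector [a, b, c, 1] :: 'a ^ 4) $ 4 = 0" using P by blast
    then show ?thesis by simp
  qed
qed

subsection \<open>Rational functions as Laurent series\<close>

text \<open>The function field, realised as a field of Laurent series.\<close>

definition FF :: "'a fls set" where
  "FF = {g xi yi zi / h xi yi zi | g h. g \<in> PF \<and> h \<in> PF \<and> h xi yi zi \<noteq> 0}"

text \<open>The class of the fractions of forms that expand to \<open>\<phi>\<close>; it is empty unless \<open>\<phi> \<in> FF\<close>.\<close>

definition cls :: "'a fls \<Rightarrow> ('a, 4) ratfun" where
  "cls \<phi> = {(A, B). (A, B) \<in> fractions curve \<and> eval_fls A gen / eval_fls B gen = \<phi>}"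

lemma FF_I: "\<phi> = g xi yi zi / h xi yi zi \<Longrightarrow> g \<in> PF \<Longrightarrow> h \<in> PF \<Longrightarrow> h xi yi zi \<noteq> 0 \<Longrightarrow> \<phi> \<in> FF"
  unfolding FF_def mem_Collect_eq by (rule exI[of _ g], rule exI[of _ h]) simp

lemma fractions_iff: "(A, B) \<in> fractions curve \<longleftrightarrow>
  (\<exists>d. homogeneous d A \<and> homogeneous d B) \<and> eval_fls B gen \<noteq> 0"
proof (cases "\<exists>d. homogeneous d A \<and> homogeneous d B")
  case True
  then obtain d where "homogeneous d B" by blast
  from form_vanishes_iff[OF this] True show ?thesis by (auto simp: fractions_def)
next
  case False
  then show ?thesis by (auto simp: fractions_def)
qed

lemma fraction_rel_iff: "((A, B), (A', B')) \<in> fraction_rel curve \<longleftrightarrow>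
  (A, B) \<in> fractions curve \<and> (A', B') \<in> fractions curve \<and>
  eval_fls A gen / eval_fls B gen = eval_fls A' gen / eval_fls B' gen"
proof (cases "(A, B) \<in> fractions curve \<and> (A', B') \<in> fractions curve")
  case True
  then obtain d d' where d: "homogeneous d A" "homogeneous d B" "homogeneous d' A'"
    "homogeneous d' B'" and nz: "eval_fls B gen \<noteq> 0" "eval_fls B' gen \<noteq> 0"
    by (auto simp: fractions_iff)
  have "homogeneous (d + d') (A * B' - A' * B)"
    using homogeneous_mult[of d A d' B'] homogeneous_mult[of d' A' d B] d
    by (intro homogeneous_diff) (simp_all add: add.commute)
  then have "(\<forall>P\<in>curve. vanishes_at P (A * B' - A' * B)) \<longleftrightarrow>
      eval_fls A gen * eval_fls B' gen = eval_fls A' gen * eval_fls B gen"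
    by (simp add: form_vanishes_iff eval_fls_diff eval_fls_mult)
  then show ?thesis using True nz by (simp add: fraction_rel_def frac_eq_eq)
qed (auto simp: fraction_rel_def)

lemma fraction_class:
  assumes "(A, B) \<in> fractions curve"
  shows "fraction_rel curve `` {(A, B)} = cls (eval_fls A gen / eval_fls B gen)"
proof (rule Set.set_eqI)
  fix p :: "('a, 4) mpoly \<times> ('a, 4) mpoly"
  obtain A' B' where p: "p = (A', B')" by (cases p)
  show "p \<in> fraction_rel curve `` {(A, B)} \<longleftrightarrow> p \<in> cls (eval_fls A gen / eval_fls B gen)"
    using assms by (simp only: p Image_singleton_iff fraction_rel_iff cls_def mem_Collect_eq
        case_prod_conv) metis
qed

lemma FF_fraction:
  assumes "\<phi> \<in> FF"
  obtains A B where "(A, B) \<in> fractions curve" "eval_fls A gen / eval_fls B gen = \<phi>"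
proof -
  obtain g h where gh: "g \<in> PF" "h \<in> PF" "h xi yi zi \<noteq> 0" "\<phi> = g xi yi zi / h xi yi zi"
    using assms by (auto simp: FF_def)
  obtain d1 where d1: "\<And>d. d \<ge> d1 \<Longrightarrow> \<exists>F :: ('a, 4) mpoly. homogeneous d F \<and>
    (\<forall>m. Poly_Mapping.lookup F m \<in> UNIV) \<and> (\<forall>x y z. eval_fls F (vector [x, y, z, 1]) = g x y z)"
    using homogenize[OF _ _ gh(1)] by blast
  obtain d2 where d2: "\<And>d. d \<ge> d2 \<Longrightarrow> \<exists>F :: ('a, 4) mpoly. homogeneous d F \<and>
    (\<forall>m. Poly_Mapping.lookup F m \<in> UNIV) \<and> (\<forall>x y z. eval_fls F (vector [x, y, z, 1]) = h x y z)"
    using homogenize[OF _ _ gh(2)] by blast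
  obtain A B :: "('a, 4) mpoly" where "homogeneous (max d1 d2) A" "homogeneous (max d1 d2) B"
    "\<forall>x y z. eval_fls A (vector [x, y, z, 1]) = g x y z"
    "\<forall>x y z. eval_fls B (vector [x, y, z, 1]) = h x y z"
    using d1[of "max d1 d2"] d2[of "max d1 d2"] by auto
  then have "(A, B) \<in> fractions curve" "eval_fls A gen / eval_fls B gen = \<phi>"
    using gh by (auto simp: fractions_iff)
  then show ?thesis using that by blast
qed

lemma fraction_in_FF: "(A, B) \<in> fractions curve \<Longrightarrow> eval_fls A gen / eval_fls B gen \<in> FF"
  by (rule FF_I[OF _ dehomogenize_UNIV[of A] dehomogenize_UNIV[of B]])
     (simp_all add: fractions_iff)

lemma carrier_function_field: "carrier (function_field curve) = cls ` FF"
proof -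
  have "fractions curve // fraction_rel curve = cls ` FF"
  proof (intro equalityI subsetI)
    fix f assume "f \<in> fractions curve // fraction_rel curve"
    then obtain A B where "(A, B) \<in> fractions curve" "f = fraction_rel curve `` {(A, B)}"
      by (auto simp: quotient_def)
    then show "f \<in> cls ` FF" using fraction_class fraction_in_FF by auto
  next
    fix f assume "f \<in> cls ` FF"
    then obtain \<phi> where "\<phi> \<in> FF" "f = cls \<phi>" by blast
    then obtain A B where "(A, B) \<in> fractions curve" "f = fraction_rel curve `` {(A, B)}"
      using FF_fraction fraction_class by metis
    then show "f \<in> fractions curve // fraction_rel curve" by (auto simp: quotient_def)
  qed
  then show ?thesis by (simp add: function_field_def)
qed

lemma cls_eq_iff:
  assumes "\<phi> \<in> FF"
  shows "cls \<phi> = cls \<psi> \<longleftrightarrow> \<phi> = \<psi>"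
proof
  obtain A B where "(A, B) \<in> cls \<phi>"
    using FF_fraction[OF assms] unfolding cls_def by blast
  moreover assume "cls \<phi> = cls \<psi>"
  ultimately have "(A, B) \<in> cls \<phi>" "(A, B) \<in> cls \<psi>" by simp_all
  then show "\<phi> = \<psi>" by (simp add: cls_def)
qed simp

lemma cls_UN:
  assumes "\<phi> \<in> FF" "\<psi> \<in> FF"
    and f: "\<And>A B A' B'. (A, B) \<in> cls \<phi> \<Longrightarrow> (A', B') \<in> cls \<psi> \<Longrightarrow> f A B A' B' = s"
  shows "(\<Union>(A, B)\<in>cls \<phi>. \<Union>(A', B')\<in>cls \<psi>. f A B A' B') = s"
proof -
  obtain A B where "(A, B) \<in> cls \<phi>"
    using FF_fraction[OF assms(1)] unfolding cls_def by blast
  moreover obtain A' B' where "(A', B') \<in> cls \<psi>"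
    using FF_fraction[OF assms(2)] unfolding cls_def by blast
  ultimately
  show ?thesis using f by fastforce
qed

lemma cls_mult:
  assumes "\<phi> \<in> FF" "\<psi> \<in> FF"
  shows "cls \<phi> \<otimes>\<^bsub>function_field curve\<^esub> cls \<psi> = cls (\<phi> * \<psi>)"
proof -
  have "fraction_rel curve `` {(A * A', B * B')} = cls (\<phi> * \<psi>)"
    if "(A, B) \<in> cls \<phi>" "(A', B') \<in> cls \<psi>" for A B A' B'
  proof -
    have "(A * A', B * B') \<in> fractions curve"
      using that by (auto simp: cls_def fractions_iff eval_fls_mult intro: homogeneous_mult)
    then show ?thesis using that by (auto simp: fraction_class eval_fls_mult cls_def)
  qed
  from cls_UN[OF assms this] show ?thesis by (simp add: function_field_def)
qed

lemma cls_one: "\<one>\<^bsub>function_field curve\<^esub> = cls 1"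
proof -
  have "(1, 1) \<in> fractions curve" by (auto simp: fractions_iff intro: exI[of _ 0])
  then show ?thesis by (simp add: function_field_def fraction_class)
qed

lemma cls_zero: "\<zero>\<^bsub>function_field curve\<^esub> = cls 0"
proof -
  have "(0, 1) \<in> fractions curve" by (auto simp: fractions_iff intro: exI[of _ 0])
  then show ?thesis by (simp add: function_field_def fraction_class)
qed

lemma FF_polyfun: "g \<in> PF \<Longrightarrow> g xi yi zi \<in> FF"
  by (rule FF_I[of _ g "\<lambda>x y z. fls_const 1"], simp, assumption, rule polyfun_const) simp_all

lemma FF_one: "1 \<in> FF"
  using FF_polyfun[OF polyfun_const[of 1 UNIV]] by simp

lemma FF_mult: assumes "\<phi> \<in> FF" "\<psi> \<in> FF" shows "\<phi> * \<psi> \<in> FF"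
proof -
  obtain g h g' h' where "g \<in> PF" "h \<in> PF" "h xi yi zi \<noteq> 0" "\<phi> = g xi yi zi / h xi yi zi"
    "g' \<in> PF" "h' \<in> PF" "h' xi yi zi \<noteq> 0" "\<psi> = g' xi yi zi / h' xi yi zi"
    using assms unfolding FF_def by blast
  then show ?thesis
    by (intro FF_I[of _ "\<lambda>x y z. g x y z * g' x y z" "\<lambda>x y z. h x y z * h' x y z"] polyfun_mult)
       auto
qed

lemma FF_inverse: assumes "\<phi> \<in> FF" shows "inverse \<phi> \<in> FF"
proof (cases "\<phi> = 0")
  case False
  obtain g h where "g \<in> PF" "h \<in> PF" "h xi yi zi \<noteq> 0" "\<phi> = g xi yi zi / h xi yi zi"
    using assms unfolding FF_def by blast
  then show ?thesis using False by (intro FF_I[of _ h g]) auto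
qed (use assms in simp)

lemma FF_power: "\<phi> \<in> FF \<Longrightarrow> \<phi> ^ n \<in> FF"
  by (induction n) (simp_all add: FF_one FF_mult)

lemma FF_power_int: "\<phi> \<in> FF \<Longrightarrow> \<phi> powi n \<in> FF"
  by (simp add: power_int_def FF_power FF_inverse)

lemma cls_nat_pow: "\<phi> \<in> FF \<Longrightarrow> cls \<phi> [^]\<^bsub>function_field curve\<^esub> (n :: nat) = cls (\<phi> ^ n)"
proof (induction n)
  case 0
  show ?case by (simp add: nat_pow_def cls_one)
next
  case (Suc n)
  have "cls \<phi> [^]\<^bsub>function_field curve\<^esub> Suc n
      = cls \<phi> [^]\<^bsub>function_field curve\<^esub> n \<otimes>\<^bsub>function_field curve\<^esub> cls \<phi>"
    by (simp add: nat_pow_def)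
  also have "\<dots> = cls (\<phi> ^ n * \<phi>)"
    using Suc by (simp only: Suc.IH[OF Suc.prems] cls_mult[OF FF_power])
  finally show ?case by (simp add: mult.commute)
qed

lemma cls_inv:
  assumes "\<phi> \<in> FF" "\<phi> \<noteq> 0"
  shows "inv\<^bsub>function_field curve\<^esub> cls \<phi> = cls (inverse \<phi>)"
  unfolding m_inv_def
proof (rule the_equality)
  show "cls (inverse \<phi>) \<in> carrier (function_field curve) \<and>
      cls \<phi> \<otimes>\<^bsub>function_field curve\<^esub> cls (inverse \<phi>) = \<one>\<^bsub>function_field curve\<^esub> \<and>
      cls (inverse \<phi>) \<otimes>\<^bsub>function_field curve\<^esub> cls \<phi> = \<one>\<^bsub>function_field curve\<^esub>"
    using assms by (simp add: carrier_function_field cls_mult FF_inverse cls_one)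
next
  fix y assume y: "y \<in> carrier (function_field curve) \<and>
      cls \<phi> \<otimes>\<^bsub>function_field curve\<^esub> y = \<one>\<^bsub>function_field curve\<^esub> \<and>
      y \<otimes>\<^bsub>function_field curve\<^esub> cls \<phi> = \<one>\<^bsub>function_field curve\<^esub>"
  then obtain \<psi> where \<psi>: "\<psi> \<in> FF" "y = cls \<psi>" by (auto simp: carrier_function_field)
  then have "\<phi> * \<psi> = 1" using y assms by (simp add: cls_mult cls_one cls_eq_iff FF_mult)
  then show "y = cls (inverse \<phi>)" using \<psi> by (simp add: inverse_unique)
qed

lemma cls_int_pow:
  assumes "\<phi> \<in> FF" "\<phi> \<noteq> 0"
  shows "cls \<phi> [^]\<^bsub>function_field curve\<^esub> (n :: int) = cls (\<phi> powi n)"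
proof (cases "n < 0")
  case True
  then show ?thesis
    using cls_inv[OF FF_power[OF assms(1)], of "nat (- n)"] assms
    by (simp add: int_pow_def2 cls_nat_pow[OF assms(1)] power_int_def power_inverse)
next
  case False
  then show ?thesis by (simp add: int_pow_def2 cls_nat_pow[OF assms(1)] power_int_def)
qed

end

subsection \<open>Local rings and orders\<close>

context gk
begin

text \<open>The local ring at the point with coordinate vector \<open>v\<close> and its maximal ideal.\<close>

definition LR :: "'a ^ 4 \<Rightarrow> 'a fls set" where
  "LR v = {eval_fls A gen / eval_fls B gen | A B.
     (\<exists>d. homogeneous d A \<and> homogeneous d B) \<and> eval B v \<noteq> 0}"

definition MI :: "'a ^ 4 \<Rightarrow> 'a fls set" where
  "MI v = {eval_fls A gen / eval_fls B gen | A B.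
     (\<exists>d. homogeneous d A \<and> homogeneous d B) \<and> eval B v \<noteq> 0 \<and> eval A v = 0}"

lemma LR_I:
  "homogeneous d A \<Longrightarrow> homogeneous d B \<Longrightarrow> eval B v \<noteq> 0 \<Longrightarrow> eval_fls A gen / eval_fls B gen \<in> LR v"
  unfolding LR_def by blast

lemma LR_E:
  assumes "\<phi> \<in> LR v"
  obtains d A B where "homogeneous d A" "homogeneous d B" "eval B v \<noteq> 0"
    "\<phi> = eval_fls A gen / eval_fls B gen"
  using assms unfolding LR_def by blast

lemma MI_I:
  "homogeneous d A \<Longrightarrow> homogeneous d B \<Longrightarrow> eval B v \<noteq> 0 \<Longrightarrow> eval A v = 0 \<Longrightarrow>
    eval_fls A gen / eval_fls B gen \<in> MI v"
  unfolding MI_def by blast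

lemma MI_E:
  assumes "\<phi> \<in> MI v"
  obtains d A B where "homogeneous d A" "homogeneous d B" "eval B v \<noteq> 0" "eval A v = 0"
    "\<phi> = eval_fls A gen / eval_fls B gen"
  using assms unfolding MI_def by blast

text \<open>\<open>v\<close> is a coordinate vector of a point of the curve.\<close>

definition on_curve :: "'a ^ 4 \<Rightarrow> bool" where
  "on_curve v \<longleftrightarrow> v \<noteq> 0 \<and> pt v \<in> curve"

lemma on_curve_zero:
  assumes "on_curve v" "homogeneous d F" "eval_fls F gen = 0"
  shows "eval F v = 0"
  using assms form_vanishes_iff[OF assms(2)] vanishes_at_pt[OF _ assms(2)]
  unfolding on_curve_def by blast

lemma on_curve_affine: "gk_rel q a b c \<Longrightarrow> on_curve (vector [a, b, c, 1])"
  using affine_pt_in_curve by (simp add: on_curve_def affine_pt_def)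

lemma on_curve_inf: "on_curve (vector [1, 0, 0, 0])"
  using inf_pt_in_curve by (simp add: on_curve_def inf_pt_def)

lemma LR_nz:
  assumes "on_curve v" "homogeneous d B" "eval B v \<noteq> 0"
  shows "eval_fls B gen \<noteq> 0"
  using on_curve_zero assms by blast

lemma LR_in_FF: assumes "on_curve v" shows "LR v \<subseteq> FF"
proof
  fix \<phi> assume "\<phi> \<in> LR v"
  then obtain d A B where "homogeneous d A" "homogeneous d B" "eval B v \<noteq> 0"
    "\<phi> = eval_fls A gen / eval_fls B gen" by (rule LR_E)
  then show "\<phi> \<in> FF" using LR_nz[OF assms] fraction_in_FF[of A B] fractions_iff by blast
qed

lemma MI_subset_LR: "MI v \<subseteq> LR v"
  unfolding MI_def LR_def by blast

lemma LR_mult: assumes "on_curve v" "\<phi> \<in> LR v" "\<psi> \<in> LR v" shows "\<phi> * \<psi> \<in> LR v"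
proof -
  obtain d A B where 1: "homogeneous d A" "homogeneous d B" "eval B v \<noteq> 0"
    "\<phi> = eval_fls A gen / eval_fls B gen" using assms(2) by (rule LR_E)
  obtain d' A' B' where 2: "homogeneous d' A'" "homogeneous d' B'" "eval B' v \<noteq> 0"
    "\<psi> = eval_fls A' gen / eval_fls B' gen" using assms(3) by (rule LR_E)
  have "eval_fls (A * A') gen / eval_fls (B * B') gen \<in> LR v"
    using 1 2 by (intro LR_I[of "d + d'"] homogeneous_mult) (simp_all add: eval_mult)
  then show ?thesis by (simp add: 1 2 eval_fls_mult)
qed

lemma LR_add: assumes "on_curve v" "\<phi> \<in> LR v" "\<psi> \<in> LR v" shows "\<phi> + \<psi> \<in> LR v"
proof -
  obtain d A B where 1: "homogeneous d A" "homogeneous d B" "eval B v \<noteq> 0"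
    "\<phi> = eval_fls A gen / eval_fls B gen" using assms(2) by (rule LR_E)
  obtain d' A' B' where 2: "homogeneous d' A'" "homogeneous d' B'" "eval B' v \<noteq> 0"
    "\<psi> = eval_fls A' gen / eval_fls B' gen" using assms(3) by (rule LR_E)
  have "homogeneous (d + d') (A * B' + B * A')"
    using 1 2 by (intro homogeneous_add homogeneous_mult)
  then have "eval_fls (A * B' + B * A') gen / eval_fls (B * B') gen \<in> LR v"
    using 1 2 by (intro LR_I[of "d + d'"] homogeneous_mult) (simp_all add: eval_mult)
  moreover have "eval_fls B gen \<noteq> 0" "eval_fls B' gen \<noteq> 0"
    using 1 2 LR_nz[OF assms(1)] by blast+
  ultimately show ?thesis by (simp add: 1 2 eval_fls_mult eval_fls_add add_frac_eq mult.commute)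
qed

lemma LR_const: "fls_const a \<in> LR v"
proof -
  have "homogeneous 0 (Poly_Mapping.single (0 :: 4 \<Rightarrow>\<^sub>0 nat) a)"
    by (intro homogeneous_single) simp
  then have "eval_fls (Poly_Mapping.single 0 a) gen / eval_fls 1 gen \<in> LR v"
    by (rule LR_I[OF _ homogeneous_one]) simp
  then show ?thesis by (simp add: eval_fls_single)
qed

lemma LR_one: "1 \<in> LR v"
  using LR_const[of 1] by simp

lemma LR_power: "on_curve v \<Longrightarrow> \<phi> \<in> LR v \<Longrightarrow> \<phi> ^ n \<in> LR v"
  by (induction n) (simp_all add: LR_one LR_mult)

lemma LR_inverse: assumes "on_curve v" "\<phi> \<in> LR v" "\<phi> \<notin> MI v" shows "inverse \<phi> \<in> LR v"
proof -
  obtain d A B where 1: "homogeneous d A" "homogeneous d B" "eval B v \<noteq> 0"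
    "\<phi> = eval_fls A gen / eval_fls B gen" using assms(2) by (rule LR_E)
  then have "eval A v \<noteq> 0" using assms(3) MI_I by blast
  then have "eval_fls B gen / eval_fls A gen \<in> LR v" using 1 by (intro LR_I)
  then show ?thesis by (simp add: 1)
qed

lemma one_notin_MI: assumes "on_curve v" shows "1 \<notin> MI v"
proof
  assume "1 \<in> MI v"
  then obtain d A B where 1: "homogeneous d A" "homogeneous d B" "eval B v \<noteq> 0" "eval A v = 0"
    "1 = eval_fls A gen / eval_fls B gen" by (rule MI_E)
  then have "eval_fls (A - B) gen = 0"
    using LR_nz[OF assms 1(2,3)] by (simp add: eval_fls_diff)
  then have "eval (A - B) v = 0" using 1 by (intro on_curve_zero[OF assms] homogeneous_diff)
  then show False using 1 by (simp add: eval_diff)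
qed

lemma MI_LR_mult: assumes "on_curve v" "\<phi> \<in> MI v" "\<psi> \<in> LR v" shows "\<phi> * \<psi> \<in> MI v"
proof -
  obtain d A B where 1: "homogeneous d A" "homogeneous d B" "eval B v \<noteq> 0" "eval A v = 0"
    "\<phi> = eval_fls A gen / eval_fls B gen" using assms(2) by (rule MI_E)
  obtain d' A' B' where 2: "homogeneous d' A'" "homogeneous d' B'" "eval B' v \<noteq> 0"
    "\<psi> = eval_fls A' gen / eval_fls B' gen" using assms(3) by (rule LR_E)
  have "eval_fls (A * A') gen / eval_fls (B * B') gen \<in> MI v"
    using 1 2 by (intro MI_I[of "d + d'"] homogeneous_mult) (simp_all add: eval_mult)
  then show ?thesis by (simp add: 1 2 eval_fls_mult)
qed

lemma cls_pair:
  assumes "on_curve v" "homogeneous d A" "homogeneous d B" "eval B v \<noteq> 0"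
  shows "(A, B) \<in> cls (eval_fls A gen / eval_fls B gen)"
  unfolding cls_def using LR_nz[OF assms(1,3,4)] assms(2,3) fractions_iff by blast

lemma local_ring_eq: assumes v: "on_curve v" shows "local_ring curve (pt v) = cls ` LR v"
proof (intro equalityI subsetI)
  fix f assume "f \<in> local_ring curve (pt v)"
  then obtain \<phi> A B where "f = cls \<phi>" "(A, B) \<in> cls \<phi>" and nv: "\<not> vanishes_at (pt v) B"
    unfolding local_ring_def carrier_function_field by blast
  then have "(A, B) \<in> fractions curve" "\<phi> = eval_fls A gen / eval_fls B gen"
    by (simp_all add: cls_def)
  then obtain d where d: "homogeneous d A" "homogeneous d B" by (auto simp: fractions_iff)
  have "eval B v \<noteq> 0" using nv vanishes_at_pt[OF _ d(2)] v unfolding on_curve_def by blast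
  then have "\<phi> \<in> LR v" using d \<open>\<phi> = _\<close> LR_I by blast
  then show "f \<in> cls ` LR v" using \<open>f = cls \<phi>\<close> by blast
next
  fix f assume "f \<in> cls ` LR v"
  then obtain \<phi> where \<phi>: "\<phi> \<in> LR v" "f = cls \<phi>" by blast
  then obtain d A B where d: "homogeneous d A" "homogeneous d B" "eval B v \<noteq> 0"
    "\<phi> = eval_fls A gen / eval_fls B gen" by (metis LR_E)
  have "(A, B) \<in> f" using cls_pair[OF v d(1-3)] \<phi> d by simp
  moreover have "\<not> vanishes_at (pt v) B"
    using d vanishes_at_pt[OF _ d(2)] v unfolding on_curve_def by blast
  moreover have "f \<in> carrier (function_field curve)"
    using \<phi> LR_in_FF[OF v] by (auto simp: carrier_function_field)
  ultimately show "f \<in> local_ring curve (pt v)" unfolding local_ring_def by blast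
qed

lemma maximal_ideal_eq: assumes v: "on_curve v" shows "maximal_ideal_at curve (pt v) = cls ` MI v"
proof (intro equalityI subsetI)
  fix f assume "f \<in> maximal_ideal_at curve (pt v)"
  then obtain \<phi> A B where "f = cls \<phi>" "(A, B) \<in> cls \<phi>"
    and nv: "\<not> vanishes_at (pt v) B" "vanishes_at (pt v) A"
    unfolding maximal_ideal_at_def carrier_function_field by blast
  then have "(A, B) \<in> fractions curve" "\<phi> = eval_fls A gen / eval_fls B gen"
    by (simp_all add: cls_def)
  then obtain d where d: "homogeneous d A" "homogeneous d B" by (auto simp: fractions_iff)
  have "eval B v \<noteq> 0" "eval A v = 0"
    using nv vanishes_at_pt[OF _ d(1)] vanishes_at_pt[OF _ d(2)] v unfolding on_curve_def by blast+
  then have "\<phi> \<in> MI v" using d \<open>\<phi> = _\<close> MI_I by blast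
  then show "f \<in> cls ` MI v" using \<open>f = cls \<phi>\<close> by blast
next
  fix f assume "f \<in> cls ` MI v"
  then obtain \<phi> where \<phi>: "\<phi> \<in> MI v" "f = cls \<phi>" by blast
  then obtain d A B where d: "homogeneous d A" "homogeneous d B" "eval B v \<noteq> 0" "eval A v = 0"
    "\<phi> = eval_fls A gen / eval_fls B gen" by (metis MI_E)
  have "(A, B) \<in> f" using cls_pair[OF v d(1-3)] \<phi> d by simp
  moreover have "\<not> vanishes_at (pt v) B" "vanishes_at (pt v) A"
    using d vanishes_at_pt[OF _ d(2)] vanishes_at_pt[OF _ d(1)] v unfolding on_curve_def by blast+
  moreover have "f \<in> carrier (function_field curve)"
    using \<phi> LR_in_FF[OF v] MI_subset_LR by (auto simp: carrier_function_field)
  ultimately show "f \<in> maximal_ideal_at curve (pt v)" unfolding maximal_ideal_at_def by blast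
qed

text \<open>
  \<open>t\<close> is a parameter at \<open>v\<close> if it generates the maximal ideal and no nonzero function is
  divisible by all its powers.
\<close>

definition parameter :: "'a ^ 4 \<Rightarrow> 'a fls \<Rightarrow> bool" where
  "parameter v t \<longleftrightarrow> on_curve v \<and> t \<noteq> 0 \<and> MI v = {t * x | x. x \<in> LR v} \<and>
     (\<forall>\<psi>\<in>LR v. \<psi> \<noteq> 0 \<longrightarrow> (\<exists>N. \<forall>n>N. \<forall>x\<in>LR v. \<psi> \<noteq> t ^ n * x))"

context
  fixes v t
  assumes par: "parameter v t"
begin

lemma on_v: "on_curve v" and t_nz: "t \<noteq> 0" and MI_t: "MI v = {t * x | x. x \<in> LR v}"
  using par by (simp_all add: parameter_def)

lemma t_in_MI: "t \<in> MI v"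
  unfolding MI_t using LR_one by force

lemma t_in_FF: "t \<in> FF"
  using t_in_MI MI_subset_LR LR_in_FF[OF on_v] by blast

lemma unit_mult:
  assumes "u \<in> LR v - MI v" "u' \<in> LR v - MI v"
  shows "u * u' \<in> LR v - MI v"
proof -
  have nz: "u \<noteq> 0"
    using assms MI_LR_mult[OF on_v t_in_MI LR_const[of 0]] by auto
  have "u * u' \<notin> MI v"
  proof
    assume "u * u' \<in> MI v"
    then have "(u * u') * inverse u \<in> MI v"
      using MI_LR_mult[OF on_v] LR_inverse[OF on_v] assms by blast
    then show False using nz assms by (simp add: field_simps)
  qed
  then show ?thesis using assms LR_mult[OF on_v] by blast
qed

lemma unit_nz: "u \<in> LR v - MI v \<Longrightarrow> u \<noteq> 0"
  using MI_LR_mult[OF on_v t_in_MI LR_const[of 0]] by auto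

lemma unit_inverse:
  assumes u: "u \<in> LR v - MI v"
  shows "inverse u \<in> LR v - MI v"
proof -
  have "inverse u \<notin> MI v"
  proof
    assume "inverse u \<in> MI v"
    then have "inverse u * u \<in> MI v" using MI_LR_mult[OF on_v] u by blast
    then show False using one_notin_MI[OF on_v] unit_nz[OF u] by simp
  qed
  then show ?thesis using u LR_inverse[OF on_v] by blast
qed

lemma unit_one: "1 \<in> LR v - MI v"
  using LR_one one_notin_MI[OF on_v] by blast

lemma unit_power_int: assumes "u \<in> LR v - MI v" shows "u powi n \<in> LR v - MI v"
proof -
  have "u ^ k \<in> LR v - MI v" if "u \<in> LR v - MI v" for u k
    by (induction k) (use that unit_one unit_mult in auto)
  then show ?thesis using assms unit_inverse by (auto simp: power_int_def)
qed

lemma unit_order_unique: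
  assumes "u \<in> LR v - MI v" "u' \<in> LR v - MI v" "u * t powi n = u' * t powi n'"
  shows "n = n'"
proof -
  have False if "u \<in> LR v - MI v" "u' \<in> LR v - MI v" "u * t powi n = u' * t powi n'" "n < n'"
    for u u' n n'
  proof -
    define k where "k = nat (n' - n) - 1"
    have "n' = n + int (Suc k)" using that(4) by (simp add: k_def)
    then have "u * t powi n = (u' * t ^ Suc k) * t powi n"
      using that(3) t_nz by (simp add: power_int_add mult_ac del: of_nat_Suc power_Suc)
    then have "u = t * (u' * t ^ k)" using t_nz by simp
    moreover have "u' * t ^ k \<in> LR v"
      using that(2) t_in_MI MI_subset_LR LR_mult[OF on_v] LR_power[OF on_v] by blast
    ultimately have "u \<in> MI v" using MI_t by blast
    then show False using that(1) by blast
  qed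
  from this[OF assms] this[OF assms(2,1) assms(3)[symmetric]] show ?thesis
    by (cases n n' rule: linorder_cases) auto
qed

lemma uniformizer_cls_iff:
  "uniformizer curve (pt v) (cls s) \<longleftrightarrow> s \<in> MI v \<and> MI v = {s * x | x. x \<in> LR v}"
  if s: "s \<in> FF"
proof -
  have sub: "MI v \<subseteq> FF" "LR v \<subseteq> FF" using MI_subset_LR LR_in_FF[OF on_v] by blast+
  have inj: "inj_on cls FF" using cls_eq_iff by (auto intro: inj_onI)
  have "{cls s \<otimes>\<^bsub>function_field curve\<^esub> h | h. h \<in> cls ` LR v} = cls ` {s * x | x. x \<in> LR v}"
  proof -
    have "cls s \<otimes>\<^bsub>function_field curve\<^esub> cls x = cls (s * x)" if "x \<in> LR v" for x
      using cls_mult s that sub by blast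
    then show ?thesis by (auto simp: image_iff)
  qed
  moreover have "{s * x | x. x \<in> LR v} \<subseteq> FF" using s sub FF_mult by blast
  moreover have "cls s \<in> cls ` MI v \<longleftrightarrow> s \<in> MI v"
    using inj s sub by (auto dest: inj_onD)
  ultimately show ?thesis
    unfolding uniformizer_def local_ring_eq[OF on_v] maximal_ideal_eq[OF on_v]
    using inj_on_image_eq_iff[OF inj sub(1), of "{s * x | x. x \<in> LR v}"] by simp
qed

lemma ord_at_eq:
  assumes u: "u \<in> LR v - MI v" and \<phi>: "\<phi> = u * t powi n"
  shows "ord_at curve (pt v) (cls \<phi>) = n"
  unfolding ord_at_def
proof (rule the_equality)
  have sub: "MI v \<subseteq> FF" "LR v \<subseteq> FF" using MI_subset_LR LR_in_FF[OF on_v] by blast+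
  have inj: "inj_on cls FF" using cls_eq_iff by (auto intro: inj_onI)
  have units: "local_ring curve (pt v) - maximal_ideal_at curve (pt v) = cls ` (LR v - MI v)"
    unfolding local_ring_eq[OF on_v] maximal_ideal_eq[OF on_v]
    by (rule inj_on_image_set_diff[OF inj, symmetric]) (use sub in blast)+
  have "uniformizer curve (pt v) (cls t)"
    using uniformizer_cls_iff[OF t_in_FF] t_in_MI MI_t by blast
  moreover have "cls u \<in> local_ring curve (pt v) - maximal_ideal_at curve (pt v)"
    using u units by blast
  moreover have "cls \<phi> = cls u \<otimes>\<^bsub>function_field curve\<^esub> (cls t [^]\<^bsub>function_field curve\<^esub> n)"
  proof -
    have "u \<in> FF" using u sub by blast
    then show ?thesis
      by (simp add: \<phi> cls_int_pow[OF t_in_FF t_nz] cls_mult FF_power_int t_in_FF)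
  qed
  ultimately show "\<exists>t u. uniformizer curve (pt v) t \<and>
      u \<in> local_ring curve (pt v) - maximal_ideal_at curve (pt v) \<and>
      cls \<phi> = u \<otimes>\<^bsub>function_field curve\<^esub> (t [^]\<^bsub>function_field curve\<^esub> n)" by blast
  fix n' :: int
  assume "\<exists>t u. uniformizer curve (pt v) t \<and>
      u \<in> local_ring curve (pt v) - maximal_ideal_at curve (pt v) \<and>
      cls \<phi> = u \<otimes>\<^bsub>function_field curve\<^esub> (t [^]\<^bsub>function_field curve\<^esub> n')"
  then obtain t' u' where t': "uniformizer curve (pt v) t'"
    "u' \<in> local_ring curve (pt v) - maximal_ideal_at curve (pt v)"
    "cls \<phi> = u' \<otimes>\<^bsub>function_field curve\<^esub> (t' [^]\<^bsub>function_field curve\<^esub> n')" by blast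
  obtain w where w: "w \<in> LR v - MI v" "u' = cls w" using t'(2) units by blast
  have "t' \<in> cls ` MI v" using t'(1) maximal_ideal_eq[OF on_v] unfolding uniformizer_def by blast
  then obtain s where s: "s \<in> MI v" "t' = cls s" by blast
  have sFF: "s \<in> FF" using s sub by blast
  have Ms: "MI v = {s * x | x. x \<in> LR v}"
    using t'(1) uniformizer_cls_iff[OF sFF] unfolding s(2) by blast
  obtain a where a: "a \<in> LR v" "s = t * a" using s MI_t by blast
  obtain b where b: "b \<in> LR v" "t = s * b" using t_in_MI Ms by blast
  have s_nz: "s \<noteq> 0" using b t_nz by auto
  have "a * b = 1" using a(2) b(2) t_nz by (metis mult.assoc mult_cancel_left1)
  then have aU: "a \<in> LR v - MI v"
    using a(1) b(1) MI_LR_mult[OF on_v _ b(1)] one_notin_MI[OF on_v] by (metis DiffI)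
  have "cls \<phi> = cls (w * s powi n')"
    using t'(3) w s cls_int_pow[OF sFF s_nz] cls_mult FF_power_int[OF sFF] sub by (metis DiffD1 subsetD)
  moreover have "w * s powi n' \<in> FF" using w sub FF_power_int[OF sFF] FF_mult by blast
  ultimately have "\<phi> = w * s powi n'" using cls_eq_iff by metis
  then have "u * t powi n = (w * a powi n') * t powi n'"
    by (simp add: \<phi> a(2) power_int_mult_distrib mult_ac)
  then show "n' = n"
    using unit_order_unique[OF u unit_mult[OF w(1) unit_power_int[OF aU]]] by metis
qed

lemma order_decomposition_LR:
  assumes "\<psi> \<in> LR v" "\<psi> \<noteq> 0"
  obtains u n where "u \<in> LR v - MI v" "\<psi> = u * t ^ n"
proof -
  obtain N where N: "\<forall>n>N. \<forall>x\<in>LR v. \<psi> \<noteq> t ^ n * x" using assms par by (auto simp: parameter_def)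
  define S where "S = {n. \<exists>x\<in>LR v. \<psi> = t ^ n * x}"
  have "0 \<in> S" using assms by (simp add: S_def)
  moreover have "S \<subseteq> {..N}" using N by (auto simp: S_def not_less[symmetric])
  ultimately have fin: "finite S" "S \<noteq> {}" by (auto intro: finite_subset)
  then have "Max S \<in> S" by (rule Max_in)
  then obtain x where x: "x \<in> LR v" "\<psi> = t ^ Max S * x" by (auto simp: S_def)
  have "x \<notin> MI v"
  proof
    assume "x \<in> MI v"
    then obtain y where "y \<in> LR v" "x = t * y" using MI_t by blast
    then have "\<psi> = t ^ Suc (Max S) * y" using x by simp
    then have "Suc (Max S) \<in> S" using \<open>y \<in> LR v\<close> unfolding S_def by blast
    then have "Suc (Max S) \<le> Max S" using fin by simp
    then show False by simp
  qed
  then show ?thesis using x that[of x "Max S"] by (simp add: mult.commute)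
qed

lemma FF_quotient:
  assumes "\<phi> \<in> FF"
  obtains x y where "x \<in> LR v" "y \<in> LR v" "y \<noteq> 0" "\<phi> = x / y"
proof -
  obtain A B where AB: "(A, B) \<in> fractions curve" "eval_fls A gen / eval_fls B gen = \<phi>"
    using FF_fraction[OF assms] by blast
  then obtain d where d: "homogeneous d A" "homogeneous d B" "eval_fls B gen \<noteq> 0"
    by (auto simp: fractions_iff)
  obtain i where i: "v $ i \<noteq> 0" using on_v by (auto simp: on_curve_def vec_eq_iff)
  define L where "L = (mvar i ^ d :: ('a, 4) mpoly)"
  have L: "homogeneous d L" "eval L v \<noteq> 0"
    using i by (simp_all add: L_def homogeneous_mvar_power eval_power)
  have Lnz: "eval_fls L gen \<noteq> 0" using LR_nz[OF on_v L] .
  show ?thesis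
  proof
    show "eval_fls A gen / eval_fls L gen \<in> LR v" "eval_fls B gen / eval_fls L gen \<in> LR v"
      using d L by (auto intro: LR_I)
    show "eval_fls B gen / eval_fls L gen \<noteq> 0" using d Lnz by simp
    show "\<phi> = eval_fls A gen / eval_fls L gen / (eval_fls B gen / eval_fls L gen)"
      using AB(2) Lnz by simp
  qed
qed

lemma order_decomposition:
  assumes "\<phi> \<in> FF" "\<phi> \<noteq> 0"
  obtains u n where "u \<in> LR v - MI v" "\<phi> = u * t powi n"
proof -
  obtain x y where xy: "x \<in> LR v" "y \<in> LR v" "y \<noteq> 0" "\<phi> = x / y"
    using FF_quotient[OF assms(1)] by blast
  then have "x \<noteq> 0" using assms by auto
  obtain u n where u: "u \<in> LR v - MI v" "x = u * t ^ n"
    using order_decomposition_LR[OF xy(1) \<open>x \<noteq> 0\<close>] by blast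
  obtain w k where w: "w \<in> LR v - MI v" "y = w * t ^ k"
    using order_decomposition_LR[OF xy(2,3)] by blast
  have "\<phi> = (u * inverse w) * t powi (int n - int k)"
    using unit_nz[OF w(1)] t_nz by (simp add: xy u w power_int_diff field_simps)
  then show ?thesis using that unit_mult[OF u(1) unit_inverse[OF w(1)]] by blast
qed

lemma ord_at_ge_iff:
  assumes "\<phi> \<in> FF" "\<phi> \<noteq> 0"
  shows "ord_at curve (pt v) (cls \<phi>) \<ge> - int k \<longleftrightarrow> \<phi> * t ^ k \<in> LR v"
proof -
  obtain u n where u: "u \<in> LR v - MI v" "\<phi> = u * t powi n"
    using order_decomposition[OF assms] by blast
  have ord: "ord_at curve (pt v) (cls \<phi>) = n" using ord_at_eq[OF u] .
  have tk: "\<phi> * t ^ k = u * t powi (n + int k)"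
    using t_nz by (simp add: u power_int_add mult.assoc)
  show ?thesis
  proof (cases "n + int k \<ge> 0")
    case True
    then have "t powi (n + int k) = t ^ nat (n + int k)" by (simp add: power_int_def)
    moreover have "t ^ nat (n + int k) \<in> LR v"
      using t_in_MI MI_subset_LR LR_power[OF on_v] by blast
    ultimately have "\<phi> * t ^ k \<in> LR v"
      unfolding tk using u LR_mult[OF on_v, of u "t ^ nat (n + int k)"] by simp
    then show ?thesis using True ord by simp
  next
    case False
    have "\<phi> * t ^ k \<notin> LR v"
    proof
      assume mem: "\<phi> * t ^ k \<in> LR v"
      define j where "j = nat (- (n + int k)) - 1"
      have j: "n + int k + int (Suc j) = 0" using False by (simp add: j_def)
      have pw: "t powi (n + int k + int (Suc j)) = t powi (n + int k) * t ^ Suc j"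
        using t_nz by (simp only: power_int_add power_int_of_nat simp_thms)
      have "u = t powi (n + int k + int (Suc j)) * u" by (simp only: j power_int_0_right mult_1)
      also have "\<dots> = t * (t ^ j * (\<phi> * t ^ k))" unfolding tk pw by simp
      finally have "u \<in> MI v"
        using MI_t LR_mult[OF on_v LR_power[OF on_v] mem] t_in_MI MI_subset_LR by blast
      then show False using u by blast
    qed
    then show ?thesis using False ord by simp
  qed
qed

end

text \<open>Values of functions at points where they are regular.\<close>

lemma value_at_eq:
  assumes v: "on_curve v" and d: "homogeneous d A" "homogeneous d B" "eval B v \<noteq> 0"
  shows "value_at (pt v) (cls (eval_fls A gen / eval_fls B gen)) = eval A v / eval B v"
  unfolding value_at_def
proof (rule the_equality)
  let ?f = "cls (eval_fls A gen / eval_fls B gen)"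
  have vnz: "v \<noteq> 0" using v by (simp add: on_curve_def)
  show "\<exists>(A', B')\<in>?f. \<exists>w\<in>pt v. eval B' w \<noteq> 0 \<and> eval A v / eval B v = eval A' w / eval B' w"
    using cls_pair[OF v d] self_in_pt[OF vnz] d by blast
  fix c assume "\<exists>(A', B')\<in>?f. \<exists>w\<in>pt v. eval B' w \<noteq> 0 \<and> c = eval A' w / eval B' w"
  then obtain A' B' w where w: "(A', B') \<in> ?f" "w \<in> pt v" "eval B' w \<noteq> 0" "c = eval A' w / eval B' w"
    by blast
  then obtain a where a: "a \<noteq> 0" "w = a *s v" using in_pt_iff[OF vnz] by blast
  have fr: "(A', B') \<in> fractions curve" and
    eq: "eval_fls A' gen / eval_fls B' gen = eval_fls A gen / eval_fls B gen"
    using w(1) by (simp_all add: cls_def)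
  then obtain d' where d': "homogeneous d' A'" "homogeneous d' B'" "eval_fls B' gen \<noteq> 0"
    by (auto simp: fractions_iff)
  have B': "eval B' v \<noteq> 0" using w(3) a eval_scale[OF d'(2)] by auto
  have c: "c = eval A' v / eval B' v"
    using a by (simp add: w(4) a(2) eval_scale[OF d'(1)] eval_scale[OF d'(2)])
  have "homogeneous (d + d') (A * B' - B * A')"
    using d d' by (intro homogeneous_diff homogeneous_mult)
  moreover have "eval_fls (A * B' - B * A') gen = 0"
    using eq d'(3) LR_nz[OF v d(2,3)] by (simp add: eval_fls_diff eval_fls_mult frac_eq_eq mult.commute)
  ultimately have "eval (A * B' - B * A') v = 0" using on_curve_zero[OF v] by blast
  then show "c = eval A v / eval B v"
    using B' d(3) by (simp add: c eval_diff eval_mult frac_eq_eq mult.commute)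
qed

subsection \<open>Affine points\<close>

lemma homogenize_pair:
  assumes K: "0 \<in> K" "\<And>a b. a \<in> K \<Longrightarrow> b \<in> K \<Longrightarrow> a + b \<in> K"
    and g: "g \<in> polyfun K" and h: "h \<in> polyfun K"
  obtains d and A B :: "('a, 4) mpoly" where "homogeneous d A" "homogeneous d B"
    "\<And>m. Poly_Mapping.lookup A m \<in> K" "\<And>m. Poly_Mapping.lookup B m \<in> K"
    "\<And>x y z. eval_fls A (vector [x, y, z, 1]) = g x y z"
    "\<And>x y z. eval_fls B (vector [x, y, z, 1]) = h x y z"
proof -
  obtain d1 where d1: "\<And>d. d \<ge> d1 \<Longrightarrow> \<exists>F :: ('a, 4) mpoly. homogeneous d F \<and>
    (\<forall>m. Poly_Mapping.lookup F m \<in> K) \<and> (\<forall>x y z. eval_fls F (vector [x, y, z, 1]) = g x y z)"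
    using homogenize[OF K g] by blast
  obtain d2 where d2: "\<And>d. d \<ge> d2 \<Longrightarrow> \<exists>F :: ('a, 4) mpoly. homogeneous d F \<and>
    (\<forall>m. Poly_Mapping.lookup F m \<in> K) \<and> (\<forall>x y z. eval_fls F (vector [x, y, z, 1]) = h x y z)"
    using homogenize[OF K h] by blast
  show ?thesis using d1[of "max d1 d2"] d2[of "max d1 d2"] that by (metis max.cobounded1 max.cobounded2)
qed

lemma pval_eval:
  fixes A :: "('a, 4) mpoly"
  assumes "\<And>x y z. eval_fls A (vector [x, y, z, 1]) = g x y z"
  shows "eval A (vector [a, b, c, 1]) = pval g a b c"
  using pval_dehomogenize[of A a b c] assms by (simp add: pval_def)

lemma homogenize_pair_UNIV:
  assumes g: "g \<in> PF" and h: "h \<in> PF"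
  obtains d and A B :: "('a, 4) mpoly" where "homogeneous d A" "homogeneous d B"
    "eval_fls A gen = g xi yi zi" "eval_fls B gen = h xi yi zi"
    "\<And>a b c. eval A (vector [a, b, c, 1]) = pval g a b c"
    "\<And>a b c. eval B (vector [a, b, c, 1]) = pval h a b c"
proof (rule homogenize_pair[OF UNIV_I UNIV_I g h])
  fix d and A B :: "('a, 4) mpoly"
  assume "homogeneous d A" "homogeneous d B"
    and A: "\<And>x y z. eval_fls A (vector [x, y, z, 1]) = g x y z"
    and B: "\<And>x y z. eval_fls B (vector [x, y, z, 1]) = h x y z"
  then show thesis using that[of d A B] pval_eval[OF A] pval_eval[OF B] by simp
qed

lemma LR_affine: "LR (vector [a, b, c, 1]) = loc a b c"
proof (intro equalityI subsetI)
  fix \<phi> assume "\<phi> \<in> LR (vector [a, b, c, 1])"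
  then obtain d A B where "homogeneous d A" "homogeneous d B" and B: "eval B (vector [a, b, c, 1]) \<noteq> 0"
    and \<phi>: "\<phi> = eval_fls A gen / eval_fls B gen" by (rule LR_E)
  have "pval (\<lambda>x y z. eval_fls B (vector [x, y, z, 1])) a b c \<noteq> 0"
    using B by (simp add: pval_dehomogenize)
  then show "\<phi> \<in> loc a b c"
    unfolding loc_def mem_Collect_eq \<phi>
    by (intro exI[of _ "\<lambda>x y z. eval_fls A (vector [x, y, z, 1])"]
        exI[of _ "\<lambda>x y z. eval_fls B (vector [x, y, z, 1])"] conjI refl dehomogenize_UNIV)
next
  fix \<phi> assume "\<phi> \<in> loc a b c"
  then obtain g h where gh: "\<phi> = g xi yi zi / h xi yi zi" "g \<in> PF" "h \<in> PF" "pval h a b c \<noteq> 0"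
    by (auto simp: loc_def)
  obtain d A B where AB: "homogeneous d A" "homogeneous d B"
    "eval_fls A gen = g xi yi zi" "eval_fls B gen = h xi yi zi"
    "\<And>a b c. eval A (vector [a, b, c, 1]) = pval g a b c"
    "\<And>a b c. eval B (vector [a, b, c, 1]) = pval h a b c"
    using homogenize_pair_UNIV[OF gh(2,3)] by blast
  have "eval B (vector [a, b, c, 1]) \<noteq> 0" using gh(4) AB(6) by simp
  then have "eval_fls A gen / eval_fls B gen \<in> LR (vector [a, b, c, 1])" using AB by (intro LR_I)
  then show "\<phi> \<in> LR (vector [a, b, c, 1])" by (simp add: AB gh)
qed

lemma MI_affine: "MI (vector [a, b, c, 1]) = max_ideal a b c"
proof (intro equalityI subsetI)
  fix \<phi> assume "\<phi> \<in> MI (vector [a, b, c, 1])"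
  then obtain d A B where "homogeneous d A" "homogeneous d B" and B: "eval B (vector [a, b, c, 1]) \<noteq> 0"
    "eval A (vector [a, b, c, 1]) = 0"
    and \<phi>: "\<phi> = eval_fls A gen / eval_fls B gen" by (rule MI_E)
  have "pval (\<lambda>x y z. eval_fls B (vector [x, y, z, 1])) a b c \<noteq> 0"
    "pval (\<lambda>x y z. eval_fls A (vector [x, y, z, 1])) a b c = 0"
    using B by (simp_all add: pval_dehomogenize)
  then show "\<phi> \<in> max_ideal a b c"
    unfolding max_ideal_def mem_Collect_eq \<phi>
    by (intro exI[of _ "\<lambda>x y z. eval_fls A (vector [x, y, z, 1])"]
        exI[of _ "\<lambda>x y z. eval_fls B (vector [x, y, z, 1])"] conjI refl dehomogenize_UNIV)
next
  fix \<phi> assume "\<phi> \<in> max_ideal a b c"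
  then obtain g h where gh: "\<phi> = g xi yi zi / h xi yi zi" "g \<in> PF" "h \<in> PF" "pval h a b c \<noteq> 0"
    "pval g a b c = 0" by (auto simp: max_ideal_def)
  obtain d A B where AB: "homogeneous d A" "homogeneous d B"
    "eval_fls A gen = g xi yi zi" "eval_fls B gen = h xi yi zi"
    "\<And>a b c. eval A (vector [a, b, c, 1]) = pval g a b c"
    "\<And>a b c. eval B (vector [a, b, c, 1]) = pval h a b c"
    using homogenize_pair_UNIV[OF gh(2,3)] by blast
  have "eval B (vector [a, b, c, 1]) \<noteq> 0" "eval A (vector [a, b, c, 1]) = 0"
    using gh(4,5) AB(5,6) by simp_all
  then have "eval_fls A gen / eval_fls B gen \<in> MI (vector [a, b, c, 1])" using AB by (intro MI_I)
  then show "\<phi> \<in> MI (vector [a, b, c, 1])" by (simp add: AB gh)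
qed

lemma parameter_affine:
  assumes P: "gk_rel q a b c"
  shows "parameter (vector [a, b, c, 1]) (zi - fls_const c)"
proof -
  have "\<exists>N. \<forall>n>N. \<forall>x\<in>loc a b c. \<psi> \<noteq> (zi - fls_const c) ^ n * x"
    if "\<psi> \<in> loc a b c" "\<psi> \<noteq> 0" for \<psi>
    using affine_order_bounded[OF P that] by metis
  then show ?thesis
    using on_curve_affine[OF P] affine_uniformizer[OF P] zi_minus_const_nz
    by (simp add: parameter_def LR_affine MI_affine)
qed

lemma ord_affine_ge:
  assumes "gk_rel q a b c" "\<phi> \<in> FF" "\<phi> \<noteq> 0"
  shows "ord_at curve (affine_pt a b c) (cls \<phi>) \<ge> - int k \<longleftrightarrow>
    \<phi> * (zi - fls_const c) ^ k \<in> loc a b c"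
  using ord_at_ge_iff[OF parameter_affine[OF assms(1)] assms(2,3)]
  by (simp add: affine_pt_def LR_affine)

lemma value_affine:
  assumes P: "gk_rel q a b c" and gh: "g \<in> PF" "h \<in> PF" "pval h a b c \<noteq> 0"
  shows "value_at (affine_pt a b c) (cls (g xi yi zi / h xi yi zi)) = pval g a b c / pval h a b c"
proof -
  obtain d A B where AB: "homogeneous d A" "homogeneous d B"
    "eval_fls A gen = g xi yi zi" "eval_fls B gen = h xi yi zi"
    "\<And>a b c. eval A (vector [a, b, c, 1]) = pval g a b c"
    "\<And>a b c. eval B (vector [a, b, c, 1]) = pval h a b c"
    using homogenize_pair_UNIV[OF gh(1,2)] by blast
  have "eval B (vector [a, b, c, 1]) \<noteq> 0" using gh(3) AB(6) by simp
  from value_at_eq[OF on_curve_affine[OF P] AB(1,2) this]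
  show ?thesis by (simp add: AB affine_pt_def)
qed

subsection \<open>The point at infinity\<close>

abbreviation inf_vec :: "'a ^ 4" where
  "inf_vec \<equiv> vector [1, 0, 0, 0]"

lemma LR_inf_gen':
  assumes "homogeneous d A" "homogeneous d B"
  shows "eval_fls A gen / eval_fls B gen = eval_fls A gen' / eval_fls B gen'"
  using gen_scale[OF assms(1)] gen_scale[OF assms(2)] xi_nz by simp

lemma eval_gen'_in_LR: assumes "homogeneous d A" shows "eval_fls A gen' \<in> LR inf_vec"
proof -
  have "eval_fls A gen / eval_fls (mvar 1 ^ d) gen \<in> LR inf_vec"
    using assms by (intro LR_I[of d] homogeneous_mvar_power) (simp_all add: eval_power)
  then show ?thesis using xi_nz by (simp add: gen_scale[OF assms] eval_fls_power)
qed

text \<open>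
  At infinity \<open>z / x\<close> is a local parameter: in terms of \<open>v = y / x\<close>, \<open>w = z / x\<close>, \<open>u = 1 / x\<close> the
  equations of the curve express \<open>v\<close> as a multiple of \<open>w\<close> and \<open>u\<close> as a multiple of \<open>v\<close> in the local ring.
\<close>

lemma yi_xi_factor: "\<exists>\<alpha>\<in>LR inf_vec. yi / xi = zi / xi * \<alpha>"
proof -
  define n where "n = q\<^sup>2 - q + 1"
  have n1: "n - 1 = q * (q - 1)" "n = Suc (n - 1)"
    by (simp_all add: n_def power2_eq_square right_diff_distrib')
  define F :: "('a, 4) mpoly" where "F = mvar 1 ^ q + mvar 1 ^ 1 * mvar 4 ^ (q - 1)"
  define B :: "('a, 4) mpoly" where "B = F ^ (q - 1) - mvar 4 ^ (n - 1)"
  have "homogeneous (1 + (q - 1)) (mvar 1 ^ 1 * mvar 4 ^ (q - 1) :: ('a, 4) mpoly)"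
    by (intro homogeneous_mult homogeneous_mvar_power)
  then have "homogeneous q F"
    using q_ge2 unfolding F_def by (intro homogeneous_add homogeneous_mvar_power) simp
  then have B: "homogeneous (n - 1) B"
    unfolding B_def n1(1) by (intro homogeneous_diff homogeneous_mvar_power homogeneous_power)
  have "n - 1 \<noteq> 0" "q - 1 \<noteq> 0" using q_ge2 n1(1) by simp_all
  then have B1: "eval B inf_vec = 1"
    by (simp add: B_def F_def eval_diff eval_power eval_add eval_mult power_0_left)
  have Bg: "eval_fls B gen = (xi ^ q + xi) ^ (q - 1) - 1"
    by (simp add: B_def F_def eval_fls_diff eval_fls_power eval_fls_add eval_fls_mult)
  have "zi ^ n = yi * eval_fls B gen"
    using gk_rel_third[OF rel_inf] unfolding Bg n_def by (simp only: right_diff_distrib mult_1_right)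
  then have "zi * zi ^ (n - 1) = yi * eval_fls B gen" using n1(2) by (metis power_Suc)
  moreover have "eval_fls B gen \<noteq> 0" using LR_nz[OF on_curve_inf B] B1 by simp
  ultimately have "yi = zi * (zi ^ (n - 1) / eval_fls B gen)" by (simp add: field_simps)
  then have "yi / xi = zi / xi * (zi ^ (n - 1) / eval_fls B gen)"
    by (metis times_divide_eq_left times_divide_eq_right)
  moreover have "eval_fls (mvar 3 ^ (n - 1)) gen / eval_fls B gen \<in> LR inf_vec"
    using B B1 by (intro LR_I[of "n - 1"] homogeneous_mvar_power) simp_all
  then have "zi ^ (n - 1) / eval_fls B gen \<in> LR inf_vec" by (simp add: eval_fls_power)
  ultimately show ?thesis by blast
qed

lemma inverse_xi_factor: "\<exists>\<beta>\<in>LR inf_vec. 1 / xi = yi / xi * \<beta>"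
proof -
  define B :: "('a, 4) mpoly" where "B = mvar 1 ^ q + mvar 1 ^ 1 * mvar 4 ^ (q - 1)"
  have "homogeneous (1 + (q - 1)) (mvar 1 ^ 1 * mvar 4 ^ (q - 1) :: ('a, 4) mpoly)"
    by (intro homogeneous_mult homogeneous_mvar_power)
  then have B: "homogeneous q B"
    using q_ge2 unfolding B_def by (intro homogeneous_add homogeneous_mvar_power) simp
  have B1: "eval B inf_vec = 1"
    using q_ge2 by (simp add: B_def eval_power eval_add eval_mult power_0_left)
  have Bg: "eval_fls B gen = xi ^ q + xi"
    by (simp add: B_def eval_fls_power eval_fls_add eval_fls_mult)
  have nz: "eval_fls B gen \<noteq> 0" using LR_nz[OF on_curve_inf B] B1 by simp
  have "yi * yi ^ q = eval_fls B gen"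
    using rel_inf by (simp add: Bg gk_rel_def)
  then have "yi * (yi ^ q / eval_fls B gen) = 1" using nz by simp
  then have "1 / xi = yi / xi * (yi ^ q / eval_fls B gen)"
    by (metis times_divide_eq_left)
  moreover have "eval_fls (mvar 2 ^ q) gen / eval_fls B gen \<in> LR inf_vec"
    using B B1 by (intro LR_I[of q] homogeneous_mvar_power) simp_all
  then have "yi ^ q / eval_fls B gen \<in> LR inf_vec" by (simp add: eval_fls_power)
  ultimately show ?thesis by blast
qed

lemma parameter_inf: "parameter inf_vec (zi / xi)"
proof -
  let ?w = "zi / xi" and ?R = "LR inf_vec"
  define J where "J = {?w * x | x. x \<in> ?R}"
  note add = LR_add[OF on_curve_inf] and mult = LR_mult[OF on_curve_inf]
  have J_add: "a + b \<in> J" if a: "a \<in> J" and b: "b \<in> J" for a b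
  proof -
    obtain x where "x \<in> ?R" "a = ?w * x" using a unfolding J_def by blast
    moreover obtain y where "y \<in> ?R" "b = ?w * y" using b unfolding J_def by blast
    ultimately have "a + b = ?w * (x + y)" "x + y \<in> ?R" using add by (simp_all add: distrib_left)
    then show ?thesis unfolding J_def by blast
  qed
  have J_mult: "a * b \<in> J" if a: "a \<in> J" and b: "b \<in> ?R" for a b
  proof -
    obtain x where "x \<in> ?R" "a = ?w * x" using a unfolding J_def by blast
    then have "a * b = ?w * (x * b)" "x * b \<in> ?R" using mult b by (simp_all add: mult.assoc)
    then show ?thesis unfolding J_def by blast
  qed
  have J0: "0 \<in> J" using LR_const[of 0] by (force simp: J_def)
  have wJ: "?w \<in> J" unfolding J_def using LR_one by force
  have yJ: "yi / xi \<in> J" using yi_xi_factor unfolding J_def by blast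
  then have xJ: "1 / xi \<in> J" using inverse_xi_factor J_mult by metis
  have R: "gen' $ i \<in> ?R" for i
  proof -
    have "eval_fls (mvar i) gen' \<in> ?R" by (rule eval_gen'_in_LR[OF homogeneous_mvar])
    then show ?thesis by simp
  qed
  have J_power: "a ^ k \<in> J" if "a \<in> J" "a \<in> ?R" "k > 0" for a k
    using that J_mult[OF that(1) LR_power[OF on_curve_inf that(2)], of "k - 1"]
    by (cases k) simp_all
  \<comment> \<open>Each monomial other than a power of \<open>X\<close> is a multiple of \<open>u\<close>, \<open>v\<close> or \<open>w\<close> at the generic point.\<close>
  have diffJ: "eval_fls A gen' - fls_const (eval A inf_vec) \<in> J" for A
  proof -
    let ?g = "\<lambda>m. (gen' $ 1) ^ Poly_Mapping.lookup m 1 * (gen' $ 2) ^ Poly_Mapping.lookup m 2 *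
      (gen' $ 3) ^ Poly_Mapping.lookup m 3 * (gen' $ 4) ^ Poly_Mapping.lookup m 4"
    let ?c = "\<lambda>m. (0 :: 'a) ^ Poly_Mapping.lookup m (2 :: 4) * 0 ^ Poly_Mapping.lookup m 3 *
      0 ^ Poly_Mapping.lookup m 4"
    have summand: "fls_const a * ?g m - fls_const (a * ?c m) \<in> J" for a m
    proof (cases "Poly_Mapping.lookup m 2 = 0 \<and> Poly_Mapping.lookup m 3 = 0
        \<and> Poly_Mapping.lookup m 4 = 0")
      case True
      then show ?thesis using J0 by simp
    next
      case False
      then have c0: "?c m = 0" by (auto simp: power_0_left)
      have pw: "(gen' $ i) ^ k \<in> ?R" for i k by (rule LR_power[OF on_curve_inf R])
      have "?g m \<in> J"
      proof -
        consider "Poly_Mapping.lookup m 2 > 0" | "Poly_Mapping.lookup m 3 > 0"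
          | "Poly_Mapping.lookup m 4 > 0" using False by blast
        then show ?thesis
        proof cases
          case 1
          have "(gen' $ 2) ^ Poly_Mapping.lookup m 2 \<in> J"
            using J_power[OF _ R[of 2] 1] yJ by simp
          then have "(gen' $ 2) ^ Poly_Mapping.lookup m 2 * ((gen' $ 1) ^ Poly_Mapping.lookup m 1 *
            (gen' $ 3) ^ Poly_Mapping.lookup m 3 * (gen' $ 4) ^ Poly_Mapping.lookup m 4) \<in> J"
            by (intro J_mult mult pw)
          then show ?thesis by (simp only: mult_ac)
        next
          case 2
          have "(gen' $ 3) ^ Poly_Mapping.lookup m 3 \<in> J"
            using J_power[OF _ R[of 3] 2] wJ by simp
          then have "(gen' $ 3) ^ Poly_Mapping.lookup m 3 * ((gen' $ 1) ^ Poly_Mapping.lookup m 1 *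
            (gen' $ 2) ^ Poly_Mapping.lookup m 2 * (gen' $ 4) ^ Poly_Mapping.lookup m 4) \<in> J"
            by (intro J_mult mult pw)
          then show ?thesis by (simp only: mult_ac)
        next
          case 3
          have "(gen' $ 4) ^ Poly_Mapping.lookup m 4 \<in> J"
            using J_power[OF _ R[of 4] 3] xJ by simp
          then have "(gen' $ 4) ^ Poly_Mapping.lookup m 4 * ((gen' $ 1) ^ Poly_Mapping.lookup m 1 *
            (gen' $ 2) ^ Poly_Mapping.lookup m 2 * (gen' $ 3) ^ Poly_Mapping.lookup m 3) \<in> J"
            by (intro J_mult mult pw)
          then show ?thesis by (simp only: mult_ac)
        qed
      qed
      then have "?g m * fls_const a \<in> J" by (rule J_mult[OF _ LR_const])
      then have "fls_const a * ?g m \<in> J" by (simp only: mult.commute)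
      then show ?thesis by (simp only: c0 mult_zero_right fls_const_0 diff_0_right)
    qed
    have "eval_fls A gen' - fls_const (eval A inf_vec)
        = (\<Sum>m\<in>Poly_Mapping.keys A. fls_const (Poly_Mapping.lookup A m) * ?g m
            - fls_const (Poly_Mapping.lookup A m * ?c m))"
      by (simp add: eval_fls_def eval_def prod_4 sum_subtractf fls_const_sum mult.assoc
          del: fls_const_mult_const)
    also have "\<dots> \<in> J"
    proof -
      have "sum f S \<in> J" if "\<And>m. f m \<in> J" for f :: "(4 \<Rightarrow>\<^sub>0 nat) \<Rightarrow> 'a fls" and S
        by (induction S rule: infinite_finite_induct) (use that J0 J_add in auto)
      from this[OF summand] show ?thesis .
    qed
    finally show ?thesis .
  qed
  have "MI inf_vec = J"
  proof (intro equalityI subsetI)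
    fix \<psi> assume "\<psi> \<in> MI inf_vec"
    then obtain d A B where AB: "homogeneous d A" "homogeneous d B" "eval B inf_vec \<noteq> 0"
      "eval A inf_vec = 0" "\<psi> = eval_fls A gen / eval_fls B gen" by (rule MI_E)
    have "eval_fls A gen' \<in> J" using diffJ[of A] AB by simp
    moreover have "eval_fls (mvar 1 ^ d) gen / eval_fls B gen \<in> ?R"
      using AB by (intro LR_I[of d] homogeneous_mvar_power)
    ultimately have "eval_fls A gen' * (eval_fls (mvar 1 ^ d) gen / eval_fls B gen) \<in> J"
      by (rule J_mult)
    then show "\<psi> \<in> J" by (simp add: AB(5) gen_scale[OF AB(1)] eval_fls_power mult.commute)
  next
    fix \<psi> assume "\<psi> \<in> J"
    then obtain x where x: "x \<in> ?R" "\<psi> = ?w * x" unfolding J_def by blast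
    have "eval_fls (mvar 3) gen / eval_fls (mvar 1) gen \<in> MI inf_vec"
      by (intro MI_I[of 1] homogeneous_mvar) simp_all
    then have "?w \<in> MI inf_vec" by simp
    then show "\<psi> \<in> MI inf_vec" unfolding x(2) by (rule MI_LR_mult[OF on_curve_inf _ x(1)])
  qed
  moreover have nonneg: "fls_subdegree x \<ge> 0" if x: "x \<in> ?R" for x
  proof -
    obtain d A B where AB: "homogeneous d A" "homogeneous d B" "eval B inf_vec \<noteq> 0"
      "x = eval_fls A gen / eval_fls B gen" using x by (rule LR_E)
    have "fls_nth (eval_fls B gen') 0 \<noteq> 0" using AB by (simp add: eval_gen'_nth0)
    then have "fls_subdegree (eval_fls B gen') = 0" "eval_fls B gen' \<noteq> 0"
      using eval_gen'_subdegree[of B] fls_subdegree_leI[of "eval_fls B gen'" 0] by auto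
    then show ?thesis
      using eval_gen'_subdegree[of A] unfolding AB(4) LR_inf_gen'[OF AB(1,2)]
      by (cases "eval_fls A gen' = 0") (simp_all add: fls_divide_subdegree)
  qed
  have wnz: "?w \<noteq> 0" using zi_nz xi_nz by simp
  have "\<exists>N. \<forall>n>N. \<forall>x\<in>?R. \<psi> \<noteq> ?w ^ n * x" if "\<psi> \<in> ?R" "\<psi> \<noteq> 0" for \<psi>
  proof (intro exI[of _ "nat (fls_subdegree \<psi>)"] allI impI ballI)
    fix n x assume n: "nat (fls_subdegree \<psi>) < n" and x: "x \<in> ?R"
    show "\<psi> \<noteq> ?w ^ n * x"
    proof
      assume eq: "\<psi> = ?w ^ n * x"
      then have "x \<noteq> 0" using that by auto
      then have "fls_subdegree \<psi> = int n * 1 + fls_subdegree x"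
        unfolding eq using wnz subdegree_ratios(2) by (simp only: fls_subdegree_mult fls_subdegree_pow power_eq_0_iff simp_thms not_False_eq_True)
      then show False using nonneg[OF x] n by linarith
    qed
  qed
  ultimately show ?thesis
    using on_curve_inf wnz unfolding parameter_def J_def by blast
qed

lemma LR_inf_subdegree:
  assumes "u \<in> LR inf_vec - MI inf_vec"
  shows "fls_subdegree u = 0"
proof -
  obtain d A B where AB: "homogeneous d A" "homogeneous d B" "eval B inf_vec \<noteq> 0"
    "u = eval_fls A gen / eval_fls B gen" using assms LR_E by blast
  then have "eval A inf_vec \<noteq> 0" using assms MI_I by blast
  have sd: "fls_subdegree (eval_fls F gen') = 0" "eval_fls F gen' \<noteq> 0" if "eval F inf_vec \<noteq> 0" for F
    using eval_gen'_subdegree[of F] fls_subdegree_leI[of "eval_fls F gen'" 0] that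
    by (auto simp: eval_gen'_nth0[symmetric])
  show ?thesis
    unfolding AB(4) LR_inf_gen'[OF AB(1,2)]
    by (subst fls_divide_subdegree) (use sd AB \<open>eval A inf_vec \<noteq> 0\<close> in auto)
qed

lemma ord_inf:
  assumes "\<phi> \<in> FF" "\<phi> \<noteq> 0"
  shows "ord_at curve inf_pt (cls \<phi>) = fls_subdegree \<phi>"
proof -
  obtain u n where u: "u \<in> LR inf_vec - MI inf_vec" "\<phi> = u * (zi / xi) powi n"
    using order_decomposition[OF parameter_inf assms] by blast
  have "ord_at curve inf_pt (cls \<phi>) = n"
    using ord_at_eq[OF parameter_inf u] by (simp add: inf_pt_def)
  moreover have "fls_subdegree \<phi> = n"
    using unit_nz[OF parameter_inf u(1)] xi_nz zi_nz subdegree_ratios(2)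
    by (simp add: u(2) LR_inf_subdegree[OF u(1)] power_int_eq_0_iff)
  ultimately show ?thesis by simp
qed

lemma value_inf:
  assumes "\<phi> \<in> FF" "\<phi> = 0 \<or> fls_subdegree \<phi> \<ge> 0"
  shows "value_at inf_pt (cls \<phi>) = fls_nth \<phi> 0"
proof -
  have "\<phi> \<in> LR inf_vec"
  proof (cases "\<phi> = 0")
    case True
    then show ?thesis using LR_const[of 0] by simp
  next
    case False
    then have "ord_at curve inf_pt (cls \<phi>) \<ge> - int 0" using ord_inf assms by simp
    then show ?thesis
      using ord_at_ge_iff[OF parameter_inf assms(1) False, of 0] by (simp add: inf_pt_def)
  qed
  then obtain d A B where AB: "homogeneous d A" "homogeneous d B" "eval B inf_vec \<noteq> 0"
    "\<phi> = eval_fls A gen / eval_fls B gen" by (rule LR_E)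
  have \<phi>: "\<phi> = eval_fls A gen' / eval_fls B gen'" using AB LR_inf_gen' by simp
  have nth: "fls_nth (f * g) 0 = fls_nth f 0 * fls_nth g 0"
    if "fls_subdegree f \<ge> 0" "fls_subdegree g \<ge> 0" for f g :: "'a fls"
  proof -
    have "f * g = fps_to_fls (fls_regpart f * fls_regpart g)"
      using that by (simp add: fls_times_fps_to_fls)
    then show ?thesis by simp
  qed
  have "eval_fls B gen' \<noteq> 0" using AB(3) eval_gen'_nth0[of B] by auto
  then have "eval_fls A gen' = \<phi> * eval_fls B gen'" by (simp add: \<phi>)
  then have "eval A inf_vec = fls_nth \<phi> 0 * eval B inf_vec"
    using nth[of \<phi> "eval_fls B gen'"] eval_gen'_subdegree[of B] assms(2)
    by (auto simp: eval_gen'_nth0[symmetric])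
  then show ?thesis
    using value_at_eq[OF on_curve_inf AB(1-3)] AB by (simp add: inf_pt_def)
qed

end

section \<open>Counting\<close>

subsection \<open>Basis monomials with bounded poles\<close>

lemma sum_lessThan_id: "2 * (\<Sum>i<n. int i) = int n * (int n - 1)"
  by (induction n) (simp_all add: algebra_simps)

text \<open>
  Since the weights of the \<open>q^3\<close> monomials \<open>x^i y^j\<close> represent all residues modulo \<open>q^3\<close>, the
  sum of their quotients by \<open>q^3\<close>, rounded up, is determined by the sum of the weights. The
  assumption on \<open>M\<close> says that \<open>M q^3\<close> is at least \<open>2 g - 1\<close>; it makes the largest of these quotients
  at most \<open>M + 1\<close>.
\<close>

lemma (in gk) card_basis:
  assumes M: "q ^ 5 + q\<^sup>2 \<le> (M + 2) * q ^ 3 + 1"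
  shows "2 * int (card (basis (M * q ^ 3)))
    = 2 * int (q ^ 3) * (int M + 1) - (int q ^ 5 + int q ^ 2 - 2)"
proof -
  define e where "e = q ^ 3"
  define n where "n = q\<^sup>2 - q + 1"
  define I where "I = {..<q} \<times> {..<q\<^sup>2}"
  define a where "a = (\<lambda>(i, j). i * (e + 1) + j * (q * n))"
  define c where "c = (\<lambda>u. (a u + (e - 1)) div e)"
  define r where "r = (\<lambda>u. c u * e - a u)"
  have q0: "q > 0" and e0: "e > 0" using q_ge2 by (simp_all add: e_def)
  have nq: "int n = int q ^ 2 - int q + 1"
  proof -
    have "int (n + q) = int (q\<^sup>2 + 1)" using gk_exponents(2)[OF q_ge2] by (simp only: n_def)
    then show ?thesis by simp
  qed
  have ie: "int e = int q ^ 3" by (simp add: e_def)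
  have c: "a u \<le> c u * e \<and> c u * e < a u + e" for u
  proof -
    have "c u * e + (a u + (e - 1)) mod e = a u + (e - 1)"
      unfolding c_def by (rule div_mult_mod_eq)
    moreover have "(a u + (e - 1)) mod e < e" using e0 by simp
    ultimately show ?thesis using e0 by linarith
  qed
  have r_lt: "r u < e" and r: "int (r u) = int (c u) * int e - int (a u)" for u
    using c[of u] by (auto simp: r_def of_nat_diff simp flip: of_nat_mult)
  have wt: "gk_weight q i j k = a (i, j) + k * e" for i j k
    by (simp add: gk_weight_def a_def e_def n_def)
  have finI: "finite I" and cardI: "card I = e"
    by (simp_all add: I_def e_def power3_eq_cube power2_eq_square)
  have inj: "inj_on r I"
  proof (rule inj_onI)
    fix u v assume uv: "u \<in> I" "v \<in> I" "r u = r v"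
    obtain i j where u: "u = (i, j)" by (cases u)
    obtain i' j' where v: "v = (i', j')" by (cases v)
    have "a u + c v * e = a v + c u * e"
      using uv(3) c[of u] c[of v] unfolding r_def by linarith
    then have "gk_weight q i j (c v) = gk_weight q i' j' (c u)" by (simp add: wt u v)
    moreover have "i < q" "i' < q" "j < q\<^sup>2" "j' < q\<^sup>2" using uv(1,2) by (simp_all add: u v I_def)
    ultimately have "i = i' \<and> j = j' \<and> c v = c u" by (rule gk_weight_inj[OF q_ge2])
    then show "u = v" by (simp only: u v)
  qed
  have "r ` I = {..<e}"
  proof (rule card_subset_eq)
    show "r ` I \<subseteq> {..<e}" using r_lt by auto
    show "card (r ` I) = card {..<e}" by (simp add: card_image[OF inj] cardI)
  qed simp
  then have "(\<Sum>u\<in>I. int (r u)) = (\<Sum>k<e. int k)"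
    using sum.reindex[OF inj, of int] by simp
  then have sum_r: "2 * (\<Sum>u\<in>I. int (r u)) = int e * (int e - 1)"
    by (simp only: sum_lessThan_id)
  have "(\<Sum>u\<in>I. int (a u)) = (\<Sum>i<q. \<Sum>j<q\<^sup>2. int i * (int e + 1) + int j * (int q * int n))"
    unfolding I_def sum.cartesian_product by (intro sum.cong) (auto simp: a_def algebra_simps)
  also have "\<dots> = int (q\<^sup>2) * (int e + 1) * (\<Sum>i<q. int i)
      + int q * (int q * int n) * (\<Sum>j<q\<^sup>2. int j)"
    by (simp add: sum.distrib sum_distrib_right[symmetric] algebra_simps)
  finally have "2 * (\<Sum>u\<in>I. int (a u)) = int (q\<^sup>2) * (int e + 1) * (2 * (\<Sum>i<q. int i))
      + int q * (int q * int n) * (2 * (\<Sum>j<q\<^sup>2. int j))" by (simp add: algebra_simps)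
  then have sum_a: "2 * (\<Sum>u\<in>I. int (a u))
      = int e * ((int e + 1) * (int q - 1) + int q * int n * (int q ^ 2 - 1))"
    unfolding sum_lessThan_id
    by (simp add: e_def algebra_simps power2_eq_square power3_eq_cube)
  have "int e * (2 * (\<Sum>u\<in>I. int (c u))) = 2 * (\<Sum>u\<in>I. int (a u)) + 2 * (\<Sum>u\<in>I. int (r u))"
    by (simp add: r sum_subtractf sum_distrib_left algebra_simps)
  also have "\<dots> = int e * ((int e + 1) * (int q - 1) + int q * int n * (int q ^ 2 - 1) + (int e - 1))"
    unfolding sum_a sum_r by (simp add: algebra_simps)
  finally have "2 * (\<Sum>u\<in>I. int (c u))
      = (int e + 1) * (int q - 1) + int q * int n * (int q ^ 2 - 1) + (int e - 1)"
    using e0 by simp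
  also have "\<dots> = int q ^ 5 + int q ^ 2 - 2"
    unfolding nq ie
    by (simp add: algebra_simps power_numeral_reduce)
  finally have sum_c: "2 * (\<Sum>u\<in>I. int (c u)) = int q ^ 5 + int q ^ 2 - 2" .
  have cM: "c u \<le> M + 1" if u: "u \<in> I" for u
  proof -
    obtain i j where ij: "u = (i, j)" "i \<le> q - 1" "j \<le> q\<^sup>2 - 1"
      using u q0 by (cases u) (auto simp: I_def)
    have "a u \<le> (q - 1) * (e + 1) + (q\<^sup>2 - 1) * (q * n)"
      unfolding ij(1) a_def using ij(2,3) by (auto intro!: add_mono mult_le_mono1)
    then have "int (a u) \<le> int ((q - 1) * (e + 1) + (q\<^sup>2 - 1) * (q * n))" by (simp only: of_nat_le_iff)
    also have "\<dots> = (int q - 1) * (int e + 1) + (int q ^ 2 - 1) * (int q * int n)"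
    proof -
      have "int (q - 1) = int q - 1" "int (q\<^sup>2 - 1) = int q ^ 2 - 1"
        using q0 by (simp_all add: of_nat_diff)
      then show ?thesis by (simp only: of_nat_add of_nat_mult of_nat_1)
    qed
    also have "\<dots> = int q ^ 5 - int q ^ 3 + int q ^ 2 - 1" unfolding nq ie
    by (simp add: algebra_simps power_numeral_reduce)
    also have "\<dots> \<le> (int M + 1) * int e"
    proof -
      have "int (q ^ 5 + q\<^sup>2) \<le> int ((M + 2) * q ^ 3 + 1)" using M by (simp only: of_nat_le_iff)
      then show ?thesis by (simp add: ie algebra_simps)
    qed
    finally have "int (a u) \<le> int ((M + 1) * e)" by (simp add: algebra_simps)
    then have "a u \<le> (M + 1) * e" by (simp only: of_nat_le_iff)
    then have "c u * e < (M + 2) * e" using c[of u] by (simp add: algebra_simps)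
    then have "c u < M + 2" unfolding mult_less_cancel2 by blast
    then show ?thesis by simp
  qed
  have basis: "basis (M * q ^ 3) = (\<lambda>(u, k). (fst u, snd u, k)) ` (SIGMA u:I. {..<M + 1 - c u})"
  proof -
    have iff: "a u + k * e \<le> M * e \<longleftrightarrow> k < M + 1 - c u" for u k
    proof
      assume "a u + k * e \<le> M * e"
      then have "(c u + k) * e < (M + 1) * e" using c[of u] by (simp add: algebra_simps)
      then have "c u + k < M + 1" unfolding mult_less_cancel2 by blast
      then show "k < M + 1 - c u" by simp
    next
      assume "k < M + 1 - c u"
      then have "c u + k \<le> M" by simp
      then have "(c u + k) * e \<le> M * e" by (rule mult_le_mono1)
      then show "a u + k * e \<le> M * e" using c[of u] by (simp add: algebra_simps)
    qed
    have "basis (M * q ^ 3) = {(i, j, k). (i, j) \<in> I \<and> k < M + 1 - c (i, j)}"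
      unfolding basis_def wt e_def[symmetric] iff by (auto simp: I_def)
    then show ?thesis by (force simp: image_iff)
  qed
  have "inj_on (\<lambda>(u, k). (fst u, snd u, k)) (SIGMA u:I. {..<M + 1 - c u})"
    by (auto intro!: inj_onI prod_eqI)
  then have "card (basis (M * q ^ 3)) = (\<Sum>u\<in>I. M + 1 - c u)"
    unfolding basis by (subst card_image) (simp_all add: finI)
  then have "int (card (basis (M * q ^ 3))) = (\<Sum>u\<in>I. int M + 1 - int (c u))"
    using cM by (simp add: of_nat_diff add.commute)
  also have "\<dots> = int e * (int M + 1) - (\<Sum>u\<in>I. int (c u))"
    by (simp add: sum_subtractf cardI)
  finally have "2 * int (card (basis (M * q ^ 3)))
      = 2 * (int e * (int M + 1)) - 2 * (\<Sum>u\<in>I. int (c u))" by simp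
  then show ?thesis unfolding sum_c by (simp add: e_def)
qed

subsection \<open>Finite fields\<close>

lemma finite_field_power_card:
  fixes x :: "'k::{field, finite}"
  shows "x ^ CARD('k) = x"
proof (cases "x = 0")
  case False
  let ?U = "UNIV - {0 :: 'k}"
  have "bij_betw (\<lambda>y. x * y) ?U ?U"
    by (rule bij_betwI[where g = "\<lambda>y. y / x"]) (use False in auto)
  then have "(\<Prod>y\<in>?U. x * y) = (\<Prod>y\<in>?U. y)" by (rule prod.reindex_bij_betw)
  then have "x ^ card ?U * (\<Prod>y\<in>?U. y) = (\<Prod>y\<in>?U. y)" by (simp add: prod.distrib)
  moreover have "(\<Prod>y\<in>?U. y) \<noteq> 0" by simp
  ultimately have "x ^ card ?U = 1" by simp
  moreover have "CARD('k) = Suc (card ?U)" using card.remove[of UNIV "0 :: 'k"] by simp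
  ultimately show ?thesis by (metis power_Suc mult_1_right)
qed simp

lemma of_nat_card_finite_field: "of_nat CARD('k) = (0 :: 'k::{field, finite})"
proof -
  have "bij (\<lambda>y :: 'k. y + 1)" by (rule bij_betwI[where g = "\<lambda>y. y - 1"]) auto
  then have "(\<Sum>y\<in>UNIV. y + 1) = (\<Sum>y\<in>UNIV. y :: 'k)" by (rule sum.reindex_bij_betw)
  then show ?thesis by (simp add: sum.distrib)
qed

lemma finite_field_characteristic:
  assumes q: "primepow q" and card: "CARD('k::{field, finite}) = q ^ 6"
  obtains e where "prime CHAR('k)" "q = CHAR('k) ^ e"
proof -
  obtain p k where p: "prime p" "k > 0" "q = p ^ k" using q by (auto simp: primepow_def)
  have "(of_nat p :: 'k) ^ (k * 6) = 0"
    using of_nat_card_finite_field[where 'k = 'k] by (simp add: card p(3) power_mult)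
  then have "CHAR('k) dvd p" by (simp add: of_nat_eq_0_iff_char_dvd)
  moreover have "CHAR('k) \<noteq> 1" by simp
  ultimately have "CHAR('k) = p" using p(1) by (metis One_nat_def prime_nat_iff)
  then show ?thesis using that p by simp
qed

lemma range_to_ac_iff:
  fixes x :: "'k::{field, finite} alg_closure"
  shows "x \<in> range to_ac \<longleftrightarrow> x ^ CARD('k) = x"
proof -
  define P where "P = monom 1 CARD('k) - monom (1 :: 'k alg_closure) 1"
  have "{0, 1} \<subseteq> (UNIV :: 'k set)" by simp
  then have "card {0, 1 :: 'k} \<le> CARD('k)" by (intro card_mono) auto
  then have N: "CARD('k) \<ge> 2" by simp
  have "coeff P CARD('k) = 1" using N by (simp add: P_def)
  then have nz: "P \<noteq> 0" by auto
  have "degree P \<le> CARD('k)"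
    unfolding P_def using N by (intro degree_diff_le) (simp_all add: degree_monom_eq)
  then have "card {x. poly P x = 0} \<le> CARD('k)" using card_poly_roots_bound[OF nz] by linarith
  moreover have "{x. poly P x = 0} = {x. x ^ CARD('k) = x}"
    by (auto simp: P_def poly_monom)
  moreover have "range to_ac \<subseteq> {x :: 'k alg_closure. x ^ CARD('k) = x}"
    by (auto simp: finite_field_power_card simp flip: to_ac_power)
  moreover have "card (range (to_ac :: 'k \<Rightarrow> _)) = CARD('k)" by (rule card_image[OF inj_to_ac])
  moreover have "finite {x. poly P x = 0}" using nz by (rule poly_roots_finite)
  ultimately have "range to_ac = {x :: 'k alg_closure. x ^ CARD('k) = x}"
    by (intro card_seteq) auto
  then show ?thesis by blast
qed

subsection \<open>The planes that meet the curve in rational points\<close>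

text \<open>
  With \<open>U = c^(q^3 + 1)\<close>, the equation of \<open>\<Gamma>\<close> says that \<open>1 / U\<close> has trace \<open>0\<close> from the field with \<open>q^3\<close>
  elements to the field with \<open>q\<close> elements. For the other \<open>c \<noteq> 0\<close> the trace is a
  \<open>(q - 1)\<close>-th root of unity, so that these \<open>c\<close> are roots of a polynomial whose degree bounds their number.
\<close>

lemma card_Gamma0_ge:
  assumes q: "q \<ge> 2" and frob: "\<And>a b :: 'k. (a + b) ^ q = a ^ q + b ^ q"
    and card: "CARD('k::{field, finite}) = q ^ 6"
  shows "card (GK_Gamma0 q :: 'k set) + q ^ 3 \<ge> q ^ 5 + q\<^sup>2"
proof -
  define N where "N = q ^ 3 + 1"
  define P :: "'k poly" where "P = monom 1 (N * (q\<^sup>2 - 1)) + monom 1 (N * (q\<^sup>2 - q)) + 1"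
  define R where "R = P ^ (q - 1) - monom 1 (N * q\<^sup>2 * (q - 1))"
  have q2: "q < q\<^sup>2" "q\<^sup>2 > 1" using gk_exponents(3)[OF q] q by linarith+
  have N0: "N > 0" by (simp add: N_def)
  have P: "poly P c = c ^ (N * (q\<^sup>2 - 1)) + c ^ (N * (q\<^sup>2 - q)) + 1" for c
    by (simp add: P_def poly_monom)
  have Gamma: "c \<in> GK_Gamma q \<longleftrightarrow> poly P c = 0" for c by (simp add: GK_Gamma_def P N_def)
  have P0: "poly P 0 = 1" using N0 q2 by (simp add: P power_0_left)
  have "poly R 0 = 1" using N0 q2 q by (simp add: R_def P0 poly_monom power_0_left)
  then have R0: "R \<noteq> 0" by auto
  have "degree P \<le> N * q\<^sup>2"
    unfolding P_def
    by (intro degree_add_le order.trans[OF degree_monom_le]) (auto intro: mult_le_mono2)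
  then have "degree (P ^ (q - 1)) \<le> N * q\<^sup>2 * (q - 1)"
    by (intro order.trans[OF degree_power_le]) simp
  then have "degree R \<le> N * q\<^sup>2 * (q - 1)"
    unfolding R_def by (intro degree_diff_le degree_monom_le)
  then have cardR: "card {c. poly R c = 0} \<le> N * q\<^sup>2 * (q - 1)"
    using card_poly_roots_bound[OF R0] by linarith
  have cover: "UNIV \<subseteq> GK_Gamma0 q \<union> {c. poly R c = 0}"
  proof
    fix c :: 'k
    show "c \<in> GK_Gamma0 q \<union> {c. poly R c = 0}"
    proof (cases "c = 0 \<or> poly P c = 0")
      case True
      then show ?thesis by (auto simp: GK_Gamma0_def Gamma)
    next
      case False
      define U where "U = c ^ N"
      define V where "V = inverse U"
      define T where "T = V + V ^ q + V ^ (q\<^sup>2)"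
      have U0: "U \<noteq> 0" using False by (simp add: U_def)
      have c6: "c ^ (q ^ 6) = c" using finite_field_power_card[of c] by (simp add: card)
      have "U ^ (q ^ 3) = c ^ (q ^ 6) * c ^ (q ^ 3)"
        by (simp add: U_def N_def algebra_simps flip: power_mult power_add)
      then have "U ^ (q ^ 3) = U" by (simp add: c6 U_def N_def)
      then have V3: "V ^ (q ^ 3) = V" by (simp add: V_def power_inverse)
      have "V ^ (q\<^sup>2) ^ 1 = V ^ (q\<^sup>2)" by simp
      have "T ^ q = V ^ q + V ^ (q * q) + V ^ (q\<^sup>2 * q)"
        by (simp add: T_def frob flip: power_mult)
      also have "\<dots> = T" using V3 by (simp add: T_def power2_eq_square power3_eq_cube mult.assoc)
      finally have Tq: "T ^ q = T" .
      have TP: "T * U ^ (q\<^sup>2) = poly P c"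
      proof -
        have "V * U ^ (q\<^sup>2) = U ^ (q\<^sup>2 - 1)"
          using U0 q2 by (simp add: V_def power_diff field_simps)
        moreover have "V ^ q * U ^ (q\<^sup>2) = U ^ (q\<^sup>2 - q)"
          using U0 q2 by (simp add: V_def power_diff power_inverse field_simps)
        moreover have "V ^ (q\<^sup>2) * U ^ (q\<^sup>2) = 1" using U0 by (simp add: V_def power_inverse)
        ultimately show ?thesis by (simp add: T_def distrib_right P U_def power_mult)
      qed
      then have "T \<noteq> 0" using False by auto
      moreover have "T * T ^ (q - 1) = T" using Tq q by (cases q) simp_all
      ultimately have "T ^ (q - 1) = 1" by simp
      then have "poly P c ^ (q - 1) = (U ^ (q\<^sup>2)) ^ (q - 1)"
        by (simp add: TP[symmetric] power_mult_distrib)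
      then have "poly R c = 0"
        by (simp add: R_def poly_monom U_def poly_power power_mult)
      then show ?thesis by blast
    qed
  qed
  have "CARD('k) \<le> card (GK_Gamma0 q \<union> {c :: 'k. poly R c = 0})"
    by (rule card_mono[OF _ cover]) simp
  also have "\<dots> \<le> card (GK_Gamma0 q :: 'k set) + card {c :: 'k. poly R c = 0}" by (rule card_Un_le)
  finally have "q ^ 6 \<le> card (GK_Gamma0 q :: 'k set) + N * q\<^sup>2 * (q - 1)"
    using cardR card by linarith
  moreover have "N * q\<^sup>2 * (q - 1) + q ^ 5 + q\<^sup>2 = q ^ 6 + q ^ 3"
    using q by (cases q) (simp_all add: N_def algebra_simps power_numeral_reduce)
  ultimately show ?thesis by linarith
qed

text \<open>
  Every point \<open>(a, b, c)\<close> of the curve is rational if \<open>c \<in> \<Gamma>\<^sub>0\<close>. Put \<open>d = c^(q^2 - q + 1)\<close>. From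
  \<open>b^(q^2) = b + d\<close> one gets \<open>b^(q^6) = b + d + d^(q^2) + d^(q^4)\<close>, and then, from \<open>a^q = b^(q + 1) - a\<close>,
  that \<open>a - a^(q^6)\<close> is a quadratic expression in conjugates of \<open>d\<close>. With \<open>U = c^(q^3 + 1)\<close>
  both corrections are multiples of \<open>U^(q^2 - 1) + U^(q^2 - q) + 1\<close>.
\<close>

lemma fibre_rational:
  fixes a b c :: "'b::field"
  assumes q: "q \<ge> 2" and frob: "\<And>a b :: 'b. (a + b) ^ q = a ^ q + b ^ q"
    and c6: "c ^ (q ^ 6) = c" and c: "c \<in> GK_Gamma0 q" and rel: "gk_rel q a b c"
  shows "a ^ (q ^ 6) = a" and "b ^ (q ^ 6) = b"
proof -
  define n where "n = q\<^sup>2 - q + 1"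
  define F where "F = (\<lambda>x :: 'b. x ^ q)"
  have q2: "q < q\<^sup>2" "1 \<le> q\<^sup>2" using gk_exponents(3)[OF q] q by linarith+
  have F_add: "F (x + y) = F x + F y" and F_mult: "F (x * y) = F x * F y" for x y
    by (simp_all add: F_def frob power_mult_distrib)
  have F_diff: "F (x - y) = F x - F y" for x y
    using F_add[of "x - y" y] by simp
  have F2: "F (F x) = x ^ (q\<^sup>2)" and F3: "F (F (F x)) = x ^ (q ^ 3)"
    and F6: "F (F (F (F (F (F x))))) = x ^ (q ^ 6)" for x
    by (simp_all add: F_def power_numeral_reduce ac_simps flip: power_mult)
  define d where "d = c ^ n"
  have b2: "F (F b) = b + d" using rel by (simp add: F2 d_def n_def gk_rel_def)
  have a1: "F a = b * F b - a" using rel by (simp add: F_def gk_rel_def)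
  have key: "d + F (F d) + F (F (F (F d))) = 0 \<and>
    d * F d + d * F (F (F d)) + F (F d) * F (F (F d)) = 0"
  proof (cases "c = 0")
    case True
    then have "d = 0" by (simp add: d_def n_def)
    moreover have "F 0 = 0" using q by (simp add: F_def)
    ultimately show ?thesis by simp
  next
    case False
    define U where "U = c ^ (q ^ 3 + 1)"
    have U0: "U \<noteq> 0" using False by (simp add: U_def)
    have Gam: "U ^ (q\<^sup>2 - 1) + U ^ (q\<^sup>2 - q) + 1 = 0"
    proof -
      have "c \<in> GK_Gamma q" using c False by (simp add: GK_Gamma0_def)
      then show ?thesis by (simp only: GK_Gamma_def U_def mem_Collect_eq power_mult)
    qed
    have "U ^ (q ^ 3) = c ^ (q ^ 6) * c ^ (q ^ 3)"
      by (simp add: U_def algebra_simps flip: power_mult power_add)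
    then have U3: "U ^ (q ^ 3) = U" by (simp add: c6 U_def)
    have dU: "d * F d = U"
    proof -
      have "d * F d = d ^ (q + 1)" by (simp add: F_def)
      then show ?thesis
        unfolding d_def U_def gk_exponents(1)[OF q, symmetric] n_def by (simp only: power_mult)
    qed
    have d3: "d * F (F (F d)) = U ^ n"
    proof -
      have "d * F (F (F d)) = d ^ (q ^ 3 + 1)" by (simp add: F3)
      also have "\<dots> = U ^ n"
        unfolding d_def U_def by (simp only: power_mult[symmetric] mult.commute)
      finally show ?thesis .
    qed
    have d23: "F (F d) * F (F (F d)) = U ^ (q\<^sup>2)"
    proof -
      have "F (F d) * F (F (F d)) = F (F (d * F d))" by (simp only: F_mult)
      then show ?thesis by (simp only: dU F2)
    qed
    have UU: "U * U ^ (q\<^sup>2 - 1) = U ^ (q\<^sup>2)" "U * U ^ (q\<^sup>2 - q) = U ^ n"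
    proof -
      have "Suc (q\<^sup>2 - 1) = q\<^sup>2" "Suc (q\<^sup>2 - q) = n" using q2 by (simp_all add: n_def)
      then show "U * U ^ (q\<^sup>2 - 1) = U ^ (q\<^sup>2)" "U * U ^ (q\<^sup>2 - q) = U ^ n" by (metis power_Suc)+
    qed
    have "U + U ^ n + U ^ (q\<^sup>2) = U * (U ^ (q\<^sup>2 - 1) + U ^ (q\<^sup>2 - q) + 1)"
      by (simp only: distrib_left UU mult_1_right) (simp only: ac_simps)
    then have second: "d * F d + d * F (F (F d)) + F (F d) * F (F (F d)) = 0"
      unfolding dU d3 d23 Gam by simp
    have FU: "F U = U ^ q" by (simp add: F_def)
    \<comment> \<open>Since \<open>U = d^(q + 1)\<close>, \<open>d^(q^2) U = d U^q\<close>, and hence \<open>d^(q^4) U^(q^2) = d U^q\<close>.\<close>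
    have e2: "F (F d) * U = d * F U"
      unfolding dU[symmetric] F_mult by (simp only: ac_simps)
    have "F (F (F (F d))) * F (F U) = F (F d) * F (F (F U))"
      using arg_cong[OF e2, of "\<lambda>x. F (F x)"] by (simp only: F_mult)
    then have e4: "F (F (F (F d))) * F (F U) = d * F U"
      using e2 by (simp only: F3[of U] U3)
    have "U * F (F U) * (d + F (F d) + F (F (F (F d))))
        = d * (U * F (F U) + F U * F (F U) + U * F U)"
    proof -
      have "U * F (F U) * (d + F (F d) + F (F (F (F d))))
        = d * (U * F (F U)) + (F (F d) * U) * F (F U) + U * (F (F (F (F d))) * F (F U))"
        by (simp only: distrib_left distrib_right ac_simps)
      then show ?thesis unfolding e2 e4 by (simp only: distrib_left ac_simps)
    qed
    also have "U * F (F U) + F U * F (F U) + U * F U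
        = U * F U * (U ^ (q\<^sup>2 - q) + U ^ (q\<^sup>2 - 1) + 1)"
    proof -
      have "U ^ (q\<^sup>2 - q) * F U = U ^ (q\<^sup>2)" unfolding FU using q2 by (simp flip: power_add)
      moreover have "U * U ^ (q\<^sup>2 - 1) = U ^ (q\<^sup>2)" by (rule UU)
      moreover have "U * F U * (u + w + 1) = U * (u * F U) + F U * (U * w) + U * F U" for u w
        by (simp add: algebra_simps)
      ultimately show ?thesis unfolding F2 by simp
    qed
    also have "U ^ (q\<^sup>2 - q) + U ^ (q\<^sup>2 - 1) + 1 = 0" using Gam by (simp only: ac_simps)
    finally have "d + F (F d) + F (F (F (F d))) = 0" using U0 by (simp add: F_def)
    then show ?thesis using second by blast
  qed
  have b6: "F (F (F (F (F (F b))))) = b"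
    using conjunct1[OF key] by (simp add: b2 F_add add.assoc)
  then show "b ^ (q ^ 6) = b" by (simp only: F6)
  define y1 d1 d2 d3 where "y1 = F b" and "d1 = F d" and "d2 = F (F d)" and "d3 = F (F (F d))"
  have y: "F b = y1" "F y1 = b + d" "F d = d1" "F d1 = d2" "F d2 = d3"
    by (simp_all add: y1_def d1_def d2_def d3_def b2)
  have yd: "F (y1 + d1 + d3) = b"
    using b6 by (simp add: y F_add)
  have yd': "b + d + d2 + F d3 = b" using yd by (simp add: y F_add)
  have "F (F (F (F (F (F a))))) = a + (d * d1 + d * d3 + d2 * d3) * (-1)"
    by (simp add: a1 F_diff F_mult F_add y yd') (simp add: algebra_simps)
  then have "F (F (F (F (F (F a))))) = a"
    using conjunct2[OF key] by (simp add: d1_def d2_def d3_def)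
  then show "a ^ (q ^ 6) = a" by (simp only: F6)
qed

section \<open>The functional code\<close>

lemma lookup_sum_single:
  assumes "finite A"
  shows "Poly_Mapping.lookup (\<Sum>P\<in>A. Poly_Mapping.single P a) Q = (if Q \<in> A then a else 0)"
  using assms by (simp add: lookup_sum lookup_single when_def)

lemma sum_fun_apply: "(\<Sum>i\<in>I. f i) x = (\<Sum>i\<in>I. f i x :: 'b::comm_monoid_add)"
  by (induction I rule: infinite_finite_induct) (simp_all add: zero_fun_def plus_fun_def)

lemma rat_0 [simp]: "(0 :: 'k::field alg_closure) \<in> range to_ac"
  and rat_1 [simp]: "(1 :: 'k alg_closure) \<in> range to_ac"
  using to_ac_0 to_ac_1 by (metis rangeI)+

lemma rat_add: "a \<in> range to_ac \<Longrightarrow> b \<in> range to_ac \<Longrightarrow> a + b \<in> range to_ac"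
  by (auto simp flip: to_ac_add)

lemma rat_uminus: "a \<in> range to_ac \<Longrightarrow> - a \<in> range to_ac"
  by (auto simp flip: to_ac_minus)

lemma rat_diff: "a \<in> range to_ac \<Longrightarrow> b \<in> range to_ac \<Longrightarrow> a - b \<in> range to_ac"
  by (auto simp flip: to_ac_diff)

lemma rat_mult: "a \<in> range to_ac \<Longrightarrow> b \<in> range to_ac \<Longrightarrow> a * b \<in> range to_ac"
  by (auto simp flip: to_ac_mult)

lemma rat_divide: "a \<in> range to_ac \<Longrightarrow> b \<in> range to_ac \<Longrightarrow> a / b \<in> range to_ac"
  by (auto simp flip: to_ac_divide)

lemma rat_power: "a \<in> range to_ac \<Longrightarrow> a ^ n \<in> range to_ac"
  by (auto simp flip: to_ac_power)

lemma rat_prod: "(\<And>i. i \<in> I \<Longrightarrow> f i \<in> range to_ac) \<Longrightarrow> prod f I \<in> range to_ac"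
  by (induction I rule: infinite_finite_induct) (simp_all add: rat_mult)

context gk
begin

lemma polyfun_in_loc:
  assumes "g \<in> PF"
  shows "g xi yi zi \<in> loc a b c"
proof -
  have "pval (\<lambda>x y z. fls_const 1) a b c \<noteq> 0" by (simp only: pval_const) simp
  then show ?thesis
    unfolding loc_def mem_Collect_eq
    by (intro exI[of _ g] exI[of _ "\<lambda>x y z. fls_const 1"] conjI assms polyfun_const) simp_all
qed

lemma loc_mult:
  assumes "gk_rel q a b c" "\<phi> \<in> loc a b c" "\<psi> \<in> loc a b c"
  shows "\<phi> * \<psi> \<in> loc a b c"
  using LR_mult[OF on_curve_affine[OF assms(1)]] assms by (simp add: LR_affine)

lemma polyfun_subdegree_le:
  assumes g: "g \<in> PF" and nz: "g xi yi zi \<noteq> 0"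
  shows "fls_subdegree (g xi yi zi) \<le> 0"
proof (rule ccontr)
  assume pos: "\<not> fls_subdegree (g xi yi zi) \<le> 0"
  then obtain c where "\<And>x y z. gk_rel q x y z \<Longrightarrow>
      g x y z = (\<Sum>(i, j, k)\<in>basis 0. fls_const (c (i, j, k)) * (x ^ i * y ^ j * z ^ k))"
    using basis_expansion[OF g, of 0] by auto
  then have "g xi yi zi = (\<Sum>(i, j, k)\<in>basis 0. fls_const (c (i, j, k)) * (xi ^ i * yi ^ j * zi ^ k))"
    using rel_inf by blast
  also have "\<dots> = (\<Sum>(i, j, k)\<in>basis 0. fls_const (c (i, j, k)))"
    using q_ge2 by (intro sum.cong refl) (auto simp: basis_def gk_weight_def)
  also have "\<dots> = fls_const (\<Sum>u\<in>basis 0. c u)" by (simp add: fls_const_sum case_prod_unfold)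
  finally show False using pos by simp
qed

lemma fibres_divisible:
  assumes "finite S" and "g \<in> PF"
    and "\<And>a b d. d \<in> S \<Longrightarrow> gk_rel q a b d \<Longrightarrow> pval g a b d = 0"
  shows "\<exists>g'\<in>PF. g xi yi zi = (\<Prod>d\<in>S. zi - fls_const d) * g' xi yi zi"
  using assms
proof (induction S arbitrary: g rule: finite_induct)
  case empty
  then show ?case by auto
next
  case (insert d S)
  obtain g1 where g1: "g1 \<in> PF"
    "\<And>x y z. gk_rel q x y z \<Longrightarrow> g x y z = (z - fls_const d) * g1 x y z"
    using fibre_divisible[OF insert.prems(1), of d] insert.prems(2) by blast
  have "pval g1 a b d' = 0" if d': "d' \<in> S" and rel: "gk_rel q a b d'" for a b d'
  proof -
    have "0 = g (fls_const a) (fls_const b) (fls_const d')"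
      using insert.prems(2)[OF _ rel] d' fls_const_pval[OF insert.prems(1), of a b d'] by simp
    also have "\<dots> = (fls_const d' - fls_const d) * g1 (fls_const a) (fls_const b) (fls_const d')"
      using g1(2) rel by (simp add: gk_rel_fls_const)
    finally have "g1 (fls_const a) (fls_const b) (fls_const d') = 0"
      using d' insert.hyps(2) by (auto simp: fls_const_eq_iff)
    then show ?thesis by (simp add: pval_def)
  qed
  then obtain g' where "g' \<in> PF" "g1 xi yi zi = (\<Prod>d\<in>S. zi - fls_const d) * g' xi yi zi"
    using insert.IH[OF g1(1)] by blast
  then show ?case using g1(2)[OF rel_inf] insert.hyps by (auto simp: mult.assoc)
qed

end

text \<open>The data of the code, on top of the curve over the algebraic closure of \<open>'k\<close>.\<close>

locale gk_code = gk q e xi yi zi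
  for q e :: nat and xi yi zi :: "'k::{field, finite} alg_closure fls" +
  fixes m s :: nat and c :: "nat \<Rightarrow> 'k"
  assumes card_k: "CARD('k) = q ^ 6"
    and c_inj: "inj_on c {0..s}" and c_Gamma: "c ` {0..s} \<subseteq> GK_Gamma0 q"
    and upper: "(m + 1) * (s + 1) + q ^ 3 \<le> q ^ 5 + q\<^sup>2"
begin

text \<open>The base field inside its algebraic closure.\<close>

abbreviation base :: "'k alg_closure set" where "base \<equiv> range to_ac"

abbreviation N :: nat where "N \<equiv> m * (s + 1) * q ^ 3"

text \<open>
  The support of \<open>G\<close> (for \<open>m > 0\<close>), the set of the evaluation points, and the two divisors.
\<close>

definition poles :: "('k alg_closure, 4) point set" where
  "poles = {affine_pt a b (to_ac (c i)) | a b i. i \<le> s \<and> gk_rel q a b (to_ac (c i))}"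

definition evals :: "('k alg_closure, 4) point set" where
  "evals = rational_points curve - poles"

definition G :: "('k alg_closure, 4) divisor" where
  "G = (\<Sum>P\<in>poles. Poly_Mapping.single P (int m))"

definition D :: "('k alg_closure, 4) divisor" where
  "D = (\<Sum>P\<in>evals. Poly_Mapping.single P 1)"

text \<open>
  The denominator \<open>(\<Prod>i. z - c i)^m\<close>, whose divisor of zeros is \<open>G\<close>, and the combination of the basis
  monomials of weight at most \<open>N\<close> with coefficients \<open>co\<close>.
\<close>

definition den :: "'k alg_closure fls \<Rightarrow> 'k alg_closure fls \<Rightarrow> 'k alg_closure fls \<Rightarrow> 'k alg_closure fls"
  where "den x y z = (\<Prod>i\<in>{0..s}. z + fls_const (to_ac (- c i))) ^ m"

definition num :: "(nat \<times> nat \<times> nat \<Rightarrow> 'k) \<Rightarrow>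
    'k alg_closure fls \<Rightarrow> 'k alg_closure fls \<Rightarrow> 'k alg_closure fls \<Rightarrow> 'k alg_closure fls"
  where "num co x y z = (\<Sum>(i, j, k)\<in>basis N. fls_const (to_ac (co (i, j, k))) * (x ^ i * y ^ j * z ^ k))"

lemma den_factor: "z + fls_const (to_ac (- c i)) = z - fls_const (to_ac (c i))"
  by (simp flip: fls_const_uminus)

lemma den_eq: "den x y z = (\<Prod>i\<in>{0..s}. z - fls_const (to_ac (c i))) ^ m"
  by (simp only: den_def den_factor)

lemma den_rat: "den \<in> polyfun base"
proof -
  have "(\<lambda>x y z. (\<Prod>i\<in>{0..s}. z + fls_const (to_ac (- c i))) ^ m) \<in> polyfun base"
    by (intro polyfun_power polyfun_prod polyfun.add polyfun_Z polyfun_const)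
       (auto intro: rat_mult rat_uminus)
  then show ?thesis by (simp add: den_def[abs_def])
qed

lemma den_PF: "den \<in> PF"
  using den_rat by (rule polyfun_UNIV)

lemma num_rat: "num co \<in> polyfun base"
proof -
  have "(\<lambda>x y z. \<Sum>u\<in>basis N. fls_const (to_ac (co (fst u, fst (snd u), snd (snd u)))) *
      (x ^ fst u * y ^ fst (snd u) * z ^ snd (snd u))) \<in> polyfun base"
    by (intro polyfun_sum polyfun.monomial) auto
  then show ?thesis by (simp add: num_def[abs_def] case_prod_unfold)
qed

lemma num_PF: "num co \<in> PF"
  using num_rat by (rule polyfun_UNIV)

lemma num_inf: "num co xi yi zi = (\<Sum>u\<in>basis N. fls_const (to_ac (co u)) * mono_inf u)"
  by (simp add: num_def case_prod_unfold)

lemma pval_den: "pval den a b z = (\<Prod>i\<in>{0..s}. z - to_ac (c i)) ^ m"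
proof -
  have "fls_const (pval den a b z) = fls_const ((\<Prod>i\<in>{0..s}. z - to_ac (c i)) ^ m)"
    unfolding fls_const_pval[OF den_PF] den_eq
    by (simp add: fls_const_prod fls_const_diff fls_const_power)
  then show ?thesis by (simp only: fls_const_eq_iff)
qed

lemma pval_num: "pval (num co) a b z = (\<Sum>(i, j, k)\<in>basis N. to_ac (co (i, j, k)) * (a ^ i * b ^ j * z ^ k))"
proof -
  have "fls_const (pval (num co) a b z)
      = fls_const (\<Sum>(i, j, k)\<in>basis N. to_ac (co (i, j, k)) * (a ^ i * b ^ j * z ^ k))"
    unfolding fls_const_pval[OF num_PF] num_def
    by (simp add: fls_const_sum case_prod_unfold flip: fls_const_power)
  then show ?thesis by (simp only: fls_const_eq_iff)
qed

lemma zi_const_lead: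
  "fls_subdegree (zi - fls_const a) = - int (q ^ 3)"
  "fls_nth (zi - fls_const a) (- int (q ^ 3)) = 1"
proof -
  have q3: "int (q ^ 3) > 0" using q_ge2 by simp
  show nth: "fls_nth (zi - fls_const a) (- int (q ^ 3)) = 1"
    using zi(2) q3 by simp
  show "fls_subdegree (zi - fls_const a) = - int (q ^ 3)"
  proof (rule fls_subdegree_eqI)
    show "fls_nth (zi - fls_const a) (- int (q ^ 3)) \<noteq> 0" using nth by simp
    fix k assume k: "k < - int (q ^ 3)"
    then have "k \<noteq> 0" using q3 by linarith
    then have "fls_nth (fls_const a) k = 0" by simp
    moreover have "fls_nth zi k = 0" using zi(1) k by simp
    ultimately show "fls_nth (zi - fls_const a) k = 0" by (simp only: fls_minus_nth diff_self)
  qed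
qed

lemma lead_mult:
  fixes f g :: "'k alg_closure fls"
  assumes "fls_nth f a = 1" "fls_subdegree f = a" "fls_nth g b = 1" "fls_subdegree g = b"
  shows "fls_nth (f * g) (a + b) = 1 \<and> fls_subdegree (f * g) = a + b"
proof -
  have "f \<noteq> 0" "g \<noteq> 0" using assms by auto
  moreover have "fls_nth (f * g) (a + b) = 1"
    using fls_times_base[of f g] by (simp only: assms mult_1_left)
  ultimately show ?thesis using assms by simp
qed

lemma lead_power:
  fixes f :: "'k alg_closure fls"
  assumes "fls_nth f a = 1" "fls_subdegree f = a"
  shows "fls_nth (f ^ n) (int n * a) = 1 \<and> fls_subdegree (f ^ n) = int n * a"
proof (induction n)
  case (Suc n)
  then show ?case using lead_mult[OF assms, of "f ^ n" "int n * a"]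
    by (simp add: algebra_simps)
qed simp

lemma lead_prod:
  fixes f :: "nat \<Rightarrow> 'k alg_closure fls"
  assumes "finite I" "\<And>i. i \<in> I \<Longrightarrow> fls_nth (f i) a = 1 \<and> fls_subdegree (f i) = a"
  shows "fls_nth (prod f I) (int (card I) * a) = 1 \<and> fls_subdegree (prod f I) = int (card I) * a"
  using assms
proof (induction I rule: finite_induct)
  case (insert i I)
  then show ?case using lead_mult[of "f i" a "prod f I" "int (card I) * a"]
    by (simp add: algebra_simps)
qed simp

lemma den_inf: "fls_nth (den xi yi zi) (- int N) = 1" "fls_subdegree (den xi yi zi) = - int N"
proof -
  have "fls_nth (\<Prod>i\<in>{0..s}. zi - fls_const (to_ac (c i))) (int (card {0..s}) * - int (q ^ 3)) = 1 \<and>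
    fls_subdegree (\<Prod>i\<in>{0..s}. zi - fls_const (to_ac (c i))) = int (card {0..s}) * - int (q ^ 3)"
    by (intro lead_prod conjI zi_const_lead finite_atLeastAtMost)
  then have "fls_nth (den xi yi zi) (int m * (int (card {0..s}) * - int (q ^ 3))) = 1 \<and>
    fls_subdegree (den xi yi zi) = int m * (int (card {0..s}) * - int (q ^ 3))"
    unfolding den_eq by (intro lead_power) blast+
  moreover have "int m * (int (card {0..s}) * - int (q ^ 3)) = - int N"
    by (simp add: algebra_simps)
  ultimately show "fls_nth (den xi yi zi) (- int N) = 1" "fls_subdegree (den xi yi zi) = - int N"
    by (simp_all only:)
qed

lemma den_nz: "den xi yi zi \<noteq> 0"
  using den_inf by auto

lemma mono_inf_lead:
  "fls_nth (xi ^ i * yi ^ j * zi ^ k) (- int (gk_weight q i j k)) = 1"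
proof -
  have "fls_nth (xi ^ i * yi ^ j * zi ^ k) (int i * - int (q ^ 3 + 1) +
    int j * - int (q * (q\<^sup>2 - q + 1)) + int k * - int (q ^ 3)) = 1"
    using lead_mult[OF conjunct1[OF lead_power[OF xi(2,1), of i]] conjunct2[OF lead_power[OF xi(2,1), of i]]
        conjunct1[OF lead_power[OF yi(2,1), of j]] conjunct2[OF lead_power[OF yi(2,1), of j]]]
      lead_mult[OF _ _ conjunct1[OF lead_power[OF zi(2,1), of k]] conjunct2[OF lead_power[OF zi(2,1), of k]]]
    by blast
  moreover have "int i * - int (q ^ 3 + 1) + int j * - int (q * (q\<^sup>2 - q + 1)) + int k * - int (q ^ 3)
      = - int (gk_weight q i j k)"
    unfolding gk_weight_def of_nat_add of_nat_mult[of i] of_nat_mult[of j] of_nat_mult[of k]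
    by (simp only: mult_minus_right minus_add_distrib) (simp add: algebra_simps)
  ultimately show ?thesis by simp
qed

text \<open>The quotients by \<open>den\<close> of the basis monomials have rational values at infinity.\<close>

lemma mono_den_value:
  assumes u: "u \<in> basis N"
  shows "fls_nth (mono_inf u / den xi yi zi) 0 \<in> base"
proof -
  obtain i j k where ijk: "u = (i, j, k)" by (metis prod_cases3)
  let ?f = "mono_inf u / den xi yi zi"
  have nz: "mono_inf u \<noteq> 0" by (rule mono_inf_nz)
  have sd: "fls_subdegree ?f = int N - int (gk_weight q i j k)"
    using fls_divide_subdegree[OF nz den_nz] by (simp add: ijk mono_inf_subdegree den_inf)
  have le: "gk_weight q i j k \<le> N" using u by (simp add: basis_def ijk)
  show ?thesis
  proof (cases "gk_weight q i j k = N")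
    case True
    have "?f * den xi yi zi = mono_inf u" using den_nz by simp
    then have "fls_nth (?f * den xi yi zi) (- int N) = 1"
      using mono_inf_lead[of i j k] True by (simp only: ijk case_prod_conv)
    moreover have "fls_subdegree ?f + fls_subdegree (den xi yi zi) = - int N"
      unfolding sd den_inf(2) True by simp
    ultimately have "fls_nth ?f (fls_subdegree ?f) * fls_nth (den xi yi zi) (- int N) = 1"
      using fls_times_base[of ?f "den xi yi zi"] by (simp only: den_inf(2))
    then have "fls_nth ?f 0 = 1" unfolding den_inf(1) sd True by simp
    then show ?thesis by (simp only: rat_1)
  next
    case False
    then have "gk_weight q i j k < N" using le by (rule le_neq_implies_less[rotated])
    then have "int (gk_weight q i j k) < int N" by (simp only: of_nat_less_iff)
    then have "0 < fls_subdegree ?f" unfolding sd by linarith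
    then show ?thesis by simp
  qed
qed

lemma frob_rat: "a \<in> base \<Longrightarrow> a ^ (q ^ 6) = (a :: 'k alg_closure)"
  using range_to_ac_iff[of a] card_k by simp

lemma frob1: "(a + b :: 'k alg_closure) ^ q = a ^ q + b ^ q"
  using frobenius[of a b 1] by simp

lemma frob1_k: "(a + b :: 'k) ^ q = a ^ q + b ^ q"
proof -
  have "to_ac ((a + b) ^ q) = to_ac (a ^ q + b ^ q)" using frob1 by simp
  then show ?thesis by (simp only: to_ac_eq_iff)
qed

lemma to_ac_Gamma0:
  fixes d :: 'k
  assumes "d \<in> GK_Gamma0 q"
  shows "to_ac d \<in> GK_Gamma0 q"
proof (cases "d = 0")
  case False
  then have "d \<in> GK_Gamma q" using assms by (simp add: GK_Gamma0_def)
  then have "to_ac (d ^ ((q ^ 3 + 1) * (q\<^sup>2 - 1)) + d ^ ((q ^ 3 + 1) * (q\<^sup>2 - q)) + 1) = to_ac 0"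
    by (simp only: GK_Gamma_def mem_Collect_eq)
  then have "to_ac d \<in> GK_Gamma q"
    by (simp only: GK_Gamma_def mem_Collect_eq to_ac_add to_ac_power to_ac_0 to_ac_1)
  then show ?thesis by (simp add: GK_Gamma0_def)
qed (simp add: GK_Gamma0_def)

lemma fibre_points_rational:
  fixes d :: 'k
  assumes "d \<in> GK_Gamma0 q" "gk_rel q a b (to_ac d)"
  shows "a \<in> base" "b \<in> base"
  using fibre_rational[OF q_ge2 frob1 frob_rat[OF rangeI] to_ac_Gamma0[OF assms(1)] assms(2)] card_k
  by (simp_all add: range_to_ac_iff)

lemma affine_rational_iff:
  "affine_pt a b z \<in> rational_points curve \<longleftrightarrow>
    affine_pt a b z \<in> curve \<and> a \<in> base \<and> b \<in> base \<and> z \<in> base"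
proof
  assume "affine_pt a b z \<in> rational_points curve"
  then obtain v :: "'k alg_closure ^ 4" where
    v: "affine_pt a b z \<in> curve" "v \<in> affine_pt a b z" "\<And>i. v $ i \<in> base"
    by (auto simp: rational_points_def)
  obtain u where u: "u \<noteq> 0" "v = u *s vector [a, b, z, 1]"
    using v(2) unfolding affine_pt_def in_pt_iff[OF affine_vec_nz] by blast
  have "a = v $ 1 / v $ 4" "b = v $ 2 / v $ 4" "z = v $ 3 / v $ 4" using u by simp_all
  then show "affine_pt a b z \<in> curve \<and> a \<in> base \<and> b \<in> base \<and> z \<in> base"
    using v rat_divide by metis
next
  assume *: "affine_pt a b z \<in> curve \<and> a \<in> base \<and> b \<in> base \<and> z \<in> base"
  have "vector [a, b, z, 1] \<in> affine_pt a b z" unfolding affine_pt_def by (rule self_in_pt) simp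
  moreover have "\<forall>i. (vector [a, b, z, 1] :: 'k alg_closure ^ 4) $ i \<in> base" using * by (simp add: forall_4)
  ultimately show "affine_pt a b z \<in> rational_points curve" using * unfolding rational_points_def by blast
qed

lemma inf_rational: "inf_pt \<in> rational_points curve"
proof -
  have "vector [1, 0, 0, 0] \<in> (inf_pt :: ('k alg_closure, 4) point)"
    unfolding inf_pt_def by (rule self_in_pt) simp
  moreover have "\<forall>i. (vector [1, 0, 0, 0] :: 'k alg_closure ^ 4) $ i \<in> base" by (simp add: forall_4)
  ultimately show ?thesis using inf_pt_in_curve unfolding rational_points_def by blast
qed

lemma finite_rational_points: "finite (rational_points curve)"
proof (rule finite_subset)
  show "rational_points curve \<subseteq> insert inf_pt ((\<lambda>(a, b, z). affine_pt a b z) ` (base \<times> base \<times> base))"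
  proof
    fix P assume P: "P \<in> rational_points curve"
    then have "P \<in> curve" by (simp add: rational_points_def)
    then show "P \<in> insert inf_pt ((\<lambda>(a, b, z). affine_pt a b z) ` (base \<times> base \<times> base))"
    proof (cases rule: curve_cases)
      case (affine a b z)
      then have "(a, b, z) \<in> base \<times> base \<times> base" using P affine_rational_iff by blast
      then show ?thesis unfolding affine(2) by (intro insertI2 image_eqI[of _ _ "(a, b, z)"]) simp_all
    qed simp
  qed
qed simp

lemma poles_iff: "affine_pt a b z \<in> poles \<longleftrightarrow> gk_rel q a b z \<and> (\<exists>i\<le>s. z = to_ac (c i))"
  by (auto simp: poles_def affine_pt_eq_iff)

lemma inf_notin_poles: "inf_pt \<notin> poles"
  using affine_pt_neq_inf by (auto simp: poles_def dest: sym)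

lemma poles_rational: "poles \<subseteq> rational_points curve"
proof
  fix P assume "P \<in> poles"
  then obtain a b i where P: "P = affine_pt a b (to_ac (c i))" "i \<le> s" "gk_rel q a b (to_ac (c i))"
    by (auto simp: poles_def)
  have "c i \<in> GK_Gamma0 q" using c_Gamma P(2) by auto
  then show "P \<in> rational_points curve"
    using fibre_points_rational[OF _ P(3)] affine_pt_in_curve[OF P(3)]
    by (simp add: P(1) affine_rational_iff)
qed

lemma finite_poles: "finite poles"
  using poles_rational finite_rational_points by (rule finite_subset)

lemma finite_evals: "finite evals"
  using finite_rational_points by (simp add: evals_def)

lemma lookup_G: "Poly_Mapping.lookup G P = (if P \<in> poles then int m else 0)"
  unfolding G_def by (rule lookup_sum_single[OF finite_poles])

lemma keys_D: "Poly_Mapping.keys D = evals"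
  by (auto simp: in_keys_iff D_def lookup_sum_single[OF finite_evals] split: if_splits)

lemma inf_in_evals: "inf_pt \<in> evals"
  using inf_rational inf_notin_poles by (simp add: evals_def)

lemma affine_in_evals_iff:
  assumes "gk_rel q a b z"
  shows "affine_pt a b z \<in> evals \<longleftrightarrow> a \<in> base \<and> b \<in> base \<and> z \<in> base \<and> (\<forall>i\<le>s. z \<noteq> to_ac (c i))"
  using affine_pt_in_curve[OF assms] assms by (auto simp: evals_def affine_rational_iff poles_iff)

lemma pval_den_nz: "(\<forall>i\<le>s. z \<noteq> to_ac (c i)) \<Longrightarrow> pval den a b z \<noteq> 0"
  by (auto simp: pval_den)

subsection \<open>The Riemann-Roch space\<close>

lemma quotient_in_FF: "num co xi yi zi / den xi yi zi \<in> FF"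
  by (rule FF_I[OF refl num_PF den_PF den_nz])

lemma den_split:
  assumes "i \<le> s"
  obtains h where "h \<in> PF"
    "\<And>x y z. den x y z = (z - fls_const (to_ac (c i))) ^ m * h x y z"
    "\<And>a b. pval h a b (to_ac (c i)) \<noteq> 0"
proof -
  define h where "h = (\<lambda>(x :: 'k alg_closure fls) (y :: 'k alg_closure fls) z. (\<Prod>j\<in>{0..s} - {i}. z - fls_const (to_ac (c j))) ^ m
    :: 'k alg_closure fls)"
  show ?thesis
  proof
    have "(\<lambda>x y z. (\<Prod>j\<in>{0..s} - {i}. z - fls_const (to_ac (c j))) ^ m) \<in> PF"
      by (intro polyfun_power polyfun_prod polyfun_diff polyfun_Z polyfun_const) auto
    then show h: "h \<in> PF" by (simp add: h_def)
    show "den x y z = (z - fls_const (to_ac (c i))) ^ m * h x y z" for x y z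
      using assms by (simp add: den_eq h_def prod.remove[of "{0..s}" i] power_mult_distrib)
    show "pval h a b (to_ac (c i)) \<noteq> 0" for a b
    proof -
      have "fls_const (pval h a b (to_ac (c i)))
          = fls_const ((\<Prod>j\<in>{0..s} - {i}. to_ac (c i) - to_ac (c j)) ^ m)"
        by (subst fls_const_pval[OF h]) (simp add: h_def fls_const_prod fls_const_diff fls_const_power)
      then have "pval h a b (to_ac (c i)) = (\<Prod>j\<in>{0..s} - {i}. to_ac (c i) - to_ac (c j)) ^ m"
        by (simp only: fls_const_eq_iff)
      moreover have "c i \<noteq> c j" if "j \<in> {0..s} - {i}" for j
        using that assms c_inj by (auto dest: inj_onD)
      ultimately show ?thesis by auto
    qed
  qed
qed

lemma num_subdegree:
  assumes "num co xi yi zi \<noteq> 0"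
  shows "fls_subdegree (num co xi yi zi) \<ge> - int N"
proof -
  obtain u where u: "u \<in> basis N" "to_ac (co u) \<noteq> (0 :: 'k alg_closure)"
    using assms unfolding num_inf by (metis (no_types, lifting) fls_const_0 mult_zero_left sum.neutral)
  obtain u0 where u0: "u0 \<in> basis N" "to_ac (co u0) \<noteq> (0 :: 'k alg_closure)"
    "\<And>u. u \<in> basis N \<Longrightarrow> to_ac (co u) \<noteq> (0 :: 'k alg_closure) \<Longrightarrow>
      fls_subdegree (mono_inf u0) \<le> fls_subdegree (mono_inf u)"
    using fls_combination_min[OF finite_basis, of u N "\<lambda>u. to_ac (co u)" mono_inf] u by blast
  have "fls_subdegree (num co xi yi zi) = fls_subdegree (mono_inf u0)"
    unfolding num_inf
    by (rule fls_combination_subdegree(1)[where c = "\<lambda>u. to_ac (co u)" and g = mono_inf])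
       (use u0 mono_inf_nz inj_on_subset[OF mono_inf_inj_on basis_subset_box] in auto)
  moreover have "fls_subdegree (mono_inf u0) \<ge> - int N"
    using u0(1) by (auto simp: basis_def mono_inf_subdegree simp flip: of_nat_mult of_nat_power)
  ultimately show ?thesis by simp
qed

lemma quotient_subdegree:
  assumes "num co xi yi zi \<noteq> 0"
  shows "fls_subdegree (num co xi yi zi / den xi yi zi) \<ge> 0"
  using num_subdegree[OF assms] fls_divide_subdegree[OF assms den_nz] by (simp add: den_inf)

lemma quotient_in_riemann_roch_space:
  "cls (num co xi yi zi / den xi yi zi) \<in> riemann_roch_space curve G"
proof (cases "num co xi yi zi = 0")
  case True
  then show ?thesis by (simp add: riemann_roch_space_def cls_zero)
next
  case False
  let ?\<phi> = "num co xi yi zi / den xi yi zi"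
  have nz: "?\<phi> \<noteq> 0" using False den_nz by simp
  have "cls ?\<phi> \<in> rational_functions curve"
  proof (rule homogenize_pair[OF rat_0 rat_add num_rat den_rat])
    fix d and A B :: "('k alg_closure, 4) mpoly"
    assume AB: "homogeneous d A" "homogeneous d B"
      "\<And>m. Poly_Mapping.lookup A m \<in> base" "\<And>m. Poly_Mapping.lookup B m \<in> base"
      and A: "\<And>x y z. eval_fls A (vector [x, y, z, 1]) = num co x y z"
      and B: "\<And>x y z. eval_fls B (vector [x, y, z, 1]) = den x y z"
    have "(A, B) \<in> cls ?\<phi>" using AB den_nz by (auto simp: cls_def fractions_iff A B)
    then show ?thesis
      using AB quotient_in_FF unfolding rational_functions_def carrier_function_field by blast
  qed
  moreover have "cls ?\<phi> \<noteq> \<zero>\<^bsub>function_field curve\<^esub>"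
    using cls_eq_iff[OF quotient_in_FF] nz by (simp add: cls_zero)
  moreover have "ord_at curve P (cls ?\<phi>) + Poly_Mapping.lookup G P \<ge> 0" if P: "P \<in> curve" for P
    using P
  proof (cases rule: curve_cases)
    case (affine a b z)
    show ?thesis
    proof (cases "P \<in> poles")
      case True
      then obtain i where i: "i \<le> s" "z = to_ac (c i)" using affine poles_iff by auto
      obtain h where h: "h \<in> PF" "\<And>x y z. den x y z = (z - fls_const (to_ac (c i))) ^ m * h x y z"
        "\<And>a b. pval h a b (to_ac (c i)) \<noteq> 0" using den_split[OF i(1)] by blast
      have "?\<phi> * (zi - fls_const z) ^ m = num co xi yi zi / h xi yi zi"
        using zi_minus_const_nz by (simp add: h(2) i(2))
      also have "\<dots> \<in> loc a b z"
        unfolding loc_def mem_Collect_eq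
        by (rule exI[of _ "num co"], rule exI[of _ h]) (use h num_PF i in simp)
      finally have "ord_at curve P (cls ?\<phi>) \<ge> - int m"
        using ord_affine_ge[OF affine(1) quotient_in_FF nz] affine(2) by simp
      then show ?thesis using True by (simp add: lookup_G)
    next
      case False
      then have "\<forall>i\<le>s. z \<noteq> to_ac (c i)" using affine poles_iff by auto
      then have "?\<phi> \<in> loc a b z"
        unfolding loc_def mem_Collect_eq
        by (intro exI[of _ "num co"] exI[of _ den] conjI refl num_PF den_PF pval_den_nz)
      then have "ord_at curve P (cls ?\<phi>) \<ge> - int 0"
        using ord_affine_ge[OF affine(1) quotient_in_FF nz, of 0] affine(2) by simp
      then show ?thesis using False by (simp add: lookup_G)
    qed
  next
    case inf
    then show ?thesis
      using ord_inf[OF quotient_in_FF nz] quotient_subdegree[OF False] inf_notin_poles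
      by (simp add: lookup_G)
  qed
  ultimately show ?thesis by (simp add: riemann_roch_space_def)
qed

lemma polyfun_frobenius:
  assumes "g \<in> polyfun base"
  shows "g (x ^ q ^ 6) (y ^ q ^ 6) (z ^ q ^ 6) = g x y z ^ (q ^ 6)"
  using assms
proof induction
  case (monomial a i j k)
  have "fls_const a ^ q ^ 6 = fls_const a"
    using frob_rat[OF monomial] by (simp add: fls_const_power[symmetric])
  then show ?case by (simp add: power_mult_distrib power_mult[symmetric] mult.commute)
next
  case (add g h)
  then show ?case by (simp add: frobenius_fls)
qed

lemma gk_rel_frobenius: "gk_rel q (xi ^ q ^ 6) (yi ^ q ^ 6) (zi ^ q ^ 6)"
proof -
  have "(yi ^ (q + 1)) ^ q ^ 6 = (xi ^ q) ^ q ^ 6 + xi ^ q ^ 6"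
    using rel_inf frobenius_fls by (simp only: gk_rel_def)
  moreover have "(zi ^ (q\<^sup>2 - q + 1)) ^ q ^ 6 + yi ^ q ^ 6 = (yi ^ q\<^sup>2) ^ q ^ 6"
    using rel_inf frobenius_fls[of "yi ^ q\<^sup>2 - yi" yi 6] by (simp add: gk_rel_def)
  ultimately show ?thesis
    unfolding gk_rel_def power_mult[symmetric] mult.commute[of "q ^ 6"]
    by (simp add: eq_diff_eq)
qed

text \<open>
  A basis expansion of a function with rational coefficients is rational: the coefficients are
  fixed by the Frobenius map, as comparison with the \<open>q^6\<close>-th power of the function shows.
\<close>

lemma expansion_rational:
  assumes g: "g \<in> PF" and \<alpha>: "\<alpha> \<in> polyfun base" and \<beta>: "\<beta> \<in> polyfun base"
    and nz: "\<beta> xi yi zi \<noteq> 0" and eq: "g xi yi zi * \<beta> xi yi zi = \<alpha> xi yi zi"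
    and co: "\<And>x y z. gk_rel q x y z \<Longrightarrow>
      g x y z = (\<Sum>(i, j, k)\<in>basis M. fls_const (co (i, j, k)) * (x ^ i * y ^ j * z ^ k))"
    and u: "u \<in> basis M"
  shows "co u \<in> base"
proof -
  let ?Q = "q ^ 6"
  let ?g = "\<lambda>u. mono_inf u ^ ?Q"
  have PF: "\<alpha> \<in> PF" "\<beta> \<in> PF" using \<alpha> \<beta> polyfun_UNIV by blast+
  have "(\<lambda>x y z. g x y z * \<beta> x y z) \<in> PF" using polyfun_mult[OF _ g PF(2)] by simp
  from polyfun_eq[OF this PF(1) eq gk_rel_frobenius]
  have "g (xi ^ ?Q) (yi ^ ?Q) (zi ^ ?Q) * \<beta> xi yi zi ^ ?Q = \<alpha> xi yi zi ^ ?Q"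
    by (simp only: polyfun_frobenius[OF \<alpha>] polyfun_frobenius[OF \<beta>])
  also have "\<dots> = g xi yi zi ^ ?Q * \<beta> xi yi zi ^ ?Q" by (simp only: eq[symmetric] power_mult_distrib)
  finally have gQ: "g (xi ^ ?Q) (yi ^ ?Q) (zi ^ ?Q) = g xi yi zi ^ ?Q" using nz by simp
  have 1: "g (xi ^ ?Q) (yi ^ ?Q) (zi ^ ?Q) = (\<Sum>u\<in>basis M. fls_const (co u) * ?g u)"
    unfolding co[OF gk_rel_frobenius]
    by (intro sum.cong refl)
       (simp add: case_prod_unfold power_mult_distrib power_mult[symmetric] mult.commute)
  have 2: "g xi yi zi ^ ?Q = (\<Sum>u\<in>basis M. fls_const (co u ^ ?Q) * ?g u)"
    unfolding co[OF rel_inf] frobenius_fls_sum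
    by (intro sum.cong refl) (simp add: case_prod_unfold power_mult_distrib fls_const_power)
  have "(\<Sum>u\<in>basis M. fls_const (co u - co u ^ ?Q) * ?g u) = 0"
    using gQ unfolding 1 2 by (simp add: fls_const_diff left_diff_distrib sum_subtractf)
  moreover have "inj_on (\<lambda>u. fls_subdegree (?g u)) (basis M)"
  proof (rule inj_onI)
    fix u v assume uv: "u \<in> basis M" "v \<in> basis M" "fls_subdegree (?g u) = fls_subdegree (?g v)"
    have "int ?Q \<noteq> 0" using q_ge2 by simp
    then have "fls_subdegree (mono_inf u) = fls_subdegree (mono_inf v)"
      using uv(3) unfolding fls_subdegree_pow mult_cancel_left by blast
    then show "u = v" using uv basis_subset_box mono_inf_inj by blast
  qed
  moreover have "?g u \<noteq> 0" for u using mono_inf_nz[of u] by (simp only: power_eq_0_iff) simp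
  ultimately have "co u - co u ^ ?Q = 0"
    using u by (intro fls_combination_independent[OF finite_basis[of M], where g = ?g]) auto
  then show ?thesis using range_to_ac_iff[of "co u"] card_k by simp
qed

lemma riemann_roch_space_quotient:
  assumes f: "f \<in> riemann_roch_space curve G"
  obtains co where "f = cls (num co xi yi zi / den xi yi zi)"
proof (cases "f = \<zero>\<^bsub>function_field curve\<^esub>")
  case True
  have "num (\<lambda>_. 0) xi yi zi = 0" by (simp add: num_inf)
  then show ?thesis using True that[of "\<lambda>_. 0"] by (simp add: cls_zero)
next
  case False
  then have rf: "f \<in> rational_functions curve"
    and ord: "\<And>P. P \<in> curve \<Longrightarrow> ord_at curve P f + Poly_Mapping.lookup G P \<ge> 0"
    using f by (auto simp: riemann_roch_space_def)
  obtain A B where AB: "(A, B) \<in> f" "\<And>m. Poly_Mapping.lookup A m \<in> base"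
    "\<And>m. Poly_Mapping.lookup B m \<in> base" and "f \<in> carrier (function_field curve)"
    using rf by (auto simp: rational_functions_def)
  then obtain \<phi> where \<phi>: "\<phi> \<in> FF" "f = cls \<phi>" by (auto simp: carrier_function_field)
  have \<phi>nz: "\<phi> \<noteq> 0" using False \<phi> cls_zero by auto
  have Bnz: "eval_fls B gen \<noteq> 0" and \<phi>eq: "\<phi> = eval_fls A gen / eval_fls B gen"
    using AB(1) unfolding \<phi>(2) by (auto simp: cls_def fractions_iff)
  define \<alpha> where "\<alpha> = (\<lambda>x y z. eval_fls A (vector [x, y, z, 1]))"
  define \<beta> where "\<beta> = (\<lambda>x y z. eval_fls B (vector [x, y, z, 1]))"
  have \<alpha>: "\<alpha> \<in> polyfun base" and \<beta>: "\<beta> \<in> polyfun base"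
    unfolding \<alpha>_def \<beta>_def by (intro dehomogenize AB rat_0)+
  have \<beta>nz: "\<beta> xi yi zi \<noteq> 0" and \<phi>q: "\<phi> = \<alpha> xi yi zi / \<beta> xi yi zi"
    using Bnz \<phi>eq by (simp_all add: \<alpha>_def \<beta>_def)
  define \<psi> where "\<psi> = \<phi> * den xi yi zi"
  have \<alpha>den: "(\<lambda>x y z. \<alpha> x y z * den x y z) \<in> polyfun base"
    by (intro polyfun_mult \<alpha> den_rat rat_mult)
  have reg: "\<psi> \<in> loc a b z" if rel: "gk_rel q a b z" for a b z
  proof (cases "affine_pt a b z \<in> poles")
    case True
    then obtain i where i: "i \<le> s" "z = to_ac (c i)" using poles_iff by auto
    obtain h where h: "h \<in> PF" "\<And>x y z. den x y z = (z - fls_const (to_ac (c i))) ^ m * h x y z"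
      "\<And>a b. pval h a b (to_ac (c i)) \<noteq> 0" using den_split[OF i(1)] by blast
    have "ord_at curve (affine_pt a b z) (cls \<phi>) \<ge> - int m"
      using ord[OF affine_pt_in_curve[OF rel]] True \<phi>(2) by (simp add: lookup_G)
    then have "\<phi> * (zi - fls_const z) ^ m \<in> loc a b z"
      using ord_affine_ge[OF rel \<phi>(1) \<phi>nz] by blast
    then have "(\<phi> * (zi - fls_const z) ^ m) * h xi yi zi \<in> loc a b z"
      using loc_mult[OF rel] polyfun_in_loc[OF h(1)] by blast
    then show ?thesis by (simp add: \<psi>_def h(2) i(2) mult.assoc)
  next
    case False
    have "ord_at curve (affine_pt a b z) (cls \<phi>) \<ge> - int 0"
      using ord[OF affine_pt_in_curve[OF rel]] False \<phi>(2) by (simp add: lookup_G)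
    then have "\<phi> * (zi - fls_const z) ^ 0 \<in> loc a b z"
      using ord_affine_ge[OF rel \<phi>(1) \<phi>nz] by blast
    then have "\<phi> \<in> loc a b z" by simp
    then show ?thesis
      unfolding \<psi>_def using loc_mult[OF rel] polyfun_in_loc[OF den_PF] by blast
  qed
  have "\<psi> = (\<lambda>x y z. \<alpha> x y z * den x y z) xi yi zi / \<beta> xi yi zi" by (simp add: \<psi>_def \<phi>q)
  then obtain g where g: "g \<in> PF" "\<psi> = g xi yi zi"
    using regular_on_affine[OF _ polyfun_UNIV[OF \<alpha>den] polyfun_UNIV[OF \<beta>] \<beta>nz reg] by blast
  have "fls_subdegree \<phi> \<ge> 0"
    using ord[OF inf_pt_in_curve] ord_inf[OF \<phi>(1) \<phi>nz] \<phi>(2) inf_notin_poles by (simp add: lookup_G)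
  then have "- int N \<le> fls_subdegree (g xi yi zi)"
    unfolding g(2)[symmetric] \<psi>_def using \<phi>nz den_nz by (simp add: den_inf)
  then obtain co where co: "\<And>x y z. gk_rel q x y z \<Longrightarrow>
      g x y z = (\<Sum>(i, j, k)\<in>basis N. fls_const (co (i, j, k)) * (x ^ i * y ^ j * z ^ k))"
    using basis_expansion[OF g(1)] by blast
  have eq: "g xi yi zi * \<beta> xi yi zi = (\<lambda>x y z. \<alpha> x y z * den x y z) xi yi zi"
    using \<beta>nz by (simp add: g(2)[symmetric] \<psi>_def \<phi>q)
  have rat: "co u \<in> base" if "u \<in> basis N" for u
    using expansion_rational[OF g(1) \<alpha>den \<beta> \<beta>nz eq co that] .
  define co' where "co' = (\<lambda>u. of_ac (co u))"
  have "num co' xi yi zi = g xi yi zi"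
    unfolding num_def co[OF rel_inf]
    by (intro sum.cong refl) (auto simp: co'_def to_ac_of_ac[OF rat])
  then have "num co' xi yi zi / den xi yi zi = \<phi>"
    using den_nz by (simp add: g(2)[symmetric] \<psi>_def)
  then show ?thesis using that[of co'] \<phi>(2) by simp
qed

subsection \<open>The dimension of the code\<close>

text \<open>The code word of a basis monomial.\<close>

definition word :: "nat \<times> nat \<times> nat \<Rightarrow> ('k alg_closure, 4) point \<Rightarrow> 'k" where
  "word u P = (if P \<in> evals then of_ac (value_at P (cls (mono_inf u / den xi yi zi))) else 0)"

lemma mono_num: assumes "u \<in> basis N" shows "num (\<lambda>w. if w = u then 1 else 0) xi yi zi = mono_inf u"
proof -
  have "num (\<lambda>w. if w = u then 1 else 0) xi yi zi = (\<Sum>w\<in>basis N. if w = u then mono_inf u else 0)"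
    unfolding num_inf by (intro sum.cong refl) auto
  then show ?thesis using assms by simp
qed

lemma value_quotient:
  assumes P: "P \<in> evals"
  shows "value_at P (cls (num co xi yi zi / den xi yi zi)) = to_ac (\<Sum>u\<in>basis N. co u * word u P)"
proof -
  have "P \<in> curve" using P by (simp add: evals_def rational_points_def)
  then have "\<exists>v. (\<forall>u\<in>basis N. v u \<in> base) \<and> (\<forall>co.
      value_at P (cls (num co xi yi zi / den xi yi zi)) = (\<Sum>u\<in>basis N. to_ac (co u) * v u))"
  proof (cases rule: curve_cases)
    case (affine a b z)
    have ev: "a \<in> base" "b \<in> base" "z \<in> base" "\<forall>i\<le>s. z \<noteq> to_ac (c i)"
      using P affine_in_evals_iff[OF affine(1)] affine(2) by blast+
    define v where "v = (\<lambda>(i, j, k). a ^ i * b ^ j * z ^ k / pval den a b z)"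
    have "pval den a b z \<in> base"
      unfolding pval_den by (intro rat_power rat_prod rat_diff ev rangeI)
    then have "\<forall>u\<in>basis N. v u \<in> base"
      unfolding v_def by (auto intro!: rat_divide rat_mult rat_power ev)
    moreover have "value_at P (cls (num co xi yi zi / den xi yi zi))
        = (\<Sum>u\<in>basis N. to_ac (co u) * v u)" for co
      unfolding affine(2) value_affine[OF affine(1) num_PF den_PF pval_den_nz[OF ev(4)]] pval_num
      by (simp add: sum_divide_distrib v_def case_prod_unfold)
    ultimately show ?thesis by blast
  next
    case inf
    define v where "v = (\<lambda>u. fls_nth (mono_inf u / den xi yi zi) 0)"
    have "\<forall>u\<in>basis N. v u \<in> base" using mono_den_value by (simp add: v_def)
    moreover have "value_at P (cls (num co xi yi zi / den xi yi zi))
        = (\<Sum>u\<in>basis N. to_ac (co u) * v u)" for co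
    proof -
      have "num co xi yi zi / den xi yi zi = 0 \<or> fls_subdegree (num co xi yi zi / den xi yi zi) \<ge> 0"
        using quotient_subdegree by (cases "num co xi yi zi = 0") auto
      then have "value_at P (cls (num co xi yi zi / den xi yi zi))
          = fls_nth (num co xi yi zi / den xi yi zi) 0"
        using value_inf[OF quotient_in_FF] inf by simp
      also have "\<dots> = (\<Sum>u\<in>basis N. to_ac (co u) * v u)"
      proof -
        have expand: "num co xi yi zi / den xi yi zi
            = (\<Sum>u\<in>basis N. fls_const (to_ac (co u)) * (mono_inf u / den xi yi zi))"
          unfolding num_inf by (simp add: sum_divide_distrib)
        have "fls_nth (\<Sum>u\<in>S. fls_const (to_ac (co u)) * f u) 0
            = (\<Sum>u\<in>S. to_ac (co u) * fls_nth (f u) 0)" for S f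
          by (induction S rule: infinite_finite_induct) simp_all
        then show ?thesis by (simp only: v_def expand)
      qed
      finally show ?thesis .
    qed
    ultimately show ?thesis by blast
  qed
  then obtain v where v: "\<And>u. u \<in> basis N \<Longrightarrow> v u \<in> base" "\<And>co.
      value_at P (cls (num co xi yi zi / den xi yi zi)) = (\<Sum>u\<in>basis N. to_ac (co u) * v u)"
    by blast
  have "to_ac (word u P) = v u" if u: "u \<in> basis N" for u
  proof -
    have "value_at P (cls (mono_inf u / den xi yi zi))
        = (\<Sum>w\<in>basis N. to_ac (if w = u then 1 else 0) * v w)"
      using v(2)[of "\<lambda>w. if w = u then 1 else 0"] mono_num[OF u] by simp
    also have "\<dots> = (\<Sum>w\<in>basis N. if w = u then v u else 0)" by (intro sum.cong refl) auto
    also have "\<dots> = v u" using u by simp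
    finally show ?thesis using P v(1)[OF u] by (simp add: word_def to_ac_of_ac)
  qed
  then show ?thesis unfolding v(2) by (simp add: to_ac_sum)
qed

lemma code_combinations:
  "functional_code curve D G = {\<Sum>u\<in>basis N. (\<lambda>P. co u * word u P) | co. True}"
proof -
  have w: "(\<lambda>P. if P \<in> Poly_Mapping.keys D then of_ac (value_at P (cls (num co xi yi zi / den xi yi zi)))
      else 0) = (\<Sum>u\<in>basis N. (\<lambda>P. co u * word u P))" for co
  proof
    fix P
    show "(if P \<in> Poly_Mapping.keys D then of_ac (value_at P (cls (num co xi yi zi / den xi yi zi)))
      else 0) = (\<Sum>u\<in>basis N. (\<lambda>P. co u * word u P)) P"
      by (simp add: keys_D sum_fun_apply value_quotient) (simp add: word_def)
  qed
  have RR: "riemann_roch_space curve G = range (\<lambda>co. cls (num co xi yi zi / den xi yi zi))"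
    using quotient_in_riemann_roch_space riemann_roch_space_quotient by blast
  show ?thesis unfolding functional_code_def RR image_image w by blast
qed

text \<open>
  A function in the Riemann-Roch space that vanishes at all evaluation points is divisible by
  \<open>z - d\<close> for all the remaining \<open>d \<in> \<Gamma>\<^sub>0\<close> and vanishes at infinity, which leaves no room for it.
\<close>

lemma words_independent:
  assumes zero: "(\<Sum>u\<in>basis N. (\<lambda>P. co u * word u P)) = 0" and u: "u \<in> basis N"
  shows "co u = 0"
proof -
  have vals: "value_at P (cls (num co xi yi zi / den xi yi zi)) = 0" if "P \<in> evals" for P
  proof -
    have "(\<Sum>u\<in>basis N. co u * word u P) = 0"
      using fun_cong[OF zero, of P] by (simp add: sum_fun_apply)
    then show ?thesis using value_quotient[OF that] by simp
  qed
  have "num co xi yi zi = 0"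
  proof (rule ccontr)
    assume nz: "num co xi yi zi \<noteq> 0"
    define S where "S = (to_ac :: 'k \<Rightarrow> _) ` (GK_Gamma0 q - c ` {0..s})"
    have "pval (num co) a b d = 0" if d: "d \<in> S" and rel: "gk_rel q a b d" for a b d
    proof -
      obtain d' where d': "d = to_ac d'" "d' \<in> GK_Gamma0 q" "d' \<notin> c ` {0..s}" using d by (auto simp: S_def)
      have ne: "\<forall>i\<le>s. d \<noteq> to_ac (c i)" using d' by auto
      then have "affine_pt a b d \<in> evals"
        using fibre_points_rational[OF d'(2)] rel d'(1) by (auto simp: affine_in_evals_iff)
      then have "pval (num co) a b d / pval den a b d = 0"
        using vals value_affine[OF rel num_PF den_PF pval_den_nz[OF ne]] by metis
      then show ?thesis using pval_den_nz[OF ne] by simp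
    qed
    moreover have "finite S" by (simp add: S_def)
    ultimately obtain g where g: "g \<in> PF" "num co xi yi zi = (\<Prod>d\<in>S. zi - fls_const d) * g xi yi zi"
      using fibres_divisible[of S, OF _ num_PF] by blast
    have gnz: "g xi yi zi \<noteq> 0" using nz g by auto
    have "fls_subdegree (\<Prod>d\<in>S. zi - fls_const d) = - (int (card S) * int (q ^ 3))"
    proof -
      have "fls_subdegree (\<Prod>d\<in>T. zi - fls_const d) = - (int (card T) * int (q ^ 3))"
        if "finite T" for T
        using that
      proof (induction T rule: finite_induct)
        case (insert d T)
        have "(\<Prod>d\<in>T. zi - fls_const d) \<noteq> 0" using zi_minus_const_nz insert.hyps by simp
        then have "fls_subdegree (\<Prod>d\<in>insert d T. zi - fls_const d)
            = - int (q ^ 3) + - (int (card T) * int (q ^ 3))"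
          using zi_minus_const_nz[of d]
          by (simp only: prod.insert[OF insert.hyps] fls_subdegree_mult zi_const_lead(1) insert.IH
              simp_thms)
        then show ?case by (simp add: insert.hyps distrib_right)
      qed simp
      then show ?thesis by (simp add: S_def)
    qed
    moreover have "(\<Prod>d\<in>S. zi - fls_const d) \<noteq> 0" using nz g by auto
    ultimately have "fls_subdegree (num co xi yi zi) \<le> - (int (card S) * int (q ^ 3))"
      using polyfun_subdegree_le[OF g(1) gnz] gnz unfolding g(2) by simp
    moreover have "fls_subdegree (num co xi yi zi) > - int N"
    proof -
      let ?\<phi> = "num co xi yi zi / den xi yi zi"
      have \<phi>nz: "?\<phi> \<noteq> 0" using nz den_nz by simp
      have "fls_nth ?\<phi> 0 = 0"
        using vals[OF inf_in_evals] value_inf[OF quotient_in_FF] quotient_subdegree[OF nz] by simp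
      then have "fls_subdegree ?\<phi> \<noteq> 0" using nth_fls_subdegree_nonzero[OF \<phi>nz] by metis
      then have "fls_subdegree ?\<phi> > 0" using quotient_subdegree[OF nz] by linarith
      then show ?thesis using fls_divide_subdegree[OF nz den_nz] by (simp add: den_inf)
    qed
    ultimately have "int (card S * q ^ 3) < int N" by simp
    then have "card S * q ^ 3 < m * (s + 1) * q ^ 3" by (simp only: of_nat_less_iff)
    then have lt: "card S < m * (s + 1)" unfolding mult_less_cancel2 by blast
    have "card S = card (GK_Gamma0 q - c ` {0..s} :: 'k set)"
      unfolding S_def by (rule card_image[OF inj_on_subset[OF inj_to_ac]]) simp
    also have "\<dots> = card (GK_Gamma0 q :: 'k set) - card (c ` {0..s})"
      using c_Gamma by (intro card_Diff_subset) auto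
    also have "card (c ` {0..s}) = s + 1" using card_image[OF c_inj] by simp
    finally have "card S + (s + 1) \<ge> card (GK_Gamma0 q :: 'k set)" by linarith
    moreover have "card (GK_Gamma0 q :: 'k set) + q ^ 3 \<ge> q ^ 5 + q\<^sup>2"
      by (rule card_Gamma0_ge[OF q_ge2 frob1_k card_k])
    ultimately show False using upper lt by simp
  qed
  then have "(\<Sum>u\<in>basis N. fls_const (to_ac (co u)) * mono_inf u) = 0" by (simp only: num_inf)
  then have "to_ac (co u) = (0 :: 'k alg_closure)"
    using u mono_inf_nz inj_on_subset[OF mono_inf_inj_on basis_subset_box]
    by (intro fls_combination_independent[OF finite_basis[of N], where g = mono_inf]) auto
  then show ?thesis by simp
qed

lemma code_dimension_eq: "code_dimension (functional_code curve D G) = card (basis N)"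
  unfolding code_dimension_def code_combinations
  by (rule vector_space.dim_combinations[OF vector_space_words finite_basis])
     (use words_independent in blast)

end

theorem proposition4p6:
  fixes q m s :: nat
    and c :: "nat \<Rightarrow> 'k::{field, finite}"
    and \<X> \<G> \<D> :: "('k alg_closure, 4) point set"
    and G D :: "('k alg_closure, 4) divisor"
  assumes "primepow q"
    and "CARD('k) = q ^ 6"
    and "c 0 = 0"
    and "inj_on c {0..s}"
    and "c ` {0..s} \<subseteq> GK_Gamma0 q"
    and "\<X> = GK_curve q"
    and "\<G> = (\<Union>i\<in>{0..s}. \<X> \<inter> plane_Z (to_ac (c i))) - {GK_infinity q}"
    and "\<D> = rational_points \<X> - \<G>"
    and "G = (\<Sum>P\<in>\<G>. Poly_Mapping.single P (int m))"
    and "D = (\<Sum>P\<in>\<D>. Poly_Mapping.single P 1)"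
    and "(real q ^ 5 - 2 * real q ^ 3 + real q ^ 2 - 1) / ((real s + 1) * real q ^ 3) \<le> real m"
    and "real m \<le> (real q ^ 5 - real q ^ 3 + real q ^ 2) / (real s + 1) - 1"
  shows "real (code_dimension (functional_code \<X> D G)) =
    real m * (real s + 1) * real q ^ 3
      - 1 / 2 * (real q ^ 5 - 2 * real q ^ 3 + real q ^ 2 - 2)"
proof -
  obtain e where char: "prime CHAR('k)" "q = CHAR('k) ^ e"
    using finite_field_characteristic[OF assms(1,2)] .
  have q: "q \<ge> 2"
    using assms(1) primepow_gt_Suc_0[of q] by simp
  have q0: "of_nat q = (0 :: 'k alg_closure)"
  proof -
    have "of_nat CHAR('k) = (0 :: 'k alg_closure)"
      using of_nat_CHAR[where ?'a = "'k alg_closure"] by simp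
    then show ?thesis using char q by (cases e) simp_all
  qed
  have n1: "of_nat (q + 1) \<noteq> (0 :: 'k alg_closure)" using q0 by simp
  have "of_nat (q\<^sup>2 - q + 1 + q) = (of_nat (q\<^sup>2 + 1) :: 'k alg_closure)"
    by (simp only: gk_exponents(2)[OF q])
  then have n2: "of_nat (q\<^sup>2 - q + 1) \<noteq> (0 :: 'k alg_closure)"
    by (simp add: q0 power2_eq_square del: of_nat_Suc of_nat_diff) (use q0 in simp)
  obtain xi yi zi :: "'k alg_closure fls" where series: "gk_rel q xi yi zi"
    "fls_subdegree xi = - int (q ^ 3 + 1)" "fls_nth xi (- int (q ^ 3 + 1)) = 1"
    "fls_subdegree yi = - int (q * (q\<^sup>2 - q + 1))" "fls_nth yi (- int (q * (q\<^sup>2 - q + 1))) = 1"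
    "fls_subdegree zi = - int (q ^ 3)" "fls_nth zi (- int (q ^ 3)) = 1"
    using gk_series_exist[OF q n1 n2] by blast
  have s0: "real s + 1 > 0" by simp
  have lower: "real q ^ 5 - 2 * real q ^ 3 + real q ^ 2 - 1 \<le> real m * ((real s + 1) * real q ^ 3)"
    using assms(11) q by (simp add: pos_divide_le_eq)
  have "(real m + 1) * (real s + 1) \<le> real q ^ 5 - real q ^ 3 + real q ^ 2"
    using assms(12) s0 by (simp add: le_diff_eq pos_le_divide_eq)
  then have "real ((m + 1) * (s + 1) + q ^ 3) \<le> real (q ^ 5 + q\<^sup>2)"
    by (simp add: algebra_simps)
  then have upper: "(m + 1) * (s + 1) + q ^ 3 \<le> q ^ 5 + q\<^sup>2" by (simp only: of_nat_le_iff)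
  interpret gk_code q e xi yi zi m s c
    by unfold_locales (use q char series assms(2,4,5) upper in simp_all)
  have plane: "affine_pt a b z \<in> plane_Z w \<longleftrightarrow> z = w" for a b z w :: "'k alg_closure"
  proof
    assume "affine_pt a b z \<in> plane_Z w"
    then have "\<forall>v\<in>affine_pt a b z. v $ 3 = w * v $ 4" by (simp add: plane_Z_def)
    moreover have "vector [a, b, z, 1] \<in> affine_pt a b z" unfolding affine_pt_def by (rule self_in_pt) simp
    ultimately have "(vector [a, b, z, 1] :: 'k alg_closure ^ 4) $ 3 = w * (vector [a, b, z, 1] :: 'k alg_closure ^ 4) $ 4"
      by blast
    then show "z = w" by simp
  next
    assume "z = w"
    then show "affine_pt a b z \<in> plane_Z w"
      using pt_in_proj_space[OF affine_vec_nz, of a b z]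
      by (auto simp: plane_Z_def affine_pt_def in_pt_iff)
  qed
  have G: "\<G> = poles"
  proof (intro equalityI subsetI)
    fix P assume P: "P \<in> \<G>"
    then obtain i where i: "i \<le> s" "P \<in> plane_Z (to_ac (c i))" "P \<noteq> inf_pt" and "P \<in> curve"
      unfolding assms(6,7) GK_infinity_eq by fastforce
    from \<open>P \<in> curve\<close> show "P \<in> poles"
    proof (cases rule: curve_cases)
      case (affine a b z)
      then show ?thesis using i plane by (auto simp: poles_iff)
    qed (use i in simp)
  next
    fix P assume "P \<in> poles"
    then obtain a b i where P: "P = affine_pt a b (to_ac (c i))" "i \<le> s" "gk_rel q a b (to_ac (c i))"
      by (auto simp: poles_def)
    have "P \<in> curve" "P \<in> plane_Z (to_ac (c i))" "P \<noteq> inf_pt"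
      using affine_pt_in_curve[OF P(3)] plane affine_pt_neq_inf unfolding P(1) by simp_all
    then show "P \<in> \<G>" unfolding assms(6,7) GK_infinity_eq using P(2) by auto
  qed
  have "\<D> = evals" unfolding assms(6,8) G evals_def by simp
  then have "code_dimension (functional_code \<X> D G) = card (basis (m * (s + 1) * q ^ 3))"
    using code_dimension_eq unfolding assms(6,9,10) G gk_code.G_def[OF gk_code_axioms] gk_code.D_def[OF gk_code_axioms] by simp
  moreover have "2 * int (card (basis (m * (s + 1) * q ^ 3)))
      = 2 * int (q ^ 3) * (int (m * (s + 1)) + 1) - (int q ^ 5 + int q ^ 2 - 2)"
  proof (rule card_basis)
    have "real (q ^ 5 + q\<^sup>2) \<le> real ((m * (s + 1) + 2) * q ^ 3 + 1)"
      using lower by (simp add: algebra_simps)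
    then show "q ^ 5 + q\<^sup>2 \<le> (m * (s + 1) + 2) * q ^ 3 + 1" by (simp only: of_nat_le_iff)
  qed
  then have "real_of_int (2 * int (card (basis (m * (s + 1) * q ^ 3))))
      = real_of_int (2 * int (q ^ 3) * (int (m * (s + 1)) + 1) - (int q ^ 5 + int q ^ 2 - 2))"
    by (simp only:)
  then have "2 * real (card (basis (m * (s + 1) * q ^ 3)))
      = 2 * real q ^ 3 * (real m * (real s + 1) + 1) - (real q ^ 5 + real q ^ 2 - 2)"
    by (simp add: algebra_simps)
  ultimately show ?thesis by (simp add: algebra_simps)
qed

end
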